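(* Let $(M,c)$ be a conformal manifold of signature $(p,q)$ and dimension $n=p+q\geq 3$, with standard tractor bundle $\mathcal{T}(M)$ and normal conformal tractor connection $\nabla^{nc}$. Let $\mathcal{H}\subset\mathcal{T}(M)$ be a totally lightlike distribution (vector subbundle) of rank $k\geq 1$ which is parallel with respect to $\nabla^{nc}$. Then there is an open, dense subset $\widetilde{M}\subset M$ such that for every $x\in\widetilde{M}$ there are an open neighborhood $U_x\subset\widetilde{M}$ of $x$ and a metric $g\in c_{|U_x}$ such that, with respect to the splitting $\mathcal{T}(U_x)\stackrel{g}{\cong}\underline{\mathbb{R}}\oplus TU_x\oplus\underline{\mathbb{R}}$ determined by $g$, $$\mathcal{H}_{|U_x}\stackrel{g}{=}\operatorname{span}\left(\begin{pmatrix} 0 \\ {K_1} \\ 0 \end{pmatrix},\dots,\begin{pmatrix} 0 \\ {K_{k-1}} \\ 0 \end{pmatrix},\begin{pmatrix} 0 \\ 0 \\ 1 \end{pmatrix}\right)$$ for certain lightlike vector fields $K_1,\dots,K_{k-1}\in\mathfrak{X}(U_x)$.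
   Context: Manifolds are connected; conformal structures are space- and time-oriented. For $g\in c$ the standard tractor bundle $\mathcal{T}(M)$ (rank $n+2$) is identified with $\underline{\mathbb{R}}\oplus TM\oplus\underline{\mathbb{R}}$, its sections being written as triples $(\alpha,Y,\beta)$ with $\alpha,\beta\in C^\infty(M)$, $Y\in\mathfrak{X}(M)$. For $\widetilde g=e^{2\sigma}g$ the triples representing the same tractor are related by $$\widetilde\alpha=e^{-\sigma}\left(\alpha-Y(\sigma)-\tfrac12\beta\|\operatorname{grad}^g\sigma\|_g^2\right),\quad \widetilde Y=e^{-\sigma}(Y+\beta\operatorname{grad}^g\sigma),\quad \widetilde\beta=e^{\sigma}\beta .$$ The bundle metric of signature $(p+1,q+1)$ is $\langle(\alpha_1,Y_1,\beta_1),(\alpha_2,Y_2,\beta_2)\rangle=\alpha_1\beta_2+\alpha_2\beta_1+g(Y_1,Y_2)$ and the normal conformal (metric) connection is $$\nabla^{nc}_X(\alpha,Y,\beta)=\left(X(\alpha)+K^g(X,Y),\ \nabla^g_XY+\alpha X-\beta K^g(X)^\sharp,\ X(\beta)-g(X,Y)\right),$$ where $K^g=\frac{1}{n-2}\left(\frac{scal^g}{2(n-1)}g-Ric^g\right)$. "Totally lightlike" means that the metric restricted to each fibre of the distribution vanishes identically. *)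

theory Defs
  imports "HOL-Analysis.Analysis" "HOL-Library.Function_Algebras" "HOL-Combinatorics.Permutations"
begin

(* Functions into a real vector space form a real vector space pointwise.  The fibres of the
   tangent and of the tractor bundle are sets of such functions, so that the library notions
   subspace, span and dim apply to them. *)

instantiation "fun" :: (type, real_vector) real_vector
begin

definition scaleR_fun_def: "scaleR r f = (\<lambda>x. r *\<^sub>R f x)"

instance
  by standard (auto simp: scaleR_fun_def fun_eq_iff scaleR_add_right scaleR_add_left)

end


section \<open>Smooth manifolds\<close>

text \<open>The differentiability classes are only used on open subsets of finite-dimensional spaces.\<close>

primrec Ck_on :: "nat \<Rightarrow> ('b::real_normed_vector \<Rightarrow> 'c::real_normed_vector) \<Rightarrow> 'b set \<Rightarrow> bool" where
  "Ck_on 0 f S \<longleftrightarrow> continuous_on S f"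
| "Ck_on (Suc k) f S \<longleftrightarrow> (\<forall>x\<in>S. f differentiable (at x)) \<and>
     (\<forall>v. Ck_on k (\<lambda>x. frechet_derivative f (at x) v) S)"

definition smooth_on :: "('b::real_normed_vector \<Rightarrow> 'c::real_normed_vector) \<Rightarrow> 'b set \<Rightarrow> bool" where
  "smooth_on f S \<longleftrightarrow> (\<forall>k. Ck_on k f S)"

text \<open>A chart is a pair of its domain and its coordinate map; only the values of the coordinate
  map on the domain matter.\<close>

type_synonym ('a, 'n) chart = "'a set \<times> ('a \<Rightarrow> real ^ 'n)"

definition chart_inv :: "('a, 'n) chart \<Rightarrow> real ^ 'n \<Rightarrow> 'a" where
  "chart_inv c = inv_into (fst c) (snd c)"

definition smooth_atlas :: "('a::topological_space, 'n::finite) chart set \<Rightarrow> bool" where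
  "smooth_atlas A \<longleftrightarrow>
     (\<Union>c\<in>A. fst c) = UNIV \<and>
     (\<forall>c\<in>A. open (fst c) \<and> open (snd c ` fst c) \<and>
        homeomorphism (fst c) (snd c ` fst c) (snd c) (chart_inv c)) \<and>
     (\<forall>c\<in>A. \<forall>d\<in>A. smooth_on (snd d \<circ> chart_inv c) (snd c ` (fst c \<inter> fst d)))"

text \<open>The manifold is the whole type \<open>'a\<close>, with a (not necessarily maximal) smooth atlas \<open>A\<close>
  modelled on \<open>real ^ 'n\<close>.\<close>

definition manifold :: "('a::{t2_space, second_countable_topology}, 'n::finite) chart set \<Rightarrow> bool" where
  "manifold A \<longleftrightarrow> connected (UNIV :: 'a set) \<and> smooth_atlas A"

definition smooth_map :: "('a, 'n::finite) chart set \<Rightarrow> 'a set \<Rightarrow> ('a \<Rightarrow> 'b::real_normed_vector) \<Rightarrow> bool" where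
  "smooth_map A U f \<longleftrightarrow> (\<forall>c\<in>A. smooth_on (f \<circ> chart_inv c) (snd c ` (U \<inter> fst c)))"

text \<open>An arbitrary chart around \<open>x\<close>, used below only for quantities that do not depend on the chart.\<close>

definition chart_at :: "('a, 'n) chart set \<Rightarrow> 'a \<Rightarrow> ('a, 'n) chart" where
  "chart_at A x = (SOME c. c \<in> A \<and> x \<in> fst c)"

text \<open>\<open>cderiv c f x w\<close> is the derivative of \<open>f\<close> at \<open>x\<close>, expressed in the chart \<open>c\<close>, in the
  direction with coordinates \<open>w\<close>.\<close>

definition cderiv :: "('a, 'n::finite) chart \<Rightarrow> ('a \<Rightarrow> 'b::real_normed_vector) \<Rightarrow> 'a \<Rightarrow> real ^ 'n \<Rightarrow> 'b" where
  "cderiv c f x w = frechet_derivative (f \<circ> chart_inv c) (at (snd c x)) w"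


section \<open>Tangent vectors and vector fields\<close>

text \<open>A tangent vector at \<open>x\<close> is the family of its coordinate vectors in all charts around \<open>x\<close>,
  which transform by the Jacobians of the coordinate changes.  It is extended by zero to all
  other pairs, so that a tangent vector is determined by its coordinates in any one chart.\<close>

type_synonym ('a, 'n) tvec = "('a, 'n) chart \<Rightarrow> real ^ 'n"

definition tangent_space :: "('a, 'n::finite) chart set \<Rightarrow> 'a \<Rightarrow> ('a, 'n) tvec set" where
  "tangent_space A x = {v.
     (\<forall>c. c \<notin> A \<or> x \<notin> fst c \<longrightarrow> v c = 0) \<and>
     (\<forall>c\<in>A. \<forall>d\<in>A. x \<in> fst c \<and> x \<in> fst d \<longrightarrow> v d = cderiv c (snd d) x (v c))}"

text \<open>The tangent vector at \<open>x\<close> with coordinates \<open>w\<close> in the chart \<open>c\<close>.  In particular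
  \<open>coord_vec A c (axis i 1)\<close> is the coordinate vector field belonging to the \<open>i\<close>-th coordinate.\<close>

definition coord_vec :: "('a, 'n::finite) chart set \<Rightarrow> ('a, 'n) chart \<Rightarrow> real ^ 'n \<Rightarrow> 'a \<Rightarrow> ('a, 'n) tvec" where
  "coord_vec A c w x = (\<lambda>d. if d \<in> A \<and> x \<in> fst d then cderiv c (snd d) x w else 0)"

definition smooth_vf :: "('a, 'n::finite) chart set \<Rightarrow> 'a set \<Rightarrow> ('a \<Rightarrow> ('a, 'n) tvec) \<Rightarrow> bool" where
  "smooth_vf A U X \<longleftrightarrow> (\<forall>x\<in>U. X x \<in> tangent_space A x) \<and>
     (\<forall>c\<in>A. smooth_map A (U \<inter> fst c) (\<lambda>x. X x c))"

definition dir_deriv :: "('a, 'n::finite) chart set \<Rightarrow> 'a \<Rightarrow> ('a, 'n) tvec \<Rightarrow> ('a \<Rightarrow> real) \<Rightarrow> real" where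
  "dir_deriv A x v f = cderiv (chart_at A x) f x (v (chart_at A x))"

definition lie_bracket :: "('a, 'n::finite) chart set \<Rightarrow> ('a \<Rightarrow> ('a, 'n) tvec) \<Rightarrow> ('a \<Rightarrow> ('a, 'n) tvec)
    \<Rightarrow> 'a \<Rightarrow> ('a, 'n) tvec" where
  "lie_bracket A X Y x = (\<lambda>d. if d \<in> A \<and> x \<in> fst d
     then cderiv d (\<lambda>y. Y y d) x (X x d) - cderiv d (\<lambda>y. X y d) x (Y x d) else 0)"


section \<open>Pseudo-Riemannian metrics\<close>

text \<open>A metric on an open set \<open>U\<close>; only the values \<open>g x u v\<close> with \<open>x \<in> U\<close> and
  \<open>u, v\<close> tangent at \<open>x\<close> matter.\<close>

type_synonym ('a, 'n) metric = "'a \<Rightarrow> ('a, 'n) tvec \<Rightarrow> ('a, 'n) tvec \<Rightarrow> real"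

definition gmat :: "('a, 'n::finite) chart set \<Rightarrow> ('a, 'n) metric \<Rightarrow> ('a, 'n) chart \<Rightarrow> 'a \<Rightarrow> real ^ 'n ^ 'n" where
  "gmat A g c x = (\<chi> i j. g x (coord_vec A c (axis i 1) x) (coord_vec A c (axis j 1) x))"

text \<open>In the signature \<open>(p, q)\<close>, \<open>p\<close> counts the negative (timelike) and \<open>q\<close> the positive
  (spacelike) directions.\<close>

definition is_metric :: "('a, 'n::finite) chart set \<Rightarrow> nat \<Rightarrow> nat \<Rightarrow> 'a set \<Rightarrow> ('a, 'n) metric \<Rightarrow> bool" where
  "is_metric A p q U g \<longleftrightarrow>
     (\<forall>x\<in>U. \<forall>u\<in>tangent_space A x. \<forall>v\<in>tangent_space A x. g x u v = g x v u) \<and>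
     (\<forall>x\<in>U. \<forall>u\<in>tangent_space A x. \<forall>v\<in>tangent_space A x. \<forall>w\<in>tangent_space A x. \<forall>a b.
        g x (a *\<^sub>R u + b *\<^sub>R v) w = a * g x u w + b * g x v w) \<and>
     (\<forall>x\<in>U. \<exists>e :: nat \<Rightarrow> ('a, 'n) tvec. span (e ` {..<p + q}) = tangent_space A x \<and>
        (\<forall>i<p + q. \<forall>j<p + q. g x (e i) (e j) = (if i \<noteq> j then 0 else if i < p then -1 else 1))) \<and>
     (\<forall>c\<in>A. smooth_map A (U \<inter> fst c) (gmat A g c))"

definition sharp :: "('a, 'n::finite) chart set \<Rightarrow> ('a, 'n) metric \<Rightarrow> 'a \<Rightarrow> (('a, 'n) tvec \<Rightarrow> real) \<Rightarrow> ('a, 'n) tvec" where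
  "sharp A g x \<omega> = (THE v. v \<in> tangent_space A x \<and> (\<forall>w\<in>tangent_space A x. g x v w = \<omega> w))"

definition grad :: "('a, 'n::finite) chart set \<Rightarrow> ('a, 'n) metric \<Rightarrow> ('a \<Rightarrow> real) \<Rightarrow> 'a \<Rightarrow> ('a, 'n) tvec" where
  "grad A g f x = sharp A g x (\<lambda>v. dir_deriv A x v f)"


subsection \<open>Levi-Civita connection and curvature\<close>

definition christoffel :: "('a, 'n::finite) chart set \<Rightarrow> ('a, 'n) metric \<Rightarrow> ('a, 'n) chart \<Rightarrow> 'a
    \<Rightarrow> 'n \<Rightarrow> 'n \<Rightarrow> 'n \<Rightarrow> real" where
  "christoffel A g c x k i j = 1/2 * (\<Sum>l\<in>UNIV. matrix_inv (gmat A g c x) $ k $ l *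
     (cderiv c (\<lambda>y. gmat A g c y $ j $ l) x (axis i 1)
      + cderiv c (\<lambda>y. gmat A g c y $ i $ l) x (axis j 1)
      - cderiv c (\<lambda>y. gmat A g c y $ i $ j) x (axis l 1)))"

text \<open>The Levi-Civita covariant derivative of the vector field \<open>Y\<close> at \<open>x\<close> in the direction \<open>v\<close>.\<close>

definition cov :: "('a, 'n::finite) chart set \<Rightarrow> ('a, 'n) metric \<Rightarrow> 'a \<Rightarrow> ('a, 'n) tvec
    \<Rightarrow> ('a \<Rightarrow> ('a, 'n) tvec) \<Rightarrow> ('a, 'n) tvec" where
  "cov A g x v Y = (\<lambda>d. if d \<in> A \<and> x \<in> fst d
     then cderiv d (\<lambda>y. Y y d) x (v d)
          + (\<chi> k. \<Sum>i\<in>UNIV. \<Sum>j\<in>UNIV. christoffel A g d x k i j * v d $ i * Y x d $ j)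
     else 0)"

definition riemann :: "('a, 'n::finite) chart set \<Rightarrow> ('a, 'n) metric \<Rightarrow> ('a \<Rightarrow> ('a, 'n) tvec)
    \<Rightarrow> ('a \<Rightarrow> ('a, 'n) tvec) \<Rightarrow> ('a \<Rightarrow> ('a, 'n) tvec) \<Rightarrow> 'a \<Rightarrow> ('a, 'n) tvec" where
  "riemann A g X Y Z x =
     cov A g x (X x) (\<lambda>y. cov A g y (Y y) Z) - cov A g x (Y x) (\<lambda>y. cov A g y (X y) Z)
     - cov A g x (lie_bracket A X Y x) Z"

text \<open>\<open>Ric(u, v)\<close> is the trace of \<open>w \<mapsto> R(w, u) v\<close> (positive on round spheres).  It is computed in
  a chart, extending \<open>u\<close> and \<open>v\<close> to fields with constant coordinates.\<close>

definition ricci :: "('a, 'n::finite) chart set \<Rightarrow> ('a, 'n) metric \<Rightarrow> ('a, 'n) metric" where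
  "ricci A g x u v = (let c = chart_at A x in \<Sum>l\<in>UNIV.
     riemann A g (coord_vec A c (axis l 1)) (coord_vec A c (u c)) (coord_vec A c (v c)) x c $ l)"

definition scal :: "('a, 'n::finite) chart set \<Rightarrow> ('a, 'n) metric \<Rightarrow> 'a \<Rightarrow> real" where
  "scal A g x = (let c = chart_at A x in \<Sum>i\<in>UNIV. \<Sum>j\<in>UNIV.
     matrix_inv (gmat A g c x) $ i $ j *
     ricci A g x (coord_vec A c (axis i 1) x) (coord_vec A c (axis j 1) x))"

definition Kg :: "('a, 'n::finite) chart set \<Rightarrow> ('a, 'n) metric \<Rightarrow> ('a, 'n) metric" where
  "Kg A g x u v = 1 / (real CARD('n) - 2) *
     (scal A g x / (2 * (real CARD('n) - 1)) * g x u v - ricci A g x u v)"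


section \<open>Conformal structures\<close>

definition conf_rel :: "('a, 'n::finite) chart set \<Rightarrow> 'a set \<Rightarrow> ('a \<Rightarrow> real)
    \<Rightarrow> ('a, 'n) metric \<Rightarrow> ('a, 'n) metric \<Rightarrow> bool" where
  "conf_rel A U \<sigma> g h \<longleftrightarrow> smooth_map A U \<sigma> \<and>
     (\<forall>x\<in>U. \<forall>u\<in>tangent_space A x. \<forall>v\<in>tangent_space A x. h x u v = exp (2 * \<sigma> x) * g x u v)"

definition conformal_class :: "('a, 'n::finite) chart set \<Rightarrow> nat \<Rightarrow> nat \<Rightarrow> ('a, 'n) metric set \<Rightarrow> bool" where
  "conformal_class A p q c \<longleftrightarrow> c \<noteq> {} \<and>
     (\<forall>g\<in>c. is_metric A p q UNIV g \<and> (\<forall>h. h \<in> c \<longleftrightarrow> (\<exists>\<sigma>. conf_rel A UNIV \<sigma> g h)))"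

definition conf_restrict :: "('a, 'n::finite) chart set \<Rightarrow> ('a, 'n) metric set \<Rightarrow> 'a set \<Rightarrow> ('a, 'n) metric set" where
  "conf_restrict A c U = {h. \<exists>g\<in>c. \<exists>\<sigma>. conf_rel A U \<sigma> g h}"

text \<open>Space and time orientations.  For \<open>\<epsilon> = -1\<close> and \<open>m = p\<close> (resp. \<open>\<epsilon> = 1\<close> and \<open>m = q\<close>) the
  orthogonal \<open>m\<close>-frames below span the maximal timelike (resp. spacelike) subspaces.  Two such
  frames \<open>e, f\<close> are equally oriented iff the orthogonal projection between their spans maps one
  to a frame oriented like the other, i.e. iff the determinant of \<open>\<epsilon> g(e\<^sub>i, f\<^sub>j)\<close> is positive.
  All these notions depend on the conformal class only.  An orientation selects one of the
  two classes at every point, continuously.\<close>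

definition maximal_frames :: "('a, 'n::finite) chart set \<Rightarrow> ('a, 'n) metric \<Rightarrow> real \<Rightarrow> nat \<Rightarrow> 'a
    \<Rightarrow> (nat \<Rightarrow> ('a, 'n) tvec) set" where
  "maximal_frames A g \<epsilon> m x = {e. \<forall>i<m. e i \<in> tangent_space A x \<and> \<epsilon> * g x (e i) (e i) > 0 \<and>
     (\<forall>j<m. i \<noteq> j \<longrightarrow> g x (e i) (e j) = 0)}"

definition nat_det :: "nat \<Rightarrow> (nat \<Rightarrow> nat \<Rightarrow> real) \<Rightarrow> real" where
  "nat_det m a = (\<Sum>\<pi> | \<pi> permutes {..<m}. of_int (sign \<pi>) * (\<Prod>i<m. a i (\<pi> i)))"

definition definite_orientation :: "('a::topological_space, 'n::finite) chart set \<Rightarrow> ('a, 'n) metric set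
    \<Rightarrow> real \<Rightarrow> nat \<Rightarrow> ('a \<Rightarrow> (nat \<Rightarrow> ('a, 'n) tvec) set) \<Rightarrow> bool" where
  "definite_orientation A c \<epsilon> m Or \<longleftrightarrow> (\<forall>g\<in>c.
     (\<forall>x. Or x \<noteq> {} \<and> Or x \<subseteq> maximal_frames A g \<epsilon> m x \<and>
        (\<forall>e\<in>Or x. \<forall>f\<in>maximal_frames A g \<epsilon> m x.
           f \<in> Or x \<longleftrightarrow> nat_det m (\<lambda>i j. \<epsilon> * g x (e i) (f j)) > 0)) \<and>
     (\<forall>x. \<exists>U E. open U \<and> x \<in> U \<and> (\<forall>i<m. smooth_vf A U (\<lambda>y. E y i)) \<and> (\<forall>y\<in>U. E y \<in> Or y)))"

definition conformal_manifold :: "('a::{t2_space, second_countable_topology}, 'n::finite) chart set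
    \<Rightarrow> nat \<Rightarrow> nat \<Rightarrow> ('a, 'n) metric set \<Rightarrow> ('a \<Rightarrow> (nat \<Rightarrow> ('a, 'n) tvec) set)
    \<Rightarrow> ('a \<Rightarrow> (nat \<Rightarrow> ('a, 'n) tvec) set) \<Rightarrow> bool" where
  "conformal_manifold A p q c TOr SOr \<longleftrightarrow> manifold A \<and> CARD('n) = p + q \<and>
     conformal_class A p q c \<and> definite_orientation A c (-1) p TOr \<and> definite_orientation A c 1 q SOr"


section \<open>The standard tractor bundle\<close>

text \<open>A gauge is a metric in the conformal class over some open set \<open>V\<close>.  A tractor at \<open>x\<close> is the
  family of the triples \<open>(\<alpha>, Y, \<beta>)\<close> representing it in all gauges around \<open>x\<close>, related by
  the transformation law and extended by zero to all other pairs.\<close>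

type_synonym ('a, 'n) gauge = "'a set \<times> ('a, 'n) metric"
type_synonym ('a, 'n) triple = "real \<times> ('a, 'n) tvec \<times> real"
type_synonym ('a, 'n) tractor = "('a, 'n) gauge \<Rightarrow> ('a, 'n) triple"

definition gauges_at :: "('a::topological_space, 'n::finite) chart set \<Rightarrow> ('a, 'n) metric set \<Rightarrow> 'a
    \<Rightarrow> ('a, 'n) gauge set" where
  "gauges_at A c x = {(V, g). open V \<and> x \<in> V \<and> g \<in> conf_restrict A c V}"

fun change_gauge :: "('a, 'n::finite) chart set \<Rightarrow> ('a, 'n) metric \<Rightarrow> ('a \<Rightarrow> real) \<Rightarrow> 'a
    \<Rightarrow> ('a, 'n) triple \<Rightarrow> ('a, 'n) triple" where
  "change_gauge A g \<sigma> x (\<alpha>, Y, \<beta>) =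
     (exp (- \<sigma> x) * (\<alpha> - dir_deriv A x Y \<sigma> - 1/2 * \<beta> * g x (grad A g \<sigma> x) (grad A g \<sigma> x)),
      exp (- \<sigma> x) *\<^sub>R (Y + \<beta> *\<^sub>R grad A g \<sigma> x),
      exp (\<sigma> x) * \<beta>)"

definition tractor_space :: "('a::topological_space, 'n::finite) chart set \<Rightarrow> ('a, 'n) metric set \<Rightarrow> 'a
    \<Rightarrow> ('a, 'n) tractor set" where
  "tractor_space A c x = {t.
     (\<forall>G. G \<notin> gauges_at A c x \<longrightarrow> t G = 0) \<and>
     (\<forall>G\<in>gauges_at A c x. fst (snd (t G)) \<in> tangent_space A x) \<and>
     (\<forall>(V, g)\<in>gauges_at A c x. \<forall>(W, h)\<in>gauges_at A c x. \<forall>\<sigma>.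
        conf_rel A (V \<inter> W) \<sigma> g h \<longrightarrow> t (W, h) = change_gauge A g \<sigma> x (t (V, g)))}"

definition smooth_section :: "('a::topological_space, 'n::finite) chart set \<Rightarrow> ('a, 'n) metric set \<Rightarrow> 'a set
    \<Rightarrow> ('a \<Rightarrow> ('a, 'n) tractor) \<Rightarrow> bool" where
  "smooth_section A c U s \<longleftrightarrow> (\<forall>x\<in>U. s x \<in> tractor_space A c x) \<and>
     (\<forall>V g. open V \<and> g \<in> conf_restrict A c V \<longrightarrow>
        smooth_map A (U \<inter> V) (\<lambda>x. fst (s x (V, g))) \<and>
        smooth_vf A (U \<inter> V) (\<lambda>x. fst (snd (s x (V, g)))) \<and>
        smooth_map A (U \<inter> V) (\<lambda>x. snd (snd (s x (V, g)))))"

fun tractor_metric :: "('a, 'n) metric \<Rightarrow> 'a \<Rightarrow> ('a, 'n) triple \<Rightarrow> ('a, 'n) triple \<Rightarrow> real" where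
  "tractor_metric g x (\<alpha>1, Y1, \<beta>1) (\<alpha>2, Y2, \<beta>2) = \<alpha>1 * \<beta>2 + \<alpha>2 * \<beta>1 + g x Y1 Y2"

text \<open>The normal conformal connection at \<open>x\<close> in the direction \<open>v\<close>, first in the splitting given by
  a metric \<open>g\<close>, then on tractor fields.\<close>

definition nabla_split :: "('a, 'n::finite) chart set \<Rightarrow> ('a, 'n) metric \<Rightarrow> 'a \<Rightarrow> ('a, 'n) tvec
    \<Rightarrow> ('a \<Rightarrow> ('a, 'n) triple) \<Rightarrow> ('a, 'n) triple" where
  "nabla_split A g x v T = (
     let \<alpha> = (\<lambda>y. fst (T y)); Y = (\<lambda>y. fst (snd (T y))); \<beta> = (\<lambda>y. snd (snd (T y))) in
     (dir_deriv A x v \<alpha> + Kg A g x v (Y x),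
      cov A g x v Y + \<alpha> x *\<^sub>R v - \<beta> x *\<^sub>R sharp A g x (Kg A g x v),
      dir_deriv A x v \<beta> - g x v (Y x)))"

definition nabla_nc :: "('a::topological_space, 'n::finite) chart set \<Rightarrow> ('a, 'n) metric set \<Rightarrow> 'a
    \<Rightarrow> ('a, 'n) tvec \<Rightarrow> ('a \<Rightarrow> ('a, 'n) tractor) \<Rightarrow> ('a, 'n) tractor" where
  "nabla_nc A c x v s = (\<lambda>(V, g). if (V, g) \<in> gauges_at A c x
     then nabla_split A g x v (\<lambda>y. s y (V, g)) else 0)"


subsection \<open>Distributions in the tractor bundle\<close>

definition tractor_distribution :: "('a::topological_space, 'n::finite) chart set \<Rightarrow> ('a, 'n) metric set
    \<Rightarrow> nat \<Rightarrow> ('a \<Rightarrow> ('a, 'n) tractor set) \<Rightarrow> bool" where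
  "tractor_distribution A c k H \<longleftrightarrow>
     (\<forall>x. subspace (H x) \<and> H x \<subseteq> tractor_space A c x \<and> dim (H x) = k) \<and>
     (\<forall>x. \<exists>U s. open U \<and> x \<in> U \<and> (\<forall>i<k. smooth_section A c U (s i)) \<and>
        (\<forall>y\<in>U. H y = span ((\<lambda>i. s i y) ` {..<k})))"

text \<open>The tractor metric does not depend on the gauge.\<close>

definition totally_lightlike :: "('a::topological_space, 'n::finite) chart set \<Rightarrow> ('a, 'n) metric set
    \<Rightarrow> ('a \<Rightarrow> ('a, 'n) tractor set) \<Rightarrow> bool" where
  "totally_lightlike A c H \<longleftrightarrow> (\<forall>x. \<forall>s\<in>H x. \<forall>t\<in>H x. \<forall>(V, g)\<in>gauges_at A c x.
     tractor_metric g x (s (V, g)) (t (V, g)) = 0)"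

definition parallel :: "('a::topological_space, 'n::finite) chart set \<Rightarrow> ('a, 'n) metric set
    \<Rightarrow> ('a \<Rightarrow> ('a, 'n) tractor set) \<Rightarrow> bool" where
  "parallel A c H \<longleftrightarrow> (\<forall>U s. open U \<and> smooth_section A c U s \<and> (\<forall>x\<in>U. s x \<in> H x) \<longrightarrow>
     (\<forall>x\<in>U. \<forall>v\<in>tangent_space A x. nabla_nc A c x v s \<in> H x))"

definition lightlike_vf :: "('a, 'n::finite) chart set \<Rightarrow> 'a set \<Rightarrow> ('a, 'n) metric
    \<Rightarrow> ('a \<Rightarrow> ('a, 'n) tvec) \<Rightarrow> bool" where
  "lightlike_vf A U g X \<longleftrightarrow> smooth_vf A U X \<and> (\<forall>x\<in>U. X x \<noteq> 0 \<and> g x (X x) (X x) = 0)"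

end

theory Submission
  imports Defs
begin

text \<open>
  Fix a metric \<open>g\<close> of the class. If all tractors of \<open>\<H>\<close> had \<open>\<beta> = 0\<close> over an open set, the third
  component of \<open>\<nabla>\<^sup>n\<^sup>c\<close> would force \<open>Y = 0\<close> and then the second one \<open>\<alpha> = 0\<close>; hence the points where
  some tractor of \<open>\<H>\<close> has \<open>\<beta> \<noteq> 0\<close> are open and dense. Near such a point \<open>\<H>\<close> has a frame
  \<open>(\<alpha>, Y, 1), (\<alpha>\<^sub>i, K\<^sub>i, 0)\<close>. As \<open>\<H>\<close> is parallel, \<open>\<nabla>\<^sup>g\<close> is torsion-free and \<open>K\<^sup>g\<close> is symmetric,
  the distribution orthogonal to all \<open>K\<^sub>i\<close> is integrable and \<open>g(Y, \<cdot>)\<close> is closed along it. Thus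
  some \<open>\<sigma>\<close> satisfies \<open>d\<sigma> = - g(Y, \<cdot>)\<close> on this distribution, and as \<open>\<H>\<close> is lightlike the metric
  \<open>e\<^sup>2\<^sup>\<sigma> g\<close> has the required form. Instead of invoking the Frobenius theorem, \<open>\<sigma>\<close> is found by
  integrating along the flows of a commuting frame, which depend smoothly on the initial point.\<close>

section \<open>Calculus of the classes \<open>C\<^sup>k\<close>\<close>

text \<open>It is enough to prescribe \<open>\<sigma>\<close> along the common orthogonal complement
  of the \<open>K i\<close>; transversally its values are free. The equation on the complement says
  that \<open>grad \<sigma> + Y\<close> is orthogonal to every vector orthogonal to all
  \<open>K i\<close>, so it lies in the span of the \<open>K i\<close>, which consists of null
  vectors. Hence the new vector part of the tractor with \<beta> = 1 can be removed by the other
  frame tractors, and the vanishing of its square is exactly the vanishing of the new first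
  component. The obstacle is regularity: \<open>\<sigma>\<close> arises from integrals along curves,
  one through each point, and must be smooth in all directions, also across the distribution. The
  flow is therefore treated as an integral equation over the unit interval. The derivative of a
  solution with respect to the initial point solves a linear equation of the same kind, so that
  smoothness follows by induction on the order. The right-hand side used later carries the factor
  \<open>z - c\<close>, so shrinking the neighbourhood of \<open>c\<close> yields the Lipschitz
  constant 1/2 on which all contraction and uniqueness arguments rest.\<close>

text \<open>The parameter \<open>t\<close> is never differentiated, but all derivatives depend continuously on it.\<close>

primrec Ck_param :: "nat \<Rightarrow> 'p::topological_space set \<Rightarrow> ('p \<Rightarrow> 'b::real_normed_vector \<Rightarrow> 'c::real_normed_vector)
    \<Rightarrow> 'b set \<Rightarrow> bool" where
  "Ck_param 0 T f S \<longleftrightarrow> continuous_on (T \<times> S) (\<lambda>(t, x). f t x)"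
| "Ck_param (Suc k) T f S \<longleftrightarrow> continuous_on (T \<times> S) (\<lambda>(t, x). f t x) \<and>
     (\<forall>t\<in>T. \<forall>x\<in>S. f t differentiable (at x)) \<and>
     (\<forall>v. Ck_param k T (\<lambda>t x. frechet_derivative (f t) (at x) v) S)"

lemma Ck_param_continuous: "Ck_param k T f S \<Longrightarrow> continuous_on (T \<times> S) (\<lambda>(t, x). f t x)"
  by (cases k) auto

lemma Ck_param_Suc_imp: "Ck_param (Suc k) T f S \<Longrightarrow> Ck_param k T f S"
proof (induction k arbitrary: f)
  case 0
  then show ?case by simp
next
  case (Suc k)
  from Suc.prems have "Ck_param k T (\<lambda>t x. frechet_derivative (f t) (at x) v) S" for v
    by (intro Suc.IH) simp
  with Suc.prems show ?case by simp
qed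

text \<open>Derivatives at a point of \<open>S\<close> only see values nearby, and \<open>S\<close>
  is open; the equality of functions therefore passes to the derivatives and the induction goes
  through.\<close>

lemma Ck_param_cong:
  assumes "open S" "\<And>t x. t \<in> T \<Longrightarrow> x \<in> S \<Longrightarrow> f t x = g t x" "Ck_param k T f S"
  shows "Ck_param k T g S"
  using assms(2,3)
proof (induction k arbitrary: f g)
  case 0
  then have "continuous_on (T \<times> S) (\<lambda>(t, x). g t x)"
    by (subst continuous_on_cong[OF refl, where g = "\<lambda>(t, x). f t x"]) auto
  then show ?case by simp
next
  case (Suc k)
  have c: "continuous_on (T \<times> S) (\<lambda>(t, x). g t x)"
    using Suc.prems by (subst continuous_on_cong[OF refl, where g = "\<lambda>(t, x). f t x"]) auto
  have d: "(g t has_derivative frechet_derivative (f t) (at x)) (at x)" if "t \<in> T" "x \<in> S" for t x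
    using Suc.prems that \<open>open S\<close>
    by (intro has_derivative_transform_within_open[of "f t" _ x UNIV S "g t"])
       (auto simp: frechet_derivative_works[symmetric])
  have e: "frechet_derivative (f t) (at x) = frechet_derivative (g t) (at x)" if "t \<in> T" "x \<in> S" for t x
    using d[OF that] by (rule frechet_derivative_at)
  have "Ck_param k T (\<lambda>t x. frechet_derivative (g t) (at x) v) S" for v
    by (rule Suc.IH[of "\<lambda>t x. frechet_derivative (f t) (at x) v"]) (use e Suc.prems in auto)
  then show ?case using c d by (auto simp: differentiable_def)
qed

lemma Ck_param_SucI:
  assumes "open S" "\<And>t x. t \<in> T \<Longrightarrow> x \<in> S \<Longrightarrow> (f t has_derivative f' t x) (at x)"
    "continuous_on (T \<times> S) (\<lambda>(t, x). f t x)" "\<And>v. Ck_param k T (\<lambda>t x. f' t x v) S"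
  shows "Ck_param (Suc k) T f S"
proof -
  have "f' t x = frechet_derivative (f t) (at x)" if "t \<in> T" "x \<in> S" for t x
    using assms(2)[OF that] by (rule frechet_derivative_at)
  then have "Ck_param k T (\<lambda>t x. frechet_derivative (f t) (at x) v) S" for v
    by (intro Ck_param_cong[OF assms(1) _ assms(4)[of v]]) auto
  then show ?thesis using assms by (auto simp: differentiable_def)
qed

lemma Ck_param_has_derivative:
  assumes "Ck_param (Suc k) T f S" "t \<in> T" "x \<in> S"
  shows "(f t has_derivative frechet_derivative (f t) (at x)) (at x)"
  unfolding frechet_derivative_works[symmetric] using assms by simp

lemma Ck_param_derivative:
  "Ck_param (Suc k) T f S \<Longrightarrow> Ck_param k T (\<lambda>t x. frechet_derivative (f t) (at x) v) S"
  by simp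

lemma Ck_param_subset: "Ck_param k T f S \<Longrightarrow> S' \<subseteq> S \<Longrightarrow> T' \<subseteq> T \<Longrightarrow> Ck_param k T' f S'"
proof (induction k arbitrary: f)
  case 0
  then show ?case by (auto elim!: continuous_on_subset)
next
  case (Suc k)
  have "continuous_on (T' \<times> S') (\<lambda>(t, x). f t x)"
    using Suc.prems by (auto elim!: continuous_on_subset)
  moreover have "Ck_param k T' (\<lambda>t x. frechet_derivative (f t) (at x) v) S'" for v
    using Suc by simp
  ultimately show ?case using Suc.prems unfolding Ck_param.simps by blast
qed

lemma continuous_on_param_local:
  assumes "\<And>x. x \<in> S \<Longrightarrow> \<exists>V. open V \<and> x \<in> V \<and> continuous_on (T \<times> (V \<inter> S)) (\<lambda>(t, x). f t x)"
  shows "continuous_on (T \<times> S) (\<lambda>(t, x). f t x)"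
  unfolding continuous_on_def
proof
  fix p assume p: "p \<in> T \<times> S"
  then obtain V where V: "open V" "snd p \<in> V" "continuous_on (T \<times> (V \<inter> S)) (\<lambda>(t, x). f t x)"
    using assms[of "snd p"] by auto
  have "open (UNIV \<times> V)" using V by (intro open_Times) auto
  then have "at p within (T \<times> (V \<inter> S)) = at p within (T \<times> S)"
    using p V by (intro at_within_nhd[of p "UNIV \<times> V"]) auto
  moreover have "p \<in> T \<times> (V \<inter> S)"
    using V p by auto
  ultimately show "((\<lambda>(t, x). f t x) \<longlongrightarrow> (case p of (t, x) \<Rightarrow> f t x)) (at p within T \<times> S)"
    using V(3) unfolding continuous_on_def by metis
qed

text \<open>Localises in \<open>x\<close> while keeping all of \<open>T\<close>: the linearised
  integral equations below are solved on a small ball around each point, but over the whole time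
  interval.\<close>

lemma Ck_param_local:
  assumes "\<And>x. x \<in> S \<Longrightarrow> \<exists>V. open V \<and> x \<in> V \<and> Ck_param k T f (V \<inter> S)"
  shows "Ck_param k T f S"
  using assms
proof (induction k arbitrary: f)
  case 0
  then show ?case using continuous_on_param_local[of S T f] by simp
next
  case (Suc k)
  have "Ck_param k T (\<lambda>t x. frechet_derivative (f t) (at x) v) S" for v
    by (rule Suc.IH) (use Suc.prems in fastforce)
  moreover have "continuous_on (T \<times> S) (\<lambda>(t, x). f t x)"
    by (rule continuous_on_param_local) (use Suc.prems in fastforce)
  moreover have "f t differentiable (at x)" if "t \<in> T" "x \<in> S" for t x
    using Suc.prems[OF that(2)] that by auto
  ultimately show ?case by auto
qed

lemma Ck_param_const: "continuous_on T h \<Longrightarrow> open S \<Longrightarrow> Ck_param k T (\<lambda>t x. h t) S"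
proof (induction k arbitrary: h)
  case 0
  then show ?case by (auto simp: case_prod_beta intro!: continuous_intros elim: continuous_on_compose2)
next
  case (Suc k)
  have "continuous_on (T \<times> S) (\<lambda>(t, x). h t)"
    using Suc.prems by (auto simp: case_prod_beta intro!: continuous_intros elim: continuous_on_compose2)
  then show ?case
    using Suc.IH[of "\<lambda>_. 0"] Suc.prems by (auto simp: frechet_derivative_const)
qed

lemma Ck_param_bounded_linear:
  assumes "bounded_linear L" "open S" "Ck_param k T f S"
  shows "Ck_param k T (\<lambda>t x. L (f t x)) S"
  using assms(3)
proof (induction k arbitrary: f)
  case 0
  then show ?case
    by (auto simp: case_prod_beta intro!: bounded_linear.continuous_on[OF assms(1)])
next
  case (Suc k)
  show ?case
  proof (rule Ck_param_SucI[OF assms(2)])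
    show "((\<lambda>x. L (f t x)) has_derivative (\<lambda>v. L (frechet_derivative (f t) (at x) v))) (at x)"
      if "t \<in> T" "x \<in> S" for t x
      using Ck_param_has_derivative[OF Suc.prems that] assms(1) by (rule bounded_linear.has_derivative[rotated])
    show "continuous_on (T \<times> S) (\<lambda>(t, x). L (f t x))"
      using Suc.prems by (auto simp: case_prod_beta intro!: bounded_linear.continuous_on[OF assms(1)])
    show "Ck_param k T (\<lambda>t x. L (frechet_derivative (f t) (at x) v)) S" for v
      using Suc by auto
  qed
qed

lemma Ck_param_add:
  assumes "open S" "Ck_param k T f S" "Ck_param k T g S"
  shows "Ck_param k T (\<lambda>t x. f t x + g t x) S"
  using assms(2,3)
proof (induction k arbitrary: f g)
  case 0
  then show ?case by (auto simp: case_prod_beta intro!: continuous_intros)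
next
  case (Suc k)
  show ?case
  proof (rule Ck_param_SucI[OF assms(1)])
    show "((\<lambda>x. f t x + g t x) has_derivative
        (\<lambda>v. frechet_derivative (f t) (at x) v + frechet_derivative (g t) (at x) v)) (at x)"
      if "t \<in> T" "x \<in> S" for t x
      using Ck_param_has_derivative[OF Suc.prems(1) that] Ck_param_has_derivative[OF Suc.prems(2) that]
      by (rule has_derivative_add)
    show "continuous_on (T \<times> S) (\<lambda>(t, x). f t x + g t x)"
      using Suc.prems by (auto simp: case_prod_beta intro!: continuous_intros)
  qed (use Suc in auto)
qed

lemma Ck_param_sum:
  assumes "open S" "\<And>i. i \<in> I \<Longrightarrow> Ck_param k T (f i) S"
  shows "Ck_param k T (\<lambda>t x. \<Sum>i\<in>I. f i t x) S"
  using assms(2)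
proof (induction I rule: infinite_finite_induct)
  case (insert i I)
  then show ?case using Ck_param_add[OF assms(1), of k T "f i" "\<lambda>t x. \<Sum>i\<in>I. f i t x"] by simp
qed (auto intro!: Ck_param_const assms(1))

lemma Ck_param_bilinear:
  assumes "bounded_bilinear B" "open S" "Ck_param k T f S" "Ck_param k T g S"
  shows "Ck_param k T (\<lambda>t x. B (f t x) (g t x)) S"
  using assms(3,4)
proof (induction k arbitrary: f g)
  case 0
  then show ?case by (auto simp: case_prod_beta intro!: bounded_bilinear.continuous_on[OF assms(1)])
next
  case (Suc k)
  show ?case
  proof (rule Ck_param_SucI[OF assms(2)])
    show "((\<lambda>x. B (f t x) (g t x)) has_derivative (\<lambda>v. B (f t x) (frechet_derivative (g t) (at x) v)
        + B (frechet_derivative (f t) (at x) v) (g t x))) (at x)"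
      if "t \<in> T" "x \<in> S" for t x
      using Ck_param_has_derivative[OF Suc.prems(1) that] Ck_param_has_derivative[OF Suc.prems(2) that]
      by (rule bounded_bilinear.FDERIV[OF assms(1)])
    show "continuous_on (T \<times> S) (\<lambda>(t, x). B (f t x) (g t x))"
      using Suc.prems by (auto simp: case_prod_beta intro!: bounded_bilinear.continuous_on[OF assms(1)])
    show "Ck_param k T (\<lambda>t x. B (f t x) (frechet_derivative (g t) (at x) v)
        + B (frechet_derivative (f t) (at x) v) (g t x)) S" for v
      using Suc.prems Suc.prems[THEN Ck_param_Suc_imp]
      by (intro Ck_param_add assms(2) Suc.IH) auto
  qed
qed

lemmas Ck_param_scaleR = Ck_param_bilinear[OF bounded_bilinear_scaleR]
  and Ck_param_inner = Ck_param_bilinear[OF bounded_bilinear_inner]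

lemma Ck_param_compose:
  fixes f :: "'p::topological_space \<Rightarrow> 'b::euclidean_space \<Rightarrow> 'c::real_normed_vector"
  assumes "open S" "Ck_param k T f S'" "Ck_param k T g S"
    "\<And>t x. t \<in> T \<Longrightarrow> x \<in> S \<Longrightarrow> g t x \<in> S'"
  shows "Ck_param k T (\<lambda>t x. f t (g t x)) S"
proof -
  have cont: "continuous_on (T \<times> S) (\<lambda>(t, x). f t (g t x))"
    if "continuous_on (T \<times> S') (\<lambda>(t, x). f t x)" "continuous_on (T \<times> S) (\<lambda>(t, x). g t x)"
    for f :: "'p \<Rightarrow> 'b \<Rightarrow> 'c"
  proof -
    have "continuous_on (T \<times> S) (\<lambda>p. (fst p, g (fst p) (snd p)))"
      using that(2) by (auto intro!: continuous_intros simp: case_prod_beta)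
    moreover have "(\<lambda>p. (fst p, g (fst p) (snd p))) ` (T \<times> S) \<subseteq> T \<times> S'"
      using assms(4) by auto
    ultimately show ?thesis
      using continuous_on_compose2[OF that(1)] by (fastforce simp: case_prod_beta)
  qed
  show ?thesis using assms(2,3)
  proof (induction k arbitrary: f)
    case 0
    then show ?case using cont by simp
  next
    case (Suc k)
    show ?case
    proof (rule Ck_param_SucI[OF assms(1)])
      \<comment> \<open>In the chain rule the derivative of \<open>f t\<close> is applied to a
        vector that varies with \<open>x\<close>. The basis expansion leaves only derivatives in
        fixed directions, which are the ones that \<open>Ck_param\<close> controls.\<close>
      show "((\<lambda>x. f t (g t x)) has_derivative (\<lambda>v. \<Sum>b\<in>Basis. (frechet_derivative (g t) (at x) v \<bullet> b) *\<^sub>R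
          frechet_derivative (f t) (at (g t x)) b)) (at x)" if "t \<in> T" "x \<in> S" for t x
      proof -
        note d = Ck_param_has_derivative[OF Suc.prems(1) that(1) assms(4)[OF that]]
        have "((\<lambda>x. f t (g t x)) has_derivative
            (\<lambda>v. frechet_derivative (f t) (at (g t x)) (frechet_derivative (g t) (at x) v))) (at x)"
          using diff_chain_at[OF Ck_param_has_derivative[OF Suc.prems(2) that] d] by (simp add: o_def)
        also have "(\<lambda>v. frechet_derivative (f t) (at (g t x)) (frechet_derivative (g t) (at x) v)) =
            (\<lambda>v. \<Sum>b\<in>Basis. (frechet_derivative (g t) (at x) v \<bullet> b) *\<^sub>R frechet_derivative (f t) (at (g t x)) b)"
          
        proof
          fix v
          let ?D = "frechet_derivative (f t) (at (g t x))" and ?w = "frechet_derivative (g t) (at x)"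
          have "?D (?w v) = ?D (\<Sum>b\<in>Basis. (?w v \<bullet> b) *\<^sub>R b)" by (simp add: euclidean_representation)
          also have "\<dots> = (\<Sum>b\<in>Basis. (?w v \<bullet> b) *\<^sub>R ?D b)"
            using has_derivative_linear[OF d] by (simp add: linear_sum linear_scale)
          finally show "?D (?w v) = (\<Sum>b\<in>Basis. (?w v \<bullet> b) *\<^sub>R ?D b)" .
        qed
        finally show ?thesis .
      qed
      show "continuous_on (T \<times> S) (\<lambda>(t, x). f t (g t x))"
        using Suc.prems cont by simp
      show "Ck_param k T (\<lambda>t x. \<Sum>b\<in>Basis. (frechet_derivative (g t) (at x) v \<bullet> b) *\<^sub>R
          frechet_derivative (f t) (at (g t x)) b) S" for v
        using Suc.prems Ck_param_Suc_imp[OF Suc.prems(2)]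
        by (intro Ck_param_sum Ck_param_scaleR assms(1) Suc.IH[of "\<lambda>t y. frechet_derivative (f t) (at y) b" for b]
            Ck_param_bounded_linear[OF bounded_linear_inner_left]) auto
    qed
  qed
qed

section \<open>Smooth functions without parameter, as the case of a single parameter value\<close>

lemma Ck_on_iff_param: "Ck_on k f S \<longleftrightarrow> Ck_param k {0::real} (\<lambda>_. f) S"
proof (induction k arbitrary: f)
  case 0
  have "continuous_on ({0::real} \<times> S) (\<lambda>(t, x). f x)" if "continuous_on S f"
    using that by (auto simp: case_prod_beta intro!: continuous_intros elim: continuous_on_compose2)
  moreover have "continuous_on S f" if c: "continuous_on ({0::real} \<times> S) (\<lambda>(t, x). f x)"
    using continuous_on_compose2[OF c, of S "\<lambda>x. (0, x)"]
    by (simp add: continuous_on_Pair image_subset_iff)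
  ultimately show ?case by auto
next
  case (Suc k)
  \<comment> \<open>\<open>Ck_param\<close> demands continuity at every order, \<open>Ck_on\<close>
    only at order 0; for a single parameter value differentiability supplies it.\<close>
  have "continuous_on ({0::real} \<times> S) (\<lambda>(t, x). f x)" if "\<forall>x\<in>S. f differentiable (at x)"
  proof -
    have "continuous_on S f" using that
      by (auto intro!: differentiable_imp_continuous_on simp: differentiable_on_def differentiable_at_withinI)
    then show ?thesis
      by (auto simp: case_prod_beta intro!: continuous_intros elim: continuous_on_compose2)
  qed
  then show ?case using Suc by auto
qed

lemma smooth_on_iff_param: "smooth_on f S \<longleftrightarrow> (\<forall>k. Ck_param k {0::real} (\<lambda>_. f) S)"
  by (simp add: smooth_on_def Ck_on_iff_param)

lemma smooth_on_imp_Ck_param: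
  assumes "smooth_on f S"
  shows "Ck_param k T (\<lambda>_. f) S"
proof -
  have "Ck_on k f S" using assms by (simp add: smooth_on_def)
  then show ?thesis
  proof (induction k arbitrary: f)
    case 0
    then show ?case
      by (auto simp: case_prod_beta intro!: continuous_intros elim: continuous_on_compose2)
  next
    case (Suc k)
    then have "continuous_on S f"
      by (auto intro!: differentiable_imp_continuous_on simp: differentiable_on_def differentiable_at_withinI)
    then have "continuous_on (T \<times> S) (\<lambda>(t, x). f x)"
      by (auto simp: case_prod_beta intro!: continuous_intros elim: continuous_on_compose2)
    with Suc show ?case by auto
  qed
qed

lemma smooth_on_imp_continuous_on: "smooth_on f S \<Longrightarrow> continuous_on S f"
  unfolding smooth_on_def by (metis Ck_on.simps(1))

lemma smooth_on_has_derivative: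
  "smooth_on f S \<Longrightarrow> x \<in> S \<Longrightarrow> (f has_derivative frechet_derivative f (at x)) (at x)"
  unfolding smooth_on_def frechet_derivative_works[symmetric] by (metis Ck_on.simps(2))

lemma smooth_on_derivative: "smooth_on f S \<Longrightarrow> smooth_on (\<lambda>x. frechet_derivative f (at x) v) S"
  unfolding smooth_on_def by (metis Ck_on.simps(2))

lemma smooth_on_subset: "smooth_on f S \<Longrightarrow> S' \<subseteq> S \<Longrightarrow> smooth_on f S'"
  unfolding smooth_on_iff_param using Ck_param_subset[of _ _ "\<lambda>_. f" S S'] by blast

lemma smooth_on_cong: "open S \<Longrightarrow> (\<And>x. x \<in> S \<Longrightarrow> f x = g x) \<Longrightarrow> smooth_on f S \<Longrightarrow> smooth_on g S"
  unfolding smooth_on_iff_param by (auto intro: Ck_param_cong[of S _ "\<lambda>_. f" "\<lambda>_. g"])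

lemma smooth_on_const: "open S \<Longrightarrow> smooth_on (\<lambda>x. a) S"
  by (simp add: smooth_on_iff_param Ck_param_const)

lemma smooth_on_bounded_linear_compose:
  "bounded_linear L \<Longrightarrow> open S \<Longrightarrow> smooth_on f S \<Longrightarrow> smooth_on (\<lambda>x. L (f x)) S"
  unfolding smooth_on_iff_param using Ck_param_bounded_linear[of L S _ _ "\<lambda>_. f"] by blast

lemma smooth_on_bounded_linear:
  assumes "bounded_linear L" "open S"
  shows "smooth_on L S"
proof -
  have "Ck_on k L S" for k
  proof (cases k)
    case 0
    then show ?thesis using assms by (auto simp: linear_continuous_on)
  next
    case (Suc j)
    have "Ck_on j (\<lambda>x. frechet_derivative L (at x) v) S" for v
    proof -
      have "smooth_on (\<lambda>x. L v) S" using assms(2) by (rule smooth_on_const)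
      moreover have "frechet_derivative L (at x) v = L v" for x
        by (metis assms(1) bounded_linear_imp_has_derivative frechet_derivative_at)
      ultimately show ?thesis by (simp add: smooth_on_def)
    qed
    then show ?thesis using assms(1) Suc
      by (auto simp: bounded_linear_imp_differentiable)
  qed
  then show ?thesis by (simp add: smooth_on_def)
qed

lemma smooth_on_id: "open S \<Longrightarrow> smooth_on (\<lambda>x. x) S"
  by (rule smooth_on_bounded_linear) (simp add: bounded_linear_ident)

lemma smooth_on_add: "open S \<Longrightarrow> smooth_on f S \<Longrightarrow> smooth_on g S \<Longrightarrow> smooth_on (\<lambda>x. f x + g x) S"
  by (simp add: smooth_on_iff_param Ck_param_add)

lemma smooth_on_minus: "open S \<Longrightarrow> smooth_on f S \<Longrightarrow> smooth_on (\<lambda>x. - f x) S"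
  using smooth_on_bounded_linear_compose[OF bounded_linear_minus[OF bounded_linear_ident]] .

lemma smooth_on_diff: "open S \<Longrightarrow> smooth_on f S \<Longrightarrow> smooth_on g S \<Longrightarrow> smooth_on (\<lambda>x. f x - g x) S"
  using smooth_on_add[of S f "\<lambda>x. - g x"] smooth_on_minus[of S g] by simp

lemma smooth_on_sum:
  "open S \<Longrightarrow> (\<And>i. i \<in> I \<Longrightarrow> smooth_on (f i) S) \<Longrightarrow> smooth_on (\<lambda>x. \<Sum>i\<in>I. f i x) S"
  by (simp add: smooth_on_iff_param Ck_param_sum)

lemma smooth_on_bilinear:
  "bounded_bilinear B \<Longrightarrow> open S \<Longrightarrow> smooth_on f S \<Longrightarrow> smooth_on g S \<Longrightarrow> smooth_on (\<lambda>x. B (f x) (g x)) S"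
  unfolding smooth_on_iff_param using Ck_param_bilinear[of B S _ _ "\<lambda>_. f" "\<lambda>_. g"] by blast

lemmas smooth_on_scaleR = smooth_on_bilinear[OF bounded_bilinear_scaleR]
  and smooth_on_inner = smooth_on_bilinear[OF bounded_bilinear_inner]

lemma smooth_on_mult:
  fixes f g :: "_ \<Rightarrow> real"
  shows "open S \<Longrightarrow> smooth_on f S \<Longrightarrow> smooth_on g S \<Longrightarrow> smooth_on (\<lambda>x. f x * g x) S"
  by (rule smooth_on_bilinear[OF bounded_bilinear_mult])

lemma smooth_on_prod:
  fixes f :: "_ \<Rightarrow> _ \<Rightarrow> real"
  assumes "open S" "\<And>i. i \<in> I \<Longrightarrow> smooth_on (f i) S"
  shows "smooth_on (\<lambda>x. \<Prod>i\<in>I. f i x) S"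
  using assms(2)
  by (induction I rule: infinite_finite_induct) (auto intro!: smooth_on_const smooth_on_mult assms(1))

lemma smooth_on_compose:
  fixes f :: "'b::euclidean_space \<Rightarrow> 'c::real_normed_vector"
  shows "open S \<Longrightarrow> smooth_on f S' \<Longrightarrow> smooth_on g S \<Longrightarrow> g ` S \<subseteq> S' \<Longrightarrow> smooth_on (\<lambda>x. f (g x)) S"
  unfolding smooth_on_iff_param using Ck_param_compose[of S _ _ "\<lambda>_. f" S' "\<lambda>_. g"] by blast

lemma smooth_on_exp: "smooth_on (exp :: real \<Rightarrow> real) UNIV"
proof -
  have "Ck_param k {0::real} (\<lambda>_. exp :: real \<Rightarrow> real) UNIV" for k
  proof (induction k)
    case 0
    show ?case by (auto simp: case_prod_beta intro!: continuous_intros)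
  next
    case (Suc k)
    have "Ck_param k {0::real} (\<lambda>t x. v * exp x) UNIV" for v :: real
      using Ck_param_bounded_linear[OF bounded_linear_mult_right[of v] open_UNIV Suc] .
    moreover have "((exp :: real \<Rightarrow> real) has_derivative (\<lambda>v. v * exp x)) (at x)" for x
      using DERIV_exp[of x] by (simp add: has_field_derivative_def mult.commute[of _ "exp x"])
    ultimately show ?case
      by (intro Ck_param_SucI[where f' = "\<lambda>_ x v. v * exp x"])
         (auto simp: case_prod_beta intro!: continuous_intros)
  qed
  then show ?thesis by (simp add: smooth_on_iff_param)
qed

text \<open>The derivative of \<open>inverse\<close> is a polynomial in \<open>inverse\<close>
  itself, so the induction on the order closes.\<close>

lemma smooth_on_inverse: "smooth_on (inverse :: real \<Rightarrow> real) {x. x \<noteq> 0}"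
proof -
  have op: "open {x::real. x \<noteq> 0}" by (intro open_Collect_neq continuous_intros)
  have "Ck_param k {0::real} (\<lambda>_. inverse :: real \<Rightarrow> real) {x. x \<noteq> 0}" for k
  proof (induction k)
    case 0
    show ?case by (auto simp: case_prod_beta intro!: continuous_intros)
  next
    case (Suc k)
    have "Ck_param k {0::real} (\<lambda>t x. - v * (inverse x * inverse x)) {x. x \<noteq> 0}" for v :: real
      using Ck_param_bounded_linear[OF bounded_linear_mult_right[of "- v"] op
          Ck_param_bilinear[OF bounded_bilinear_mult op Suc Suc]] .
    moreover have "((inverse :: real \<Rightarrow> real) has_derivative (\<lambda>v. - v * (inverse x * inverse x))) (at x)"
      if "x \<noteq> 0" for x
      using that by (auto intro!: derivative_eq_intros)
    ultimately show ?case
      by (intro Ck_param_SucI[where f' = "\<lambda>_ x v. - v * (inverse x * inverse x)"] op)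
         (auto simp: case_prod_beta intro!: continuous_intros)
  qed
  then show ?thesis by (simp add: smooth_on_iff_param)
qed

lemma smooth_on_divide:
  fixes f g :: "_ \<Rightarrow> real"
  assumes "open S" "smooth_on f S" "smooth_on g S" "\<And>x. x \<in> S \<Longrightarrow> g x \<noteq> 0"
  shows "smooth_on (\<lambda>x. f x / g x) S"
proof -
  have "g ` S \<subseteq> {x. x \<noteq> 0}" using assms(4) by auto
  then have "smooth_on (\<lambda>x. inverse (g x)) S"
    by (rule smooth_on_compose[OF assms(1) smooth_on_inverse assms(3)])
  from smooth_on_mult[OF assms(1,2) this] show ?thesis by (simp add: divide_inverse)
qed

lemma smooth_on_vec_lambda:
  fixes f :: "'i::finite \<Rightarrow> 'b::real_normed_vector \<Rightarrow> 'c::real_normed_vector"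
  assumes "open S" "\<And>i. smooth_on (f i) S"
  shows "smooth_on (\<lambda>x. \<chi> i. f i x) S"
proof -
  have "bounded_linear (\<lambda>a::'c. axis i a)" for i :: 'i
    by (rule bounded_linear_intro[where K = 1])
       (auto simp: axis_def vec_eq_iff norm_vec_def L2_set_def if_distrib[of norm] if_distrib[of "\<lambda>x. x\<^sup>2"] cong: if_cong)
  then have "smooth_on (\<lambda>x. axis i (f i x)) S" for i
    using smooth_on_bounded_linear_compose assms by blast
  then have "smooth_on (\<lambda>x. \<Sum>i\<in>UNIV. axis i (f i x)) S"
    by (intro smooth_on_sum assms) auto
  moreover have "(\<Sum>i\<in>UNIV. axis i (f i x)) = (\<chi> i. f i x)" for x
    by (simp add: vec_eq_iff axis_def)
  ultimately show ?thesis by simp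
qed

lemma smooth_on_vec_nth: "open S \<Longrightarrow> smooth_on f S \<Longrightarrow> smooth_on (\<lambda>x. f x $ i) S"
  by (rule smooth_on_bounded_linear_compose[OF bounded_linear_vec_nth])

section \<open>Integral equations with parameters\<close>

text \<open>The substitution makes the domain of integration independent of \<open>t\<close>.\<close>

definition volterra :: "(real \<Rightarrow> 'f::banach) \<Rightarrow> real \<Rightarrow> 'f" where
  "volterra h t = integral {0..1} (\<lambda>s. t *\<^sub>R h (t * s))"

lemma unit_interval_mult: "t \<in> {0..1} \<Longrightarrow> s \<in> {0..1} \<Longrightarrow> t * s \<in> {0..1::real}"
  by (auto intro: mult_le_one)

lemma continuous_on_rescaled:
  fixes h :: "real \<Rightarrow> 'f::real_normed_vector"
  assumes "continuous_on {0..1} h" "t \<in> {0..1}"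
  shows "continuous_on {0..1} (\<lambda>s. t *\<^sub>R h (t * s))"
proof -
  have "continuous_on {0..1} (\<lambda>s. t * s)" by (intro continuous_intros)
  moreover have "(\<lambda>s. t * s) ` {0..1} \<subseteq> {0..1}" using unit_interval_mult[OF assms(2)] by blast
  ultimately have "continuous_on {0..1} (\<lambda>s. h (t * s))"
    by (rule continuous_on_compose2[OF assms(1)])
  then show ?thesis by (intro continuous_intros)
qed

lemma volterra_cong:
  assumes "\<And>s. s \<in> {0..1} \<Longrightarrow> h s = h' s" "t \<in> {0..1}"
  shows "volterra h t = volterra h' t"
  unfolding volterra_def using assms unit_interval_mult by (intro integral_cong) auto

lemma volterra_add:
  assumes "continuous_on {0..1} h" "continuous_on {0..1} h'" "t \<in> {0..1}"
  shows "volterra (\<lambda>s. h s + h' s) t = volterra h t + volterra h' t"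
  unfolding volterra_def scaleR_add_right
  by (intro Henstock_Kurzweil_Integration.integral_add integrable_continuous_interval continuous_on_rescaled assms)

lemma volterra_diff:
  assumes "continuous_on {0..1} h" "continuous_on {0..1} h'" "t \<in> {0..1}"
  shows "volterra (\<lambda>s. h s - h' s) t = volterra h t - volterra h' t"
  unfolding volterra_def scaleR_diff_right
  by (intro Henstock_Kurzweil_Integration.integral_diff integrable_continuous_interval continuous_on_rescaled assms)

lemma volterra_scaleR: "volterra (\<lambda>s. c *\<^sub>R h s) t = c *\<^sub>R volterra h t"
  unfolding volterra_def by (simp add: scaleR_left_commute[of t c])

lemma volterra_bound:
  assumes "\<And>s. s \<in> {0..1} \<Longrightarrow> norm (h s) \<le> B" "t \<in> {0..1}"
  shows "norm (volterra h t) \<le> B"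
proof (cases "(\<lambda>s. t *\<^sub>R h (t * s)) integrable_on {0..1}")
  case True
  have "0 \<le> B" using assms(1)[of 0] norm_ge_zero[of "h 0"] by (simp del: norm_ge_zero)
  moreover have "norm (t *\<^sub>R h (t * s)) \<le> B" if "s \<in> cbox 0 1" for s
  proof -
    have "norm (h (t * s)) \<le> B" using that assms unit_interval_mult by auto
    then show ?thesis using assms(2) \<open>0 \<le> B\<close> mult_mono[of t 1 "norm (h (t * s))" B] by auto
  qed
  moreover have "((\<lambda>s. t *\<^sub>R h (t * s)) has_integral volterra h t) (cbox 0 1)"
    using integrable_integral[OF True] by (simp add: volterra_def)
  ultimately have "norm (volterra h t) \<le> B * Henstock_Kurzweil_Integration.content (cbox 0 (1::real))"
    using has_integral_bound[of B "\<lambda>s. t *\<^sub>R h (t * s)" "volterra h t" 0 1] by blast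
  then show ?thesis by simp
next
  \<comment> \<open>A function that is not integrable has integral 0 by convention, and
    \<open>B\<close> is nonnegative because it bounds a norm.\<close>
  case False
  then have "volterra h t = 0" unfolding volterra_def by (rule not_integrable_integral)
  then show ?thesis using assms(1)[of 0] order_trans[OF norm_ge_zero] by fastforce
qed

lemma continuous_on_param_slice:
  assumes "continuous_on (T \<times> K) (\<lambda>(t, z). h t z)" "z \<in> K"
  shows "continuous_on T (\<lambda>t. h t z)"
proof -
  have "continuous_on T (\<lambda>t. (t, z))" by (intro continuous_intros)
  moreover have "(\<lambda>t. (t, z)) ` T \<subseteq> T \<times> K" using assms(2) by auto
  ultimately show ?thesis using continuous_on_compose2[OF assms(1)] by fastforce
qed

lemma continuous_on_volterra:
  fixes h :: "real \<Rightarrow> 'e::topological_space \<Rightarrow> 'f::banach"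
  assumes "continuous_on ({0..1} \<times> K) (\<lambda>(t, z). h t z)"
  shows "continuous_on ({0..1} \<times> K) (\<lambda>(t, z). volterra (\<lambda>s. h s z) t)"
proof -
  have "continuous_on (({0..1::real} \<times> K) \<times> cbox 0 1) (\<lambda>q. (fst (fst q) * snd q, snd (fst q)))"
    by (intro continuous_intros) 
  moreover have "(fst (fst q) * snd q, snd (fst q)) \<in> {0..1} \<times> K" if "q \<in> ({0..1} \<times> K) \<times> cbox 0 1" for q :: "(real \<times> 'e) \<times> real"
    using that unit_interval_mult[of "fst (fst q)" "snd q"] by (auto simp: mem_Times_iff)
  ultimately have "continuous_on (({0..1} \<times> K) \<times> cbox 0 1)
      (\<lambda>q. case (fst (fst q) * snd q, snd (fst q)) of (t, z) \<Rightarrow> h t z)"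
    by (intro continuous_on_compose2[OF assms]) blast+
  then have "continuous_on (({0..1} \<times> K) \<times> cbox 0 (1::real)) (\<lambda>(p, s). fst p *\<^sub>R h (fst p * s) (snd p))"
    by (auto simp: case_prod_beta intro!: continuous_intros)
  from integral_continuous_on_param[OF this] show ?thesis
    by (simp add: volterra_def case_prod_beta)
qed

text \<open>In finite dimensions continuity along a basis gives continuity in the operator norm. The
  operator norm is what the uniform estimates below require.\<close>

lemma continuous_on_Blinfun_derivative:
  fixes f :: "'p::t2_space \<Rightarrow> 'e::euclidean_space \<Rightarrow> 'f::real_normed_vector"
  assumes "Ck_param (Suc k) T f S"
  shows "continuous_on (T \<times> S) (\<lambda>(t, x). Blinfun (frechet_derivative (f t) (at x)))"
proof -
  have bl: "bounded_linear (frechet_derivative (f t) (at x))" if "t \<in> T" "x \<in> S" for t x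
    using Ck_param_has_derivative[OF assms that] by (rule has_derivative_bounded_linear)
  show ?thesis
  proof (rule continuous_on_blinfun_componentwise)
    fix i :: 'e
    have "continuous_on (T \<times> S) (\<lambda>(t, x). frechet_derivative (f t) (at x) i)"
      using Ck_param_continuous[OF Ck_param_derivative[OF assms]] .
    then show "continuous_on (T \<times> S) (\<lambda>p. blinfun_apply (case p of (t, x) \<Rightarrow> Blinfun (frechet_derivative (f t) (at x))) i)"
      by (rule continuous_on_cong[THEN iffD1, rotated 2]) (auto simp: bounded_linear_Blinfun_apply bl)
  qed
qed

text \<open>Differentiation under the integral sign. It is carried out on a ball around
  \<open>z\<close> because the Leibniz rule is stated for a convex domain.\<close>

lemma volterra_has_derivative:
  fixes h :: "real \<Rightarrow> 'e::euclidean_space \<Rightarrow> 'f::banach"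
  assumes "open S" "Ck_param (Suc k) {0..1} h S" "t \<in> {0..1}" "z \<in> S"
  shows "((\<lambda>z. volterra (\<lambda>s. h s z) t) has_derivative
    (\<lambda>v. volterra (\<lambda>s. frechet_derivative (h s) (at z) v) t)) (at z)"
proof -
  obtain r where r: "r > 0" "ball z r \<subseteq> S" using assms(1,4) openE by blast
  have bl: "bounded_linear (frechet_derivative (h t) (at x))" if "t \<in> {0..1}" "x \<in> S" for t x
    using Ck_param_has_derivative[OF assms(2) that] by (rule has_derivative_bounded_linear)
  define B where "B s x = Blinfun (frechet_derivative (h s) (at x))" for s x
  have B: "blinfun_apply (B s x) = frechet_derivative (h s) (at x)" if "s \<in> {0..1}" "x \<in> S" for s x
    unfolding B_def by (rule bounded_linear_Blinfun_apply[OF bl[OF that]])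
  have cB: "continuous_on ({0..1} \<times> S) (\<lambda>(s, x). B s x)"
    unfolding B_def by (rule continuous_on_Blinfun_derivative[OF assms(2)])
  have ts: "t * s \<in> {0..1}" if "s \<in> cbox 0 1" for s
    using unit_interval_mult[OF assms(3)] that by auto
  have "((\<lambda>z. integral (cbox 0 1) (\<lambda>s. t *\<^sub>R h (t * s) z)) has_derivative
      blinfun_apply (integral (cbox 0 1) (\<lambda>s. t *\<^sub>R B (t * s) z))) (at z within ball z r)"
  proof (rule leibniz_rule)
    show "((\<lambda>x. t *\<^sub>R h (t * s) x) has_derivative blinfun_apply (t *\<^sub>R B (t * s) x)) (at x within ball z r)"
      if "x \<in> ball z r" "s \<in> cbox 0 1" for x s
    proof -
      have x: "x \<in> S" using that r by auto
      have "(h (t * s) has_derivative blinfun_apply (B (t * s) x)) (at x within ball z r)"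
        using Ck_param_has_derivative[OF assms(2) ts[OF that(2)] x] B[OF ts[OF that(2)] x]
        by (auto intro: has_derivative_at_withinI)
      then show ?thesis by (auto simp: scaleR_blinfun.rep_eq intro: has_derivative_scaleR_right)
    qed
    show "(\<lambda>s. t *\<^sub>R h (t * s) x) integrable_on cbox 0 1" if "x \<in> ball z r" for x
    proof -
      have "x \<in> S" using that r by auto
      then show ?thesis
        using continuous_on_rescaled[OF continuous_on_param_slice[OF Ck_param_continuous[OF assms(2)]] assms(3)]
        by (auto intro!: integrable_continuous_interval)
    qed
    have "continuous_on (ball z r \<times> cbox 0 1) (\<lambda>q. (t * snd q, fst q))" by (intro continuous_intros)
    moreover have "(\<lambda>q. (t * snd q, fst q)) ` (ball z r \<times> cbox 0 1) \<subseteq> {0..1} \<times> S"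
      using ts r(2) by auto
    ultimately have "continuous_on (ball z r \<times> cbox 0 1) (\<lambda>q. B (t * snd q) (fst q))"
      using continuous_on_compose2[OF cB] by (fastforce simp: case_prod_beta)
    then show "continuous_on (ball z r \<times> cbox 0 1) (\<lambda>(x, s). t *\<^sub>R B (t * s) x)"
      by (auto simp: case_prod_beta intro!: continuous_intros)
  qed (use r in auto)
  then have "((\<lambda>z. volterra (\<lambda>s. h s z) t) has_derivative
      blinfun_apply (integral (cbox 0 1) (\<lambda>s. t *\<^sub>R B (t * s) z))) (at z)"
    using r by (simp add: volterra_def at_within_open[of z "ball z r"])
  moreover have "blinfun_apply (integral (cbox 0 1) (\<lambda>s. t *\<^sub>R B (t * s) z)) =
      (\<lambda>v. volterra (\<lambda>s. frechet_derivative (h s) (at z) v) t)"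
  proof
    fix v
    have "continuous_on {0..1} (\<lambda>s. t *\<^sub>R B (t * s) z)"
      using continuous_on_rescaled[OF continuous_on_param_slice[OF cB assms(4)] assms(3)] .
    then have "(\<lambda>s. t *\<^sub>R B (t * s) z) integrable_on cbox 0 1"
      by (auto intro!: integrable_continuous_interval)
    from blinfun_apply_integral[OF this] have "blinfun_apply (integral (cbox 0 1) (\<lambda>s. t *\<^sub>R B (t * s) z)) v =
        integral (cbox 0 1) (\<lambda>s. blinfun_apply (t *\<^sub>R B (t * s) z) v)" .
    also have "\<dots> = integral {0..1} (\<lambda>s. t *\<^sub>R frechet_derivative (h (t * s)) (at z) v)"
      using B[OF ts assms(4)] by (auto intro!: integral_cong simp: scaleR_blinfun.rep_eq)
    finally show "blinfun_apply (integral (cbox 0 1) (\<lambda>s. t *\<^sub>R B (t * s) z)) v =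
      volterra (\<lambda>s. frechet_derivative (h s) (at z) v) t" by (simp add: volterra_def)
  qed
  ultimately show ?thesis by (rule has_derivative_eq_rhs)
qed

lemma Ck_param_volterra:
  fixes h :: "real \<Rightarrow> 'e::euclidean_space \<Rightarrow> 'f::banach"
  assumes "open S" "Ck_param k {0..1} h S"
  shows "Ck_param k {0..1} (\<lambda>t z. volterra (\<lambda>s. h s z) t) S"
  using assms(2)
proof (induction k arbitrary: h)
  case 0
  then show ?case using continuous_on_volterra by auto
next
  case (Suc k)
  show ?case
  proof (rule Ck_param_SucI[OF assms(1)])
    show "((\<lambda>z. volterra (\<lambda>s. h s z) t) has_derivative
      (\<lambda>v. volterra (\<lambda>s. frechet_derivative (h s) (at z) v) t)) (at z)" if "t \<in> {0..1}" "z \<in> S" for t z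
      using volterra_has_derivative[OF assms(1) Suc.prems that] .
    show "continuous_on ({0..1} \<times> S) (\<lambda>(t, z). volterra (\<lambda>s. h s z) t)"
      using continuous_on_volterra[OF Ck_param_continuous[OF Suc.prems]] .
    show "Ck_param k {0..1} (\<lambda>t z. volterra (\<lambda>s. frechet_derivative (h s) (at z) v) t) S" for v
      using Suc.IH[OF Ck_param_derivative[OF Suc.prems]] .
  qed
qed

text \<open>The fundamental theorem of calculus after the substitution: it turns a differential
  equation for \<open>V\<close> into an integral equation.\<close>

lemma volterra_derivative:
  fixes V :: "real \<Rightarrow> 'f::banach"
  assumes "\<And>t. t \<in> {0..1} \<Longrightarrow> (V has_vector_derivative h t) (at t within {0..1})" "t \<in> {0..1}"
  shows "volterra h t = V t - V 0"
proof -
  have "((\<lambda>s. V (t * s)) has_vector_derivative t *\<^sub>R h (t * s)) (at s within {0..1})" if "s \<in> {0..1}" for s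
  proof -
    have "((\<lambda>s. t * s) has_vector_derivative t) (at s within {0..1})"
      by (auto intro!: derivative_eq_intros)
    moreover have "(V has_vector_derivative h (t * s)) (at (t * s) within (\<lambda>s. t * s) ` {0..1})"
    proof (rule has_vector_derivative_within_subset)
      show "(V has_vector_derivative h (t * s)) (at (t * s) within {0..1})"
        using assms(1) unit_interval_mult[OF assms(2) that] .
      show "(\<lambda>s. t * s) ` {0..1} \<subseteq> {0..1}" using unit_interval_mult[OF assms(2)] by blast
    qed
    ultimately show ?thesis
      using vector_diff_chain_within[of "\<lambda>s. t * s" t s "{0..1}" V "h (t * s)"] by (simp add: o_def)
  qed
  then have "((\<lambda>s. t *\<^sub>R h (t * s)) has_integral V (t * 1) - V (t * 0)) {0..1}"
    by (intro fundamental_theorem_of_calculus) auto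
  from integral_unique[OF this] show ?thesis unfolding volterra_def by simp
qed

lemma volterra_has_vector_derivative:
  fixes h :: "real \<Rightarrow> 'f::banach"
  assumes "continuous_on {0..1} h" "t \<in> {0..1}"
  shows "(volterra h has_vector_derivative h t) (at t within {0..1})"
proof -
  define V where "V t = integral {0..t} h" for t
  have V: "(V has_vector_derivative h t) (at t within {0..1})" if "t \<in> {0..1}" for t
    unfolding V_def using integral_has_vector_derivative[OF assms(1) that] .
  have "volterra h t = V t" if "t \<in> {0..1}" for t
    using volterra_derivative[OF V that] by (simp add: V_def)
  then show ?thesis
    using has_vector_derivative_transform[OF assms(2) _ V[OF assms(2)]] by blast
qed

subsection \<open>Existence and uniqueness\<close>

text \<open>Banach's fixed point theorem in the space of bounded continuous functions of time and
  parameter together, so that joint continuity of the solution comes for free. On an interval of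
  length 1 the Lipschitz constant 1/2 makes the integral operator a contraction.\<close>

lemma integral_equation_solution:
  fixes b :: "real \<Rightarrow> 'e::euclidean_space \<Rightarrow> 'f::banach"
    and F :: "real \<Rightarrow> 'e \<Rightarrow> 'f \<Rightarrow> 'f"
  assumes K: "compact K" "convex K" "K \<noteq> {}"
    and b: "continuous_on ({0..1} \<times> K) (\<lambda>(t, z). b t z)"
    and F: "continuous_on ({0..1} \<times> K \<times> UNIV) (\<lambda>(t, z, Y). F t z Y)"
    and lip: "\<And>t z Y Y'. t \<in> {0..1} \<Longrightarrow> z \<in> K \<Longrightarrow> norm (F t z Y - F t z Y') \<le> 1/2 * norm (Y - Y')"
  obtains y where "continuous_on ({0..1} \<times> K) (\<lambda>(t, z). y t z)"
    "\<And>t z. t \<in> {0..1} \<Longrightarrow> z \<in> K \<Longrightarrow> y t z = b t z + volterra (\<lambda>s. F s z (y s z)) t"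
proof -
  \<comment> \<open>A continuous retraction of the whole space onto the compact convex set
    \<open>{0..1} \<times> K\<close>. Precomposing with it turns functions on this set into bounded
    continuous functions on the full type, which form a complete space.\<close>
  define \<rho> where "\<rho> p = (closest_point {0..1::real} (fst p), closest_point K (snd p))" for p :: "real \<times> 'e"
  have \<rho>_mem: "\<rho> p \<in> {0..1} \<times> K" for p
    using closest_point_in_set[of "{0..1::real}"] closest_point_in_set[of K] K
    by (auto simp: \<rho>_def compact_imp_closed simp del: atLeastAtMost_iff)
  have \<rho>_cont: "continuous_on UNIV \<rho>"
    unfolding \<rho>_def using K
    by (intro continuous_on_Pair continuous_on_compose2[OF continuous_on_closest_point[of _ UNIV]] continuous_intros)
       (auto simp: compact_imp_closed)
  have \<rho>_id: "\<rho> p = p" if "p \<in> {0..1} \<times> K" for p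
    using that by (auto simp: \<rho>_def closest_point_self)
  define G where "G \<gamma> p = b (fst p) (snd p) + volterra (\<lambda>s. F s (snd p) (apply_bcontfun \<gamma> (s, snd p))) (fst p)"
    for \<gamma> :: "(real \<times> 'e) \<Rightarrow>\<^sub>C 'f" and p
  have cF: "continuous_on ({0..1} \<times> K) (\<lambda>(s, z). F s z (apply_bcontfun \<gamma> (s, z)))" for \<gamma>
  proof -
    have "continuous_on ({0..1} \<times> K) (\<lambda>p. (fst p, snd p, apply_bcontfun \<gamma> p))"
      by (intro continuous_intros) auto
    moreover have "(\<lambda>p. (fst p, snd p, apply_bcontfun \<gamma> p)) ` ({0..1} \<times> K) \<subseteq> {0..1} \<times> K \<times> UNIV"
      by auto
    ultimately show ?thesis using continuous_on_compose2[OF F] by (fastforce simp: case_prod_beta)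
  qed
  have cG: "continuous_on ({0..1} \<times> K) (G \<gamma>)" for \<gamma>
    unfolding G_def using b continuous_on_volterra[OF cF, of \<gamma>]
    by (auto simp: case_prod_beta intro!: continuous_intros)
  define T where "T \<gamma> = Bcontfun (\<lambda>p. G \<gamma> (\<rho> p))" for \<gamma>
  have T: "apply_bcontfun (T \<gamma>) = (\<lambda>p. G \<gamma> (\<rho> p))" for \<gamma>
  proof -
    have "continuous_on UNIV (\<lambda>p. G \<gamma> (\<rho> p))"
      using continuous_on_compose2[OF cG \<rho>_cont] \<rho>_mem by blast
    moreover have "bounded (G \<gamma> ` ({0..1} \<times> K))"
      by (intro compact_imp_bounded compact_continuous_image cG compact_Times K) auto
    then have "bounded (range (\<lambda>p. G \<gamma> (\<rho> p)))"
      by (rule bounded_subset) (use \<rho>_mem in auto)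
    ultimately have "(\<lambda>p. G \<gamma> (\<rho> p)) \<in> bcontfun" by (simp add: bcontfun_def)
    then show ?thesis unfolding T_def by (simp add: Bcontfun_inverse)
  qed
  have contr: "dist (T \<gamma>) (T \<gamma>') \<le> 1/2 * dist \<gamma> \<gamma>'" for \<gamma> \<gamma>'
  proof (rule dist_bound)
    fix p
    obtain t z where tz: "\<rho> p = (t, z)" "t \<in> {0..1}" "z \<in> K" using \<rho>_mem[of p] by auto
    have c: "continuous_on {0..1} (\<lambda>s. F s z (apply_bcontfun \<gamma> (s, z)))" for \<gamma>
      using continuous_on_param_slice[OF cF tz(3)] .
    have "norm (F s z (apply_bcontfun \<gamma> (s, z)) - F s z (apply_bcontfun \<gamma>' (s, z))) \<le> 1/2 * dist \<gamma> \<gamma>'"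
      if "s \<in> {0..1}" for s
      using lip[OF that tz(3), of "apply_bcontfun \<gamma> (s, z)" "apply_bcontfun \<gamma>' (s, z)"]
        dist_bounded[of \<gamma> "(s, z)" \<gamma>'] by (simp add: dist_norm)
    then have "norm (volterra (\<lambda>s. F s z (apply_bcontfun \<gamma> (s, z)) - F s z (apply_bcontfun \<gamma>' (s, z))) t)
        \<le> 1/2 * dist \<gamma> \<gamma>'"
      using tz(2) by (intro volterra_bound) auto
    then show "dist (apply_bcontfun (T \<gamma>) p) (apply_bcontfun (T \<gamma>') p) \<le> 1/2 * dist \<gamma> \<gamma>'"
      unfolding T G_def tz by (simp add: volterra_diff[OF c c tz(2)] dist_norm)
  qed
  obtain \<gamma> where \<gamma>: "T \<gamma> = \<gamma>" using banach_fix_type[of "1/2" T] contr by auto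
  show ?thesis
  proof (rule that[of "\<lambda>t z. apply_bcontfun \<gamma> (t, z)"])
    fix t :: real and z assume "t \<in> {0..1}" "z \<in> K"
    then have "apply_bcontfun \<gamma> (t, z) = G \<gamma> (t, z)" using T[of \<gamma>] \<gamma> \<rho>_id[of "(t, z)"] by simp
    then show "apply_bcontfun \<gamma> (t, z) = b t z + volterra (\<lambda>s. F s z (apply_bcontfun \<gamma> (s, z))) t"
      by (simp add: G_def)
  qed auto
qed

text \<open>The hypothesis is applied at a point where \<open>norm (e s)\<close> is maximal, with
  \<open>M\<close> this maximum, and then solved for it. It takes the place of a Gronwall
  inequality.\<close>

lemma sup_estimate:
  fixes e :: "real \<Rightarrow> 'f::real_normed_vector"
  assumes "continuous_on {0..1} e" "q < 1"
    and est: "\<And>M t. t \<in> {0..1} \<Longrightarrow> (\<And>s. s \<in> {0..1} \<Longrightarrow> norm (e s) \<le> M) \<Longrightarrow> norm (e t) \<le> a + q * M"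
    and "t \<in> {0..1}"
  shows "norm (e t) \<le> a / (1 - q)"
proof -
  have "continuous_on {0..1} (\<lambda>s. norm (e s))" using assms(1) by (intro continuous_intros)
  then obtain t0 where t0: "t0 \<in> {0..1}" "\<And>s. s \<in> {0..1} \<Longrightarrow> norm (e s) \<le> norm (e t0)"
    using continuous_attains_sup[of "{0..1::real}" "\<lambda>s. norm (e s)"] by auto
  have "norm (e t0) \<le> a + q * norm (e t0)" using est[OF t0(1) t0(2)] .
  then have "norm (e t0) \<le> a / (1 - q)" using assms(2) by (simp add: field_simps)
  then show ?thesis using t0(2)[OF assms(4)] by simp
qed

lemma linear_integral_equation_unique:
  fixes e :: "real \<Rightarrow> 'f::banach" and A :: "real \<Rightarrow> 'f \<Rightarrow> 'f"
  assumes "continuous_on {0..1} e" "\<And>t::real. t \<in> {0..1} \<Longrightarrow> e t = volterra (\<lambda>s. A s (e s)) t"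
    and "\<And>s w. s \<in> {0..1} \<Longrightarrow> norm (A s w) \<le> 1/2 * norm w" "t \<in> {0..1::real}"
  shows "e t = (0 :: 'f)"
proof -
  have "norm (e t) \<le> 0 / (1 - 1/2)"
  proof (rule sup_estimate[OF assms(1) _ _ assms(4)])
    fix M and t :: real assume *: "t \<in> {0..1}" "\<And>s. s \<in> {0..1} \<Longrightarrow> norm (e s) \<le> M"
    have "norm (A s (e s)) \<le> 1/2 * M" if "s \<in> {0..1}" for s
      using assms(3)[OF that, of "e s"] *(2)[OF that] by linarith
    then have "norm (volterra (\<lambda>s. A s (e s)) t) \<le> 1/2 * M"
      using *(1) by (rule volterra_bound)
    then show "norm (e t) \<le> 0 + 1/2 * M" using assms(2)[OF *(1)] by simp
  qed auto
  then show ?thesis by simp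
qed

subsection \<open>Differentiable dependence on parameters\<close>

text \<open>The remainder of the first-order expansion is uniform along a compact curve. Near the
  curve the derivative varies by at most \<epsilon> on balls of one common radius, and the mean
  value inequality converts this into the estimate.\<close>

lemma uniform_differentiability:
  fixes f :: "real \<Rightarrow> 'e::euclidean_space \<Rightarrow> 'f::real_normed_vector"
  assumes S: "open S" and f: "Ck_param (Suc k) {0..1} f S"
    and p: "continuous_on {0..1} p" "\<And>s. s \<in> {0..1} \<Longrightarrow> p s \<in> S" and \<epsilon>: "\<epsilon> > 0"
  obtains d where "d > 0" "\<And>s \<eta>. s \<in> {0..1} \<Longrightarrow> norm \<eta> < d \<Longrightarrow>
    norm (f s (p s + \<eta>) - f s (p s) - frechet_derivative (f s) (at (p s)) \<eta>) \<le> \<epsilon> * norm \<eta>"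
proof -
  define B where "B s x = Blinfun (frechet_derivative (f s) (at x))" for s x
  have B: "blinfun_apply (B s x) = frechet_derivative (f s) (at x)" if "s \<in> {0..1}" "x \<in> S" for s x
    unfolding B_def using has_derivative_bounded_linear[OF Ck_param_has_derivative[OF f that]]
    by (rule bounded_linear_Blinfun_apply)
  have cB: "continuous_on ({0..1} \<times> S) (\<lambda>q. B (fst q) (snd q))"
    using continuous_on_Blinfun_derivative[OF f] by (simp add: B_def case_prod_beta)
  have "\<exists>r>0. ball (p s) r \<subseteq> S \<and>
      (\<forall>q\<in>{0..1} \<times> S. dist q (s, p s) < r \<longrightarrow> dist (B (fst q) (snd q)) (B s (p s)) < \<epsilon>/2)"
    if s: "s \<in> {0..1}" for s
  proof -
    obtain r1 where r1: "r1 > 0" "ball (p s) r1 \<subseteq> S" using S p(2)[OF s] openE by blast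
    have "(s, p s) \<in> {0..1} \<times> S" using s p(2) by auto
    then obtain r2 where r2: "r2 > 0" "\<And>q. q \<in> {0..1} \<times> S \<Longrightarrow> dist q (s, p s) < r2 \<Longrightarrow>
        dist (B (fst q) (snd q)) (B s (p s)) < \<epsilon>/2"
      using cB[unfolded continuous_on_iff] \<epsilon> by (metis fst_conv half_gt_zero snd_conv)
    show ?thesis
      by (rule exI[of _ "min r1 r2"]) (use r1 r2 in \<open>auto simp: subset_ball dest: subsetD\<close>)
  qed
  then obtain r where r: "\<And>s. s \<in> {0..1} \<Longrightarrow> r s > 0 \<and> ball (p s) (r s) \<subseteq> S \<and>
      (\<forall>q\<in>{0..1} \<times> S. dist q (s, p s) < r s \<longrightarrow> dist (B (fst q) (snd q)) (B s (p s)) < \<epsilon>/2)"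
    by metis
  have "compact ((\<lambda>s. (s, p s)) ` {0..1})"
    by (intro compact_continuous_image continuous_intros p(1)) auto
  moreover have "(\<lambda>s. (s, p s)) ` {0..1} \<subseteq> \<Union> ((\<lambda>s. ball (s, p s) (r s)) ` {0..1})"
    using r by force
  \<comment> \<open>A Lebesgue number of the cover: the ball of radius \<open>d\<close> around a
    point of the curve lies in one of the chosen balls, so two derivatives taken there at the same
    time both differ from that of the centre by less than \<epsilon>/2.\<close>
  ultimately obtain d where d: "d > 0" and
    dG: "\<And>x. x \<in> (\<lambda>s. (s, p s)) ` {0..1} \<Longrightarrow> \<exists>G\<in>(\<lambda>s. ball (s, p s) (r s)) ` {0..1}. ball x d \<subseteq> G"
    by (rule Heine_Borel_lemma) auto
  show ?thesis
  proof (rule that[OF d])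
    fix s \<eta> assume s: "s \<in> {0..1::real}" and \<eta>: "norm (\<eta> :: 'e) < d"
    obtain s0 where s0: "s0 \<in> {0..1}" "ball (s, p s) d \<subseteq> ball (s0, p s0) (r s0)"
      using dG[of "(s, p s)"] s by auto
    have q: "x \<in> S \<and> dist (B s x) (B s0 (p s0)) < \<epsilon>/2" if "x \<in> ball (p s) d" for x
    proof -
      have "(s, x) \<in> ball (s, p s) d" using that by (simp add: dist_Pair_Pair)
      then have *: "dist (s, x) (s0, p s0) < r s0" using s0(2) by (auto simp: dist_commute)
      then have "dist x (p s0) < r s0" using dist_snd_le[of "(s, x)" "(s0, p s0)"] by simp
      then have "x \<in> S" using r[OF s0(1)] by (auto simp: dist_commute)
      moreover from this * have "dist (B s x) (B s0 (p s0)) < \<epsilon>/2" using r[OF s0(1)] s by auto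
      ultimately show ?thesis ..
    qed
    have "norm (f s (p s + \<eta>) - f s (p s) - blinfun_apply (B s (p s)) ((p s + \<eta>) - p s))
        \<le> norm ((p s + \<eta>) - p s) * \<epsilon>"
    proof (rule differentiable_bound_linearization[where S = "ball (p s) d" and f' = "\<lambda>x. blinfun_apply (B s x)"])
      fix t :: real assume "t \<in> {0..1}"
      then have "norm (t *\<^sub>R \<eta>) \<le> norm \<eta>" by (auto simp: mult_left_le_one_le)
      then show "p s + t *\<^sub>R (p s + \<eta> - p s) \<in> ball (p s) d" using \<eta> by (simp add: dist_norm)
    next
      fix x assume x: "x \<in> ball (p s) d"
      show "(f s has_derivative blinfun_apply (B s x)) (at x within ball (p s) d)"
        using Ck_param_has_derivative[OF f s] q[OF x] B[OF s] by (auto intro: has_derivative_at_withinI)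
      have "dist (B s x) (B s (p s)) \<le> \<epsilon>"
        using dist_triangle_half_r[of "B s0 (p s0)" "B s x" \<epsilon> "B s (p s)"] q[OF x] q[of "p s"] d
        by (simp add: dist_commute)
      then show "onorm (blinfun_apply (B s x) - blinfun_apply (B s (p s))) \<le> \<epsilon>"
        by (simp add: dist_norm norm_blinfun.rep_eq minus_blinfun.rep_eq fun_diff_def)
    qed (use d in auto)
    then show "norm (f s (p s + \<eta>) - f s (p s) - frechet_derivative (f s) (at (p s)) \<eta>) \<le> \<epsilon> * norm \<eta>"
      using B[OF s p(2)[OF s]] by (simp add: mult.commute)
  qed
qed

text \<open>The candidate \<open>W v\<close> for the derivative in direction \<open>v\<close> solves
  the linearised equation, a contraction by \<open>bound\<close>. Two applications of
  \<open>sup_estimate\<close> compare it with the increment of \<open>y\<close>: the first shows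
  that the increment is of order \<open>norm h\<close>, the second that its difference from
  \<open>W\<close> is of smaller order.\<close>

lemma integral_equation_differentiable:
  fixes b :: "real \<Rightarrow> 'e::euclidean_space \<Rightarrow> 'f::euclidean_space"
    and f :: "real \<Rightarrow> 'e \<times> 'f \<Rightarrow> 'f" and y :: "real \<Rightarrow> 'e \<Rightarrow> 'f"
  assumes U: "open U" and V: "open V" and b: "Ck_param (Suc 0) {0..1} b U"
    and f: "Ck_param (Suc 0) {0..1} f V"
    and y: "continuous_on ({0..1} \<times> U) (\<lambda>(t, z). y t z)"
    and mem: "\<And>t z. t \<in> {0..1} \<Longrightarrow> z \<in> U \<Longrightarrow> (z, y t z) \<in> V"
    and eq: "\<And>t z. t \<in> {0..1} \<Longrightarrow> z \<in> U \<Longrightarrow> y t z = b t z + volterra (\<lambda>s. f s (z, y s z)) t"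
    and bound: "\<And>t z w. t \<in> {0..1} \<Longrightarrow> z \<in> U \<Longrightarrow>
      norm (frechet_derivative (f t) (at (z, y t z)) (0, w)) \<le> 1/2 * norm w"
    and z0: "z0 \<in> U"
  obtains r W where "r > 0" "ball z0 r \<subseteq> U" "\<And>v. continuous_on ({0..1} \<times> ball z0 r) (\<lambda>(t, z). W v t z)"
    "\<And>t z. t \<in> {0..1} \<Longrightarrow> z \<in> ball z0 r \<Longrightarrow> (y t has_derivative (\<lambda>v. W v t z)) (at z)"
    "\<And>v t z. t \<in> {0..1} \<Longrightarrow> z \<in> ball z0 r \<Longrightarrow> W v t z = frechet_derivative (b t) (at z) v
      + volterra (\<lambda>s. frechet_derivative (f s) (at (z, y s z)) (v, W v s z)) t"
proof -
  obtain r0 where r0: "r0 > 0" "cball z0 r0 \<subseteq> U" using U z0 open_contains_cball by blast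
  define K where "K = cball z0 r0"
  have K: "compact K" "convex K" "K \<noteq> {}" "K \<subseteq> U" "ball z0 r0 \<subseteq> K"
    using r0 by (auto simp: K_def)
  define Bb where "Bb t z = Blinfun (frechet_derivative (b t) (at z))" for t z
  define A where "A t z = Blinfun (frechet_derivative (f t) (at (z, y t z)))" for t z
  have Bb: "blinfun_apply (Bb t z) = frechet_derivative (b t) (at z)" if "t \<in> {0..1}" "z \<in> U" for t z
    unfolding Bb_def using has_derivative_bounded_linear[OF Ck_param_has_derivative[OF b that]]
    by (rule bounded_linear_Blinfun_apply)
  have A: "blinfun_apply (A t z) = frechet_derivative (f t) (at (z, y t z))" if "t \<in> {0..1}" "z \<in> U" for t z
    unfolding A_def using has_derivative_bounded_linear[OF Ck_param_has_derivative[OF f that(1) mem[OF that]]]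
    by (rule bounded_linear_Blinfun_apply)
  have cBb: "continuous_on ({0..1} \<times> U) (\<lambda>(t, z). Bb t z)"
    using continuous_on_Blinfun_derivative[OF b] by (simp add: Bb_def)
  have cA: "continuous_on ({0..1} \<times> U) (\<lambda>(t, z). A t z)"
  proof -
    have "continuous_on ({0..1} \<times> U) (\<lambda>q. (fst q, snd q, y (fst q) (snd q)))"
      using y by (intro continuous_intros) (auto simp: case_prod_beta)
    moreover have "(\<lambda>q. (fst q, snd q, y (fst q) (snd q))) ` ({0..1} \<times> U) \<subseteq> {0..1} \<times> V"
      using mem by auto
    ultimately have "continuous_on ({0..1} \<times> U) (\<lambda>q. case (fst q, snd q, y (fst q) (snd q)) of
        (t, x) \<Rightarrow> Blinfun (frechet_derivative (f t) (at x)))"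
      by (rule continuous_on_compose2[OF continuous_on_Blinfun_derivative[OF f]])
    then show ?thesis by (simp add: A_def case_prod_beta)
  qed
  have Abound: "norm (blinfun_apply (A t z) (0, w)) \<le> 1/2 * norm w" if "t \<in> {0..1}" "z \<in> U" for t z w
    using bound[OF that] A[OF that] by simp
  have A_split: "blinfun_apply (A t z) (v, w) = blinfun_apply (A t z) (v, 0) + blinfun_apply (A t z) (0, w)"
    for t z v w
    by (simp flip: blinfun.add_right)
  have A_diff: "blinfun_apply (A t z) (v, w) - blinfun_apply (A t z) (v', w') = blinfun_apply (A t z) (v - v', w - w')"
    for t z v v' w w'
    by (simp flip: blinfun.diff_right)
  have "\<exists>W. continuous_on ({0..1} \<times> K) (\<lambda>(t, z). W t z) \<and> (\<forall>t\<in>{0..1}. \<forall>z\<in>K.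
      W t z = blinfun_apply (Bb t z) v + volterra (\<lambda>s. blinfun_apply (A s z) (v, W s z)) t)" for v
  proof -
    have cb: "continuous_on ({0..1} \<times> K) (\<lambda>(t, z). blinfun_apply (Bb t z) v)"
      using continuous_on_subset[OF cBb, of "{0..1} \<times> K"] K
      by (auto simp: case_prod_beta intro!: continuous_intros)
    have "continuous_on ({0..1} \<times> K \<times> UNIV) (\<lambda>q::real \<times> 'e \<times> 'f. A (fst q) (fst (snd q)))"
    proof -
      have "continuous_on ({0..1} \<times> K \<times> UNIV) (\<lambda>q::real \<times> 'e \<times> 'f. (fst q, fst (snd q)))"
        by (intro continuous_intros)
      moreover have "(\<lambda>q::real \<times> 'e \<times> 'f. (fst q, fst (snd q))) ` ({0..1} \<times> K \<times> UNIV) \<subseteq> {0..1} \<times> U"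
        using K by auto
      ultimately have "continuous_on ({0..1} \<times> K \<times> UNIV)
          (\<lambda>q::real \<times> 'e \<times> 'f. case (fst q, fst (snd q)) of (t, z) \<Rightarrow> A t z)"
        by (rule continuous_on_compose2[OF cA])
      then show ?thesis by simp
    qed
    then have cF: "continuous_on ({0..1} \<times> K \<times> UNIV) (\<lambda>(t, z, Y). blinfun_apply (A t z) (v, Y))"
      by (auto simp: case_prod_beta intro!: continuous_intros)
    have lip: "norm (blinfun_apply (A t z) (v, Y) - blinfun_apply (A t z) (v, Y')) \<le> 1/2 * norm (Y - Y')"
      if "t \<in> {0..1}" "z \<in> K" for t z Y Y'
      using Abound[OF that(1), of z "Y - Y'"] that K by (auto simp: A_diff)
    show ?thesis
    proof (rule integral_equation_solution[OF K(1-3) cb cF lip])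
      fix W assume "continuous_on ({0..1} \<times> K) (\<lambda>(t, z). W t z)"
        "\<And>t z. t \<in> {0..1} \<Longrightarrow> z \<in> K \<Longrightarrow>
          W t z = blinfun_apply (Bb t z) v + volterra (\<lambda>s. blinfun_apply (A s z) (v, W s z)) t"
      then show ?thesis by (intro exI[of _ W]) simp
    qed
  qed
  then have "\<forall>v. \<exists>W. continuous_on ({0..1} \<times> K) (\<lambda>(t, z). W t z) \<and> (\<forall>t\<in>{0..1}. \<forall>z\<in>K.
      W t z = blinfun_apply (Bb t z) v + volterra (\<lambda>s. blinfun_apply (A s z) (v, W s z)) t)" ..
  from choice[OF this] obtain W where
    W_all: "\<forall>v. continuous_on ({0..1} \<times> K) (\<lambda>(t, z). W v t z) \<and> (\<forall>t\<in>{0..1}. \<forall>z\<in>K.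
      W v t z = blinfun_apply (Bb t z) v + volterra (\<lambda>s. blinfun_apply (A s z) (v, W v s z)) t)" ..
  have cW: "continuous_on ({0..1} \<times> K) (\<lambda>(t, z). W v t z)" for v
    using W_all[rule_format, of v] by (rule conjunct1)
  have W: "W v t z = blinfun_apply (Bb t z) v + volterra (\<lambda>s. blinfun_apply (A s z) (v, W v s z)) t"
    if "t \<in> {0..1}" "z \<in> K" for v t z
    using W_all[rule_format, of v, THEN conjunct2] that by simp
  have cAs: "continuous_on {0..1} (\<lambda>s. A s z)" if "z \<in> K" for z
    using continuous_on_param_slice[OF cA] that K by auto
  have cWs: "continuous_on {0..1} (\<lambda>s. W v s z)" if "z \<in> K" for z v
    using continuous_on_param_slice[OF cW] that by auto
  \<comment> \<open>The \<open>W v\<close> were chosen separately for each \<open>v\<close>.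
    Linearity holds because the defect solves the homogeneous linearised equation, whose only
    continuous solution is 0.\<close>
  have lin: "linear (\<lambda>v. W v t z)" if t: "t \<in> {0..1}" and z: "z \<in> K" for t z
  proof (rule linearI)
    fix u v
    have zU: "z \<in> U" using z K by auto
    have cc: "continuous_on {0..1} (\<lambda>s. blinfun_apply (A s z) (v, W v s z))" for v
      by (intro continuous_intros cAs cWs z)
    have "W (u + v) t z - (W u t z + W v t z) = 0"
    proof (rule linear_integral_equation_unique[where A = "\<lambda>s w. blinfun_apply (A s z) (0, w)"
          and e = "\<lambda>t. W (u + v) t z - (W u t z + W v t z)"])
      fix t :: real assume t: "t \<in> {0..1}"
      have "blinfun_apply (A s z) (0, W (u + v) s z - (W u s z + W v s z)) = blinfun_apply (A s z) (u + v, W (u + v) s z)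
          - (blinfun_apply (A s z) (u, W u s z) + blinfun_apply (A s z) (v, W v s z))" for s
        by (simp flip: blinfun.diff_right blinfun.add_right)
      then show "W (u + v) t z - (W u t z + W v t z) =
          volterra (\<lambda>s. blinfun_apply (A s z) (0, W (u + v) s z - (W u s z + W v s z))) t"
        by (simp add: volterra_diff[OF cc continuous_on_add[OF cc cc] t] volterra_add[OF cc cc t] W[OF t z, of "u + v"] W[OF t z, of u] W[OF t z, of v] blinfun.add_right)
    qed (use t Abound zU cWs z in \<open>auto intro!: continuous_intros\<close>)
    then show "W (u + v) t z = W u t z + W v t z" by simp
  next
    fix c v
    have zU: "z \<in> U" using z K by auto
    have cc: "continuous_on {0..1} (\<lambda>s. blinfun_apply (A s z) (v, W v s z))" for v
      by (intro continuous_intros cAs cWs z)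
    have "W (c *\<^sub>R v) t z - c *\<^sub>R W v t z = 0"
    proof (rule linear_integral_equation_unique[where A = "\<lambda>s w. blinfun_apply (A s z) (0, w)"
          and e = "\<lambda>t. W (c *\<^sub>R v) t z - c *\<^sub>R W v t z"])
      fix t :: real assume t: "t \<in> {0..1}"
      have "blinfun_apply (A s z) (0, W (c *\<^sub>R v) s z - c *\<^sub>R W v s z) = blinfun_apply (A s z) (c *\<^sub>R v, W (c *\<^sub>R v) s z)
          - c *\<^sub>R blinfun_apply (A s z) (v, W v s z)" for s
        by (simp flip: blinfun.diff_right blinfun.scaleR_right)
      then show "W (c *\<^sub>R v) t z - c *\<^sub>R W v t z =
          volterra (\<lambda>s. blinfun_apply (A s z) (0, W (c *\<^sub>R v) s z - c *\<^sub>R W v s z)) t"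
        by (simp add: volterra_scaleR volterra_diff[OF cc continuous_on_scaleR[OF continuous_on_const cc] t] W[OF t z, of "c *\<^sub>R v"] W[OF t z, of v]
            blinfun.scaleR_right scaleR_add_right)
    qed (use t Abound zU cWs z in \<open>auto intro!: continuous_intros\<close>)
    then show "W (c *\<^sub>R v) t z = c *\<^sub>R W v t z" by simp
  qed
  have deriv: "(y t has_derivative (\<lambda>v. W v t z)) (at z)" if t: "t \<in> {0..1}" and z: "z \<in> ball z0 r0" for t z
    unfolding has_derivative_at_alt
  proof (intro conjI allI impI)
    have zK: "z \<in> K" and zU: "z \<in> U" using z K by auto
    show "bounded_linear (\<lambda>v. W v t z)" using lin[OF t zK] by (simp add: linear_conv_bounded_linear)
    fix \<epsilon> :: real assume \<epsilon>: "\<epsilon> > 0"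
    have cys: "continuous_on {0..1} (\<lambda>s. y s z)" if "z \<in> U" for z
      using continuous_on_param_slice[OF y that] .
    have cfs: "continuous_on {0..1} (\<lambda>s. f s (z, y s z))" if "z \<in> U" for z
    proof -
      have "continuous_on {0..1} (\<lambda>s. (s, z, y s z))" using cys[OF that] by (intro continuous_intros)
      moreover have "(\<lambda>s. (s, z, y s z)) ` {0..1} \<subseteq> {0..1} \<times> V" using mem that by auto
      ultimately have "continuous_on {0..1} (\<lambda>s. case (s, z, y s z) of (t, x) \<Rightarrow> f t x)"
        by (rule continuous_on_compose2[OF Ck_param_continuous[OF f]])
      then show ?thesis by simp
    qed
    have "bounded ((\<lambda>s. A s z) ` {0..1})" "bounded ((\<lambda>s. Bb s z) ` {0..1})"
      using continuous_on_param_slice[OF cA zU] continuous_on_param_slice[OF cBb zU]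
      by (auto intro!: compact_imp_bounded compact_continuous_image)
    then obtain C1 C2 where C: "\<And>s. s \<in> {0..1} \<Longrightarrow> norm (A s z) \<le> C1" "\<And>s. s \<in> {0..1} \<Longrightarrow> norm (Bb s z) \<le> C2"
      unfolding bounded_iff by (metis imageI)
    define C where "C = max 0 (max C1 C2)"
    have C0: "C \<ge> 0" by (simp add: C_def)
    have CA: "norm (blinfun_apply (A s z) x) \<le> C * norm x" if "s \<in> {0..1}" for s x
    proof -
      have "norm (A s z) \<le> C" using C(1)[OF that] by (simp add: C_def)
      then show ?thesis using norm_blinfun[of "A s z" x] mult_right_mono[of "norm (A s z)" C "norm x"] by simp
    qed
    have CB: "norm (blinfun_apply (Bb s z) x) \<le> C * norm x" if "s \<in> {0..1}" for s x
    proof -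
      have "norm (Bb s z) \<le> C" using C(2)[OF that] by (simp add: C_def)
      then show ?thesis using norm_blinfun[of "Bb s z" x] mult_right_mono[of "norm (Bb s z)" C "norm x"] by simp
    qed
    \<comment> \<open>The bound that \<open>sup_estimate\<close> yields for the increment of
      \<open>y\<close>, with a = (2 C + 1) \<open>norm h\<close> and q = 3/4.\<close>
    define C' where "C' = 4 * (2 * C + 1)"
    have C': "C' > 0" using C0 by (simp add: C'_def)
    \<comment> \<open>The value 1/4 makes q = 1/2 + 1/4 in the estimate of the increment; the other
      entry brings the final error \<open>2 * (\<epsilon>1 * (2 + C'))\<close> below
      \<epsilon>.\<close>
    define \<epsilon>1 where "\<epsilon>1 = min (1/4) (\<epsilon> / (2 * (2 + C')))"
    have \<epsilon>1: "\<epsilon>1 > 0" "\<epsilon>1 \<le> 1/4"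
      using \<epsilon> C' unfolding \<epsilon>1_def by (simp_all only: min.cobounded1) simp
    have \<epsilon>1': "2 * (\<epsilon>1 * (2 + C')) \<le> \<epsilon>"
    proof -
      have "\<epsilon>1 \<le> \<epsilon> / (2 * (2 + C'))" by (simp add: \<epsilon>1_def)
      then show ?thesis using C' by (simp add: field_simps)
    qed
    obtain d1 where d1: "d1 > 0" "\<And>s \<eta>. s \<in> {0..1} \<Longrightarrow> norm \<eta> < d1 \<Longrightarrow>
        norm (f s ((z, y s z) + \<eta>) - f s (z, y s z) - blinfun_apply (A s z) \<eta>) \<le> \<epsilon>1 * norm \<eta>"
    proof (rule uniform_differentiability[OF V f _ _ \<epsilon>1(1), of "\<lambda>s. (z, y s z)"])
      show "continuous_on {0..1} (\<lambda>s. (z, y s z))" using cys[OF zU] by (intro continuous_intros)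
    qed (use mem zU A in auto)
    obtain d2 where d2: "d2 > 0" "\<And>s \<eta>. s \<in> {0..1} \<Longrightarrow> norm \<eta> < d2 \<Longrightarrow>
        norm (b s (z + \<eta>) - b s z - blinfun_apply (Bb s z) \<eta>) \<le> \<epsilon>1 * norm \<eta>"
      by (rule uniform_differentiability[OF U b _ _ \<epsilon>1(1), of "\<lambda>s. z"]) (use zU Bb in auto)
    obtain d4 where d4: "d4 > 0" "ball z d4 \<subseteq> K"
    proof -
      have "open (ball z0 r0)" by simp
      then show ?thesis using that openE[of "ball z0 r0" z] z K(5) by (metis order_trans)
    qed
    have "uniformly_continuous_on ({0..1} \<times> K) (\<lambda>(t, z). y t z)"
      using continuous_on_subset[OF y, of "{0..1} \<times> K"] K
      by (intro compact_uniformly_continuous compact_Times) auto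
    then obtain d3 where d3: "d3 > 0" "\<And>q q'. q \<in> {0..1} \<times> K \<Longrightarrow> q' \<in> {0..1} \<times> K \<Longrightarrow> dist q' q < d3 \<Longrightarrow>
        dist (case q' of (t, z) \<Rightarrow> y t z) (case q of (t, z) \<Rightarrow> y t z) < d1 / 2"
      unfolding uniformly_continuous_on_def using d1(1) by (metis half_gt_zero)
    \<comment> \<open>The entries keep the increment of the parameter below \<open>d1/2\<close>,
      make the expansion of \<open>b\<close> valid, force the increment of \<open>y\<close> below
      \<open>d1/2\<close>, and keep \<open>z'\<close> in \<open>K\<close>. Together the two
      increments stay within the radius \<open>d1\<close> for the expansion of
      \<open>f\<close>.\<close>
    define d where "d = min (min (d1/2) d2) (min d3 d4)"
    show "\<exists>d>0. \<forall>z'. norm (z' - z) < d \<longrightarrow> norm (y t z' - y t z - W (z' - z) t z) \<le> \<epsilon> * norm (z' - z)"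
    proof (intro exI[of _ d] conjI allI impI)
      show "d > 0" using d1(1) d2(1) d3(1) d4(1) by (simp add: d_def)
      fix z' assume z': "norm (z' - z) < d"
      define h where "h = z' - z"
      have h: "norm h < d1/2" "norm h < d2" "norm h < d3" "norm h < d4" "z' = z + h"
        using z' by (auto simp: h_def d_def)
      have z'K: "z' \<in> K" using h d4 by (auto simp: dist_norm)
      then have z'U: "z' \<in> U" using K by auto
      define \<delta> where "\<delta> s = y s z' - y s z" for s
      have c\<delta>: "continuous_on {0..1} \<delta>" unfolding \<delta>_def using cys zU z'U by (intro continuous_intros) auto
      have \<delta>: "norm (\<delta> s) < d1/2" if "s \<in> {0..1}" for s
      proof -
        have "dist (s, z') (s, z) = norm h" by (simp add: dist_Pair_Pair dist_norm h_def)
        then show ?thesis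
          using d3(2)[of "(s, z)" "(s, z')"] that zK z'K h(3) unfolding \<delta>_def by (simp add: dist_norm)
      qed
      define R where "R s = f s (z', y s z') - f s (z, y s z) - blinfun_apply (A s z) (h, \<delta> s)" for s
      have norm_pair: "norm (h, \<delta> s) \<le> norm h + norm (\<delta> s)" for s
        by (rule norm_Pair_le)
      have R: "norm (R s) \<le> \<epsilon>1 * (norm h + norm (\<delta> s))" if "s \<in> {0..1}" for s
      proof -
        have "norm (h, \<delta> s) < d1" using norm_pair[of s] \<delta>[OF that] h(1) by linarith
        from d1(2)[OF that this] have "norm (R s) \<le> \<epsilon>1 * norm (h, \<delta> s)"
          by (simp add: R_def h(5) \<delta>_def)
        also have "\<dots> \<le> \<epsilon>1 * (norm h + norm (\<delta> s))" using norm_pair \<epsilon>1 by simp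
        finally show ?thesis .
      qed
      have Rb: "norm (b s z' - b s z - blinfun_apply (Bb s z) h) \<le> \<epsilon>1 * norm h" if "s \<in> {0..1}" for s
        using d2(2)[OF that h(2)] h(5) by simp
      have \<delta>_eq: "\<delta> t = (b t z' - b t z) + volterra (\<lambda>s. f s (z', y s z') - f s (z, y s z)) t" if "t \<in> {0..1}" for t
        using eq[OF that z'U] eq[OF that zU] by (simp add: \<delta>_def volterra_diff[OF cfs[OF z'U] cfs[OF zU] that])
      \<comment> \<open>A Lipschitz bound at \<open>z\<close>, needed before the remainder
        \<open>R\<close> can be called small relative to \<open>norm h\<close>.\<close>
      have \<delta>_le: "norm (\<delta> t) \<le> C' * norm h" if "t \<in> {0..1}" for t
      proof -
        have "norm (\<delta> t) \<le> ((2 * C + 1) * norm h) / (1 - 3/4)"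
        proof (rule sup_estimate[OF c\<delta> _ _ that])
          fix M and t :: real assume t: "t \<in> {0..1}" and M: "\<And>s. s \<in> {0..1} \<Longrightarrow> norm (\<delta> s) \<le> M"
          have "norm (f s (z', y s z') - f s (z, y s z)) \<le> (C + 1/4) * norm h + 3/4 * M" if s: "s \<in> {0..1}" for s
          proof -
            have "f s (z', y s z') - f s (z, y s z) = R s + (blinfun_apply (A s z) (h, 0) + blinfun_apply (A s z) (0, \<delta> s))"
              using A_split[of s z h "\<delta> s"] by (simp add: R_def)
            then have "norm (f s (z', y s z') - f s (z, y s z)) \<le>
                norm (R s) + (norm (blinfun_apply (A s z) (h, 0)) + norm (blinfun_apply (A s z) (0, \<delta> s)))"
              by (simp only: order_trans[OF norm_triangle_ineq add_left_mono[OF norm_triangle_ineq]])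
            moreover have "norm (R s) \<le> 1/4 * (norm h + M)"
              using R[OF s] M[OF s] \<epsilon>1 mult_mono[of \<epsilon>1 "1/4" "norm h + norm (\<delta> s)" "norm h + M"] by simp
            moreover have "norm (blinfun_apply (A s z) (h, 0)) \<le> C * norm h" using CA[OF s, of "(h, 0)"] by simp
            moreover have "norm (blinfun_apply (A s z) (0, \<delta> s)) \<le> 1/2 * M"
              using Abound[OF s zU, of "\<delta> s"] M[OF s] by linarith
            ultimately show ?thesis by (simp add: algebra_simps)
          qed
          then have "norm (volterra (\<lambda>s. f s (z', y s z') - f s (z, y s z)) t) \<le> (C + 1/4) * norm h + 3/4 * M"
            using t by (rule volterra_bound)
          moreover have "norm (b t z' - b t z) \<le> (C + 1/4) * norm h"
          proof -
            have "norm (b t z' - b t z) \<le> norm (b t z' - b t z - blinfun_apply (Bb t z) h) + norm (blinfun_apply (Bb t z) h)"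
              using norm_triangle_ineq[of "b t z' - b t z - blinfun_apply (Bb t z) h" "blinfun_apply (Bb t z) h"] by simp
            also have "\<dots> \<le> \<epsilon>1 * norm h + C * norm h" using Rb[OF t] CB[OF t, of h] by linarith
            also have "\<dots> \<le> 1/4 * norm h + C * norm h" using \<epsilon>1 by (intro add_right_mono mult_right_mono) auto
            finally show ?thesis by (simp add: algebra_simps)
          qed
          moreover have "norm (\<delta> t) \<le> norm (b t z' - b t z) + norm (volterra (\<lambda>s. f s (z', y s z') - f s (z, y s z)) t)"
            unfolding \<delta>_eq[OF t] by (rule norm_triangle_ineq)
          ultimately have "norm (\<delta> t) \<le> (C + 1/4) * norm h + ((C + 1/4) * norm h + 3/4 * M)" by linarith
          also have "\<dots> \<le> (2 * C + 1) * norm h + 3/4 * M" by (simp add: algebra_simps)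
          finally show "norm (\<delta> t) \<le> (2 * C + 1) * norm h + 3/4 * M" .
        qed simp
        then show ?thesis by (simp add: C'_def algebra_simps)
      qed
      \<comment> \<open>Subtracting the equation for \<open>W\<close> leaves a linear equation for
        \<open>e\<close> in which only the remainders of \<open>b\<close> and \<open>f\<close>
        appear as inhomogeneity.\<close>
      define e where "e s = \<delta> s - W h s z" for s
      have ce: "continuous_on {0..1} e" unfolding e_def by (intro continuous_intros c\<delta> cWs zK)
      have "norm (e t) \<le> (\<epsilon>1 * (2 + C') * norm h) / (1 - 1/2)"
      proof (rule sup_estimate[OF ce _ _ t])
        fix M and t :: real assume t: "t \<in> {0..1}" and M: "\<And>s. s \<in> {0..1} \<Longrightarrow> norm (e s) \<le> M"
        have "norm (R s + blinfun_apply (A s z) (0, e s)) \<le> \<epsilon>1 * (1 + C') * norm h + 1/2 * M" if s: "s \<in> {0..1}" for s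
        proof -
          have "norm (R s) \<le> \<epsilon>1 * (norm h + C' * norm h)"
            using R[OF s] \<delta>_le[OF s] \<epsilon>1 by (smt (verit) mult_left_mono)
          moreover have "norm (blinfun_apply (A s z) (0, e s)) \<le> 1/2 * M"
            using Abound[OF s zU, of "e s"] M[OF s] by linarith
          ultimately show ?thesis
            using norm_triangle_ineq[of "R s" "blinfun_apply (A s z) (0, e s)"] by (simp add: algebra_simps)
        qed
        then have 1: "norm (volterra (\<lambda>s. R s + blinfun_apply (A s z) (0, e s)) t) \<le> \<epsilon>1 * (1 + C') * norm h + 1/2 * M"
          using t by (rule volterra_bound)
        have cAW: "continuous_on {0..1} (\<lambda>s. blinfun_apply (A s z) (h, W h s z))"
          by (intro continuous_intros cAs cWs zK)
        have "R s + blinfun_apply (A s z) (0, e s) =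
            (f s (z', y s z') - f s (z, y s z)) - blinfun_apply (A s z) (h, W h s z)" for s
          using A_diff[of s z h "\<delta> s" h "W h s z"] by (simp add: R_def e_def algebra_simps)
        then have "volterra (\<lambda>s. R s + blinfun_apply (A s z) (0, e s)) t =
            volterra (\<lambda>s. f s (z', y s z') - f s (z, y s z)) t - volterra (\<lambda>s. blinfun_apply (A s z) (h, W h s z)) t"
          using volterra_diff[OF continuous_on_diff[OF cfs[OF z'U] cfs[OF zU]] cAW t] by simp
        then have "e t = (b t z' - b t z - blinfun_apply (Bb t z) h) + volterra (\<lambda>s. R s + blinfun_apply (A s z) (0, e s)) t"
          unfolding e_def[of t] \<delta>_eq[OF t] W[OF t zK] by simp
        then have "norm (e t) \<le> norm (b t z' - b t z - blinfun_apply (Bb t z) h)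
            + norm (volterra (\<lambda>s. R s + blinfun_apply (A s z) (0, e s)) t)"
          by (simp only: norm_triangle_ineq)
        then have "norm (e t) \<le> \<epsilon>1 * norm h + (\<epsilon>1 * (1 + C') * norm h + 1/2 * M)"
          using 1 Rb[OF t] by linarith
        then show "norm (e t) \<le> \<epsilon>1 * (2 + C') * norm h + 1/2 * M" by (simp add: algebra_simps)
      qed simp
      also have "\<dots> = 2 * (\<epsilon>1 * (2 + C')) * norm h" by simp
      also have "\<dots> \<le> \<epsilon> * norm h" using \<epsilon>1' by (intro mult_right_mono) auto
      finally show "norm (y t z' - y t z - W (z' - z) t z) \<le> \<epsilon> * norm (z' - z)"
        by (simp add: e_def \<delta>_def h_def)
    qed
  qed
  show ?thesis
  proof (rule that[of r0 W])
    show "continuous_on ({0..1} \<times> ball z0 r0) (\<lambda>(t, z). W v t z)" for v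
      by (rule continuous_on_subset[OF cW]) (use K(5) in auto)
    show "W v t z = frechet_derivative (b t) (at z) v
      + volterra (\<lambda>s. frechet_derivative (f s) (at (z, y s z)) (v, W v s z)) t"
      if "t \<in> {0..1}" "z \<in> ball z0 r0" for v t z
    proof -
      have z: "z \<in> K" "z \<in> U" using that K by auto
      have "volterra (\<lambda>s. frechet_derivative (f s) (at (z, y s z)) (v, W v s z)) t =
          volterra (\<lambda>s. blinfun_apply (A s z) (v, W v s z)) t"
        by (rule volterra_cong[OF _ that(1)]) (simp add: A z(2))
      then show ?thesis using W[OF that(1) z(1), of v] Bb[OF that(1) z(2)] by simp
    qed
  qed (use r0 K deriv in auto)
qed

subsection \<open>Smooth dependence on parameters\<close>

lemma Ck_param_mono: "Ck_param m T f S \<Longrightarrow> k \<le> m \<Longrightarrow> Ck_param k T f S"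
proof (induction m)
  case (Suc m)
  then show ?case using Ck_param_Suc_imp le_SucE by metis
qed simp

lemma Ck_param_Pair:
  assumes "open S" "Ck_param k T f S" "Ck_param k T g S"
  shows "Ck_param k T (\<lambda>t x. (f t x, g t x)) S"
proof -
  have "Ck_param k T (\<lambda>t x. (f t x, 0)) S"
    by (rule Ck_param_bounded_linear[OF _ assms(1,2)])
       (intro bounded_linear_Pair bounded_linear_ident bounded_linear_zero)
  moreover have "Ck_param k T (\<lambda>t x. (0, g t x)) S"
    by (rule Ck_param_bounded_linear[OF _ assms(1,3)])
       (intro bounded_linear_Pair bounded_linear_ident bounded_linear_zero)
  ultimately show ?thesis using Ck_param_add[OF assms(1)] by fastforce
qed

text \<open>The derivative of \<open>W\<close> solves an equation with the same \<open>A\<close>.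
  Its inhomogeneity contains derivatives of \<open>b\<close> and \<open>A\<close>, and of the
  solution only \<open>W\<close> itself. The induction hypothesis is thus used twice: for
  \<open>W\<close>, to make this inhomogeneity \<open>k\<close> times differentiable, and then for
  the derivative of \<open>W\<close>. Hence \<open>U\<close>, \<open>b\<close> and \<open>W\<close>
  are generalised.\<close>

lemma linear_integral_equation_Ck:
  fixes A :: "real \<Rightarrow> 'e::euclidean_space \<Rightarrow> 'f::euclidean_space \<Rightarrow> 'f"
  assumes "open U" "\<And>w. Ck_param k {0..1} (\<lambda>t z. A t z w) U"
    "\<And>t z. t \<in> {0..1} \<Longrightarrow> z \<in> U \<Longrightarrow> linear (A t z)"
    "\<And>t z w. t \<in> {0..1} \<Longrightarrow> z \<in> U \<Longrightarrow> norm (A t z w) \<le> 1/2 * norm w"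
    "Ck_param k {0..1} b U" "continuous_on ({0..1} \<times> U) (\<lambda>(t, z). W t z)"
    "\<And>t z. t \<in> {0..1} \<Longrightarrow> z \<in> U \<Longrightarrow> W t z = b t z + volterra (\<lambda>s. A s z (W s z)) t"
  shows "Ck_param k {0..1} W U"
  using assms
proof (induction k arbitrary: U b W)
  case 0
  then show ?case by simp
next
  case (Suc k)
  note U = Suc.prems(1) and A = Suc.prems(2) and lin = Suc.prems(3) and bd = Suc.prems(4)
    and b = Suc.prems(5) and cW = Suc.prems(6) and W = Suc.prems(7)
  have Ck: "Ck_param k {0..1} W U"
    using Suc.IH[OF U Ck_param_Suc_imp[OF A] lin bd Ck_param_Suc_imp[OF b] cW W] .
  \<comment> \<open>The linear equation in the format of
    \<open>integral_equation_differentiable\<close>. The basis expansion reduces joint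
    differentiability in parameter and unknown to that of \<open>A t z i\<close> for fixed
    \<open>i\<close>.\<close>
  define f where "f t p = (\<Sum>i\<in>Basis. (snd p \<bullet> i) *\<^sub>R A t (fst p) i)" for t and p :: "'e \<times> 'f"
  have A_sum: "A t z w = (\<Sum>i\<in>Basis. (w \<bullet> i) *\<^sub>R A t z i)" if "t \<in> {0..1}" "z \<in> U" for t z w
  proof -
    have "A t z w = A t z (\<Sum>i\<in>Basis. (w \<bullet> i) *\<^sub>R i)" by (simp add: euclidean_representation)
    then show ?thesis using lin[OF that] by (simp add: linear_sum linear_scale)
  qed
  have f_A: "f t (z, w) = A t z w" if "t \<in> {0..1}" "z \<in> U" for t z w
    using A_sum[OF that, of w] by (simp add: f_def)
  have V: "open (U \<times> (UNIV :: 'f set))" using U by (intro open_Times) auto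
  have Cf: "Ck_param (Suc 0) {0..1} f (U \<times> UNIV)"
    unfolding f_def
  proof (intro Ck_param_sum Ck_param_scaleR V)
    fix i :: 'f
    show "Ck_param (Suc 0) {0..1::real} (\<lambda>t p::'e \<times> 'f. snd p \<bullet> i) (U \<times> UNIV)"
      by (rule smooth_on_imp_Ck_param, rule smooth_on_bounded_linear[OF _ V])
         (intro bounded_linear_inner_left_comp bounded_linear_snd)
    show "Ck_param (Suc 0) {0..1} (\<lambda>t p. A t (fst p) i) (U \<times> (UNIV :: 'f set))"
    proof (rule Ck_param_compose[where f = "\<lambda>t z. A t z i" and g = "\<lambda>t. fst", OF V])
      show "Ck_param (Suc 0) {0..1} (\<lambda>t z. A t z i) U" by (rule Ck_param_mono[OF A]) simp
      show "Ck_param (Suc 0) {0..1::real} (\<lambda>t. fst) (U \<times> (UNIV :: 'f set))"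
        by (rule smooth_on_imp_Ck_param[OF smooth_on_bounded_linear[OF bounded_linear_fst V]])
    qed auto
  qed
  define D where "D t z i = frechet_derivative (\<lambda>z. A t z i) (at z)" for t z i
  have Ad: "((\<lambda>z. A t z i) has_derivative D t z i) (at z)" if "t \<in> {0..1}" "z \<in> U" for t z i
    unfolding D_def using Ck_param_has_derivative[OF A that] .
  have fd: "frechet_derivative (f t) (at (z, Y)) (v, w) = (\<Sum>i\<in>Basis. (Y \<bullet> i) *\<^sub>R D t z i v) + A t z w"
    if tz: "t \<in> {0..1}" "z \<in> U" for t z Y v w
  proof -
    have "((\<lambda>p. A t (fst p) i) has_derivative (\<lambda>q. D t z i (fst q))) (at (z, Y))" for i
      using has_derivative_compose[OF bounded_linear_imp_has_derivative[OF bounded_linear_fst, of "at (z, Y)"],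
          of "\<lambda>z. A t z i" "D t z i"] Ad[OF tz, of i] by simp
    then have "(f t has_derivative (\<lambda>q. \<Sum>i\<in>Basis. (Y \<bullet> i) *\<^sub>R D t z i (fst q) + (snd q \<bullet> i) *\<^sub>R A t z i)) (at (z, Y))"
      unfolding f_def by (auto intro!: derivative_eq_intros)
    from frechet_derivative_at[OF this, symmetric] show ?thesis
      using A_sum[OF tz, of w] by (simp add: sum.distrib)
  qed
  show ?case
  proof (rule Ck_param_local)
    fix z0 assume z0: "z0 \<in> U"
    have half: "norm (frechet_derivative (f t) (at (z, W t z)) (0, w)) \<le> 1/2 * norm w" if "t \<in> {0..1}" "z \<in> U" for t z w
      using bd[OF that, of w] linear_0[OF has_derivative_linear[OF Ad[OF that]]] by (simp add: fd[OF that])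
    have W_f: "W t z = b t z + volterra (\<lambda>s. f s (z, W s z)) t" if "t \<in> {0..1}" "z \<in> U" for t z
      using W[OF that] volterra_cong[of "\<lambda>s. A s z (W s z)" "\<lambda>s. f s (z, W s z)" t] f_A that by simp
    have b1: "Ck_param (Suc 0) {0..1} b U" by (rule Ck_param_mono[OF b]) simp
    obtain r V where r: "r > 0" "ball z0 r \<subseteq> U"
      and cV: "\<And>v. continuous_on ({0..1} \<times> ball z0 r) (\<lambda>(t, z). V v t z)"
      and dW: "\<And>t z. t \<in> {0..1} \<Longrightarrow> z \<in> ball z0 r \<Longrightarrow> (W t has_derivative (\<lambda>v. V v t z)) (at z)"
      and V_eq: "\<And>v t z. t \<in> {0..1} \<Longrightarrow> z \<in> ball z0 r \<Longrightarrow> V v t z = frechet_derivative (b t) (at z) v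
        + volterra (\<lambda>s. frechet_derivative (f s) (at (z, W s z)) (v, V v s z)) t"
      by (rule integral_equation_differentiable[OF U V b1 Cf cW _ W_f half z0]) auto
    \<comment> \<open>The part of the new inhomogeneity that comes from differentiating the
      coefficients \<open>A\<close>.\<close>
    have cD: "Ck_param k {0..1} (\<lambda>s z. \<Sum>i\<in>Basis. (W s z \<bullet> i) *\<^sub>R D s z i v) (ball z0 r)" for v
    proof (intro Ck_param_sum Ck_param_scaleR open_ball)
      fix i :: 'f
      show "Ck_param k {0..1} (\<lambda>s z. W s z \<bullet> i) (ball z0 r)"
        using Ck_param_bounded_linear[OF bounded_linear_inner_left open_ball Ck_param_subset[OF Ck r(2) order_refl]] .
      show "Ck_param k {0..1} (\<lambda>s z. D s z i v) (ball z0 r)"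
        unfolding D_def using Ck_param_subset[OF Ck_param_derivative[OF A] r(2) order_refl] .
    qed
    have "Ck_param k {0..1} (V v) (ball z0 r)" for v
    proof (rule Suc.IH[where b = "\<lambda>t z. frechet_derivative (b t) (at z) v
          + volterra (\<lambda>s. \<Sum>i\<in>Basis. (W s z \<bullet> i) *\<^sub>R D s z i v) t"])
      show "Ck_param k {0..1} (\<lambda>t z. A t z w) (ball z0 r)" for w
        using Ck_param_subset[OF Ck_param_Suc_imp[OF A] r(2) order_refl] .
      show "Ck_param k {0..1} (\<lambda>t z. frechet_derivative (b t) (at z) v
          + volterra (\<lambda>s. \<Sum>i\<in>Basis. (W s z \<bullet> i) *\<^sub>R D s z i v) t) (ball z0 r)"
        by (intro Ck_param_add open_ball Ck_param_volterra cD Ck_param_subset[OF Ck_param_derivative[OF b] r(2) order_refl])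
      fix t :: real and z assume t: "t \<in> {0..1}" and z: "z \<in> ball z0 r"
      have zU: "z \<in> U" using z r by auto
      have c1: "continuous_on {0..1} (\<lambda>s. \<Sum>i\<in>Basis. (W s z \<bullet> i) *\<^sub>R D s z i v)"
        using continuous_on_param_slice[OF Ck_param_continuous[OF cD] z] .
      have c2: "continuous_on {0..1} (\<lambda>s. A s z (V v s z))"
      proof -
        have "continuous_on {0..1} (\<lambda>s. \<Sum>i\<in>Basis. (V v s z \<bullet> i) *\<^sub>R A s z i)"
          by (intro continuous_intros continuous_on_param_slice[OF Ck_param_continuous[OF A] zU]
              continuous_on_param_slice[OF cV z])
        then show ?thesis by (rule continuous_on_cong[THEN iffD1, rotated 2]) (use A_sum zU in auto)
      qed
      have "V v t z = frechet_derivative (b t) (at z) v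
          + volterra (\<lambda>s. (\<Sum>i\<in>Basis. (W s z \<bullet> i) *\<^sub>R D s z i v) + A s z (V v s z)) t"
        unfolding V_eq[OF t z, of v]
        by (intro arg_cong2[where f = "(+)"] refl volterra_cong fd t) (use zU in auto)
      then show "V v t z = frechet_derivative (b t) (at z) v
          + volterra (\<lambda>s. \<Sum>i\<in>Basis. (W s z \<bullet> i) *\<^sub>R D s z i v) t + volterra (\<lambda>s. A s z (V v s z)) t"
        using volterra_add[OF c1 c2 t] by simp
    qed (use r lin bd cV in auto)
    then have "Ck_param (Suc k) {0..1} W (ball z0 r)"
      using dW continuous_on_subset[OF cW, of "{0..1} \<times> ball z0 r"] r
      by (intro Ck_param_SucI[where f' = "\<lambda>t z v. V v t z"] open_ball) auto
    then show "\<exists>N. open N \<and> z0 \<in> N \<and> Ck_param (Suc k) {0..1} W (N \<inter> U)"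
      using r by (intro exI[of _ "ball z0 r"]) (simp add: Int_absorb2 del: Ck_param.simps)
  qed
qed

text \<open>The point \<open>z\<close> is the initial value and at the same time a parameter of the
  field. Since \<open>f\<close> vanishes at \<open>(c, c)\<close> together with its derivative in
  the second variable, it is small near that point and has Lipschitz constant 1/2 there, so one
  fixed point covers the unit time interval. By the last conclusion any solution of the linearised
  equation is the derivative of the flow, which allows that derivative to be guessed.\<close>

lemma smooth_flow:
  fixes f :: "'e::euclidean_space \<times> 'e \<Rightarrow> 'e"
  assumes V: "open V" and f: "smooth_on f V" and c: "(c, c) \<in> V" "f (c, c) = 0"
    and Df0: "\<And>w. frechet_derivative f (at (c, c)) (0, w) = 0"
  obtains r y where "r > 0" "\<And>k. Ck_param k {0..1} y (ball c r)"
    "\<And>t z. t \<in> {0..1} \<Longrightarrow> z \<in> ball c r \<Longrightarrow> (z, y t z) \<in> V"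
    "\<And>t z. t \<in> {0..1} \<Longrightarrow> z \<in> ball c r \<Longrightarrow> y t z = z + volterra (\<lambda>s. f (z, y s z)) t"
    "\<And>t z v X. t \<in> {0..1} \<Longrightarrow> z \<in> ball c r \<Longrightarrow> continuous_on {0..1} X \<Longrightarrow>
      \<forall>t\<in>{0..1}. X t = v + volterra (\<lambda>s. frechet_derivative f (at (z, y s z)) (v, X s)) t \<Longrightarrow>
      frechet_derivative (y t) (at z) v = X t"
proof -
  have Cf: "Ck_param k T (\<lambda>_::real. f) V" for k T using f by (rule smooth_on_imp_Ck_param)
  define D where "D p = frechet_derivative f (at p)" for p
  have fd: "(f has_derivative D p) (at p)" if "p \<in> V" for p
    unfolding D_def using f that by (rule smooth_on_has_derivative)
  define B where "B p = Blinfun (D p)" for p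
  have B: "blinfun_apply (B p) = D p" if "p \<in> V" for p
    unfolding B_def by (rule bounded_linear_Blinfun_apply[OF has_derivative_bounded_linear[OF fd[OF that]]])
  have cB: "continuous_on V B"
  proof (rule continuous_on_blinfun_componentwise)
    fix i :: "'e \<times> 'e"
    have "continuous_on V (\<lambda>p. D p i)"
      unfolding D_def using smooth_on_imp_continuous_on[OF smooth_on_derivative[OF f]] .
    then show "continuous_on V (\<lambda>p. blinfun_apply (B p) i)"
      by (rule continuous_on_cong[THEN iffD1, rotated 2]) (auto simp: B)
  qed
  obtain R0 where R0: "R0 > 0" "ball (c, c) R0 \<subseteq> V" "\<And>p. p \<in> ball (c, c) R0 \<Longrightarrow> norm (B p - B (c, c)) < 1/2"
  proof -
    obtain R1 where R1: "R1 > 0" "ball (c, c) R1 \<subseteq> V" using V c(1) openE by blast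
    obtain R2 where R2: "R2 > 0" "\<And>p. p \<in> V \<Longrightarrow> dist p (c, c) < R2 \<Longrightarrow> dist (B p) (B (c, c)) < 1/2"
      using cB[unfolded continuous_on_iff] c(1) by (metis zero_less_divide_1_iff zero_less_numeral)
    show ?thesis
      using that[of "min R1 R2"] R1 R2 by (auto simp: dist_norm norm_minus_commute subset_iff)
  qed
  \<comment> \<open>Two distances of at most \<open>R\<close> add up to less than \<open>R0\<close>,
    so pairs of points of \<open>cball c R\<close> stay in the ball where the bound 1/2
    holds.\<close>
  define R where "R = R0 / 3"
  have R: "R > 0" using R0 by (simp add: R_def)
  have box: "(z, Y) \<in> ball (c, c) R0" if "z \<in> cball c R" "Y \<in> cball c R" for z Y
  proof -
    have "dist (c, c) (z, Y) \<le> dist c z + dist c Y"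
      by (simp add: dist_Pair_Pair sqrt_sum_squares_le_sum)
    then show ?thesis using that R by (simp add: R_def)
  qed
  have boxV: "(z, Y) \<in> V" if "z \<in> cball c R" "Y \<in> cball c R" for z Y
    using box[OF that] R0 by auto
  have D_half: "norm (D p (0, w)) \<le> 1/2 * norm w" if "p \<in> ball (c, c) R0" for p w
  proof -
    have p: "p \<in> V" using that R0 by auto
    have "D p (0, w) = blinfun_apply (B p - B (c, c)) (0, w)"
      using B[OF p] B[OF c(1)] Df0[of w] by (simp add: blinfun.diff_left D_def)
    then have "norm (D p (0, w)) \<le> norm (B p - B (c, c)) * norm (0 :: 'e, w)"
      using norm_blinfun by metis
    also have "\<dots> \<le> 1/2 * norm w"
      using mult_right_mono[of "norm (B p - B (c, c))" "1/2" "norm w"] R0(3)[OF that] by simp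
    finally show ?thesis .
  qed
  have lip: "norm (f (z, Y) - f (z, Y')) \<le> 1/2 * norm (Y - Y')"
    if z: "z \<in> cball c R" and Y: "Y \<in> cball c R" "Y' \<in> cball c R" for z Y Y'
  proof (rule differentiable_bound[where f = "\<lambda>Y. f (z, Y)" and f' = "\<lambda>Y w. D (z, Y) (0, w)" and S = "cball c R"])
    fix Y assume Y: "Y \<in> cball c R"
    have "((\<lambda>Y. (z, Y)) has_derivative (\<lambda>w. (0, w))) (at Y within cball c R)"
      by (intro derivative_eq_intros) auto
    from has_derivative_compose[OF this has_derivative_at_withinI[OF fd[OF boxV[OF z Y]]]]
    show "((\<lambda>Y. f (z, Y)) has_derivative (\<lambda>w. D (z, Y) (0, w))) (at Y within cball c R)"
      using has_derivative_compose[OF \<open>((\<lambda>Y. (z, Y)) has_derivative (\<lambda>w. (0, w))) (at Y within cball c R)\<close> fd[OF boxV[OF z Y]]]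
      by simp
    show "onorm (\<lambda>w. D (z, Y) (0, w)) \<le> 1/2"
      using D_half[OF box[OF z Y]] by (intro onorm_le)
  qed (use Y in auto)
  obtain r0 where r0: "r0 > 0" "\<And>z. dist z c < r0 \<Longrightarrow> norm (f (z, c)) < R/8"
  proof -
    have "isCont (\<lambda>z. f (z, c)) c"
    proof (rule isCont_o2[of c "\<lambda>z. (z, c)" f])
      show "isCont f (c, c)" using fd[OF c(1)] by (rule has_derivative_continuous)
    qed (intro continuous_intros)
    then show ?thesis
      using that R c(2) unfolding continuous_at_eps_delta by (metis dist_0_norm dist_commute divide_pos_pos zero_less_numeral)
  qed
  \<comment> \<open>The displacement is at most R/2 + R/8 by the Lipschitz bound and the choice of
    \<open>r0\<close>; with the initial distance R/4 the solution stays in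
    \<open>cball c R\<close>.\<close>
  define r where "r = min (R/4) (r0/2)"
  have r: "r > 0" "r \<le> R/4" "r < r0" using R r0 by (auto simp: r_def)
  define K where "K = cball c r"
  have K: "compact K" "convex K" "K \<noteq> {}" "ball c r \<subseteq> K" using r by (auto simp: K_def)
  have KR: "z \<in> cball c R" if "z \<in> K" for z using that r R by (auto simp: K_def)
  \<comment> \<open>Projecting the unknown to the ball makes the right-hand side globally Lipschitz.
    The solution turns out to remain in the ball, where the projection is the identity.\<close>
  define cp where "cp = closest_point (cball c R)"
  have cp: "cp Y \<in> cball c R" for Y unfolding cp_def using R by (intro closest_point_in_set) auto
  have cp_lip: "norm (cp Y - cp Y') \<le> norm (Y - Y')" for Y Y'
    using closest_point_lipschitz[of "cball c R" Y Y'] R by (simp add: cp_def dist_norm)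
  have cF: "continuous_on ({0..1::real} \<times> K \<times> UNIV) (\<lambda>(t, z, Y). f (z, cp Y))"
  proof -
    have "continuous_on ({0..1::real} \<times> K \<times> UNIV) (\<lambda>q. cp (snd (snd q)))"
      unfolding cp_def using R
      by (intro continuous_on_compose2[OF continuous_on_closest_point[of _ UNIV]] continuous_intros) auto
    then have "continuous_on ({0..1::real} \<times> K \<times> UNIV) (\<lambda>q. (fst (snd q), cp (snd (snd q))))"
      by (intro continuous_intros)
    moreover have "(\<lambda>q. (fst (snd q), cp (snd (snd q)))) ` ({0..1::real} \<times> K \<times> UNIV) \<subseteq> V"
      using boxV KR cp by auto
    ultimately have "continuous_on ({0..1::real} \<times> K \<times> UNIV) (\<lambda>q. f (fst (snd q), cp (snd (snd q))))"
      by (rule continuous_on_compose2[OF smooth_on_imp_continuous_on[OF f]])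
    then show ?thesis by (simp add: case_prod_beta)
  qed
  have cb: "continuous_on ({0..1::real} \<times> K) (\<lambda>(t, z). z)"
    by (auto simp: case_prod_beta intro!: continuous_intros)
  have lipF: "norm (f (z, cp Y) - f (z, cp Y')) \<le> 1/2 * norm (Y - Y')" if "z \<in> K" for z Y Y'
    using lip[OF KR[OF that] cp[of Y] cp[of Y']] cp_lip[of Y Y'] by linarith
  show ?thesis
  proof (rule integral_equation_solution[OF K(1-3) cb cF lipF])
    fix y assume y: "continuous_on ({0..1} \<times> K) (\<lambda>(t, z). y t z)"
      and eq0: "\<And>t z. t \<in> {0..1} \<Longrightarrow> z \<in> K \<Longrightarrow> y t z = z + volterra (\<lambda>s. f (z, cp (y s z))) t"
    have yR: "y t z \<in> cball c R" if t: "t \<in> {0..1}" and z: "z \<in> K" for t z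
    proof -
      have "norm (f (z, cp (y s z))) \<le> 5/8 * R" for s
      proof -
        have "norm (f (z, cp (y s z)) - f (z, c)) \<le> 1/2 * norm (cp (y s z) - c)"
          using lip[OF KR[OF z] cp, of c] R by simp
        also have "\<dots> \<le> 1/2 * R" using cp[of "y s z"] by (simp add: dist_norm norm_minus_commute)
        finally have "norm (f (z, cp (y s z)) - f (z, c)) \<le> 1/2 * R" .
        moreover have "norm (f (z, c)) < R/8" using r0(2)[of z] z r by (auto simp: K_def dist_commute)
        ultimately show ?thesis using norm_triangle_sub[of "f (z, cp (y s z))" "f (z, c)"] by linarith
      qed
      then have "norm (volterra (\<lambda>s. f (z, cp (y s z))) t) \<le> 5/8 * R" using t by (intro volterra_bound)
      moreover have "norm (z - c) \<le> R/4" using z r by (auto simp: K_def dist_norm norm_minus_commute)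
      moreover have "norm (y t z - c) \<le> norm (z - c) + norm (volterra (\<lambda>s. f (z, cp (y s z))) t)"
        using norm_triangle_ineq[of "z - c" "volterra (\<lambda>s. f (z, cp (y s z))) t"] by (simp add: eq0[OF t z] algebra_simps)
      ultimately have "norm (y t z - c) \<le> R" using R by linarith
      then show ?thesis by (simp add: dist_norm norm_minus_commute)
    qed
    have eq: "y t z = z + volterra (\<lambda>s. f (z, y s z)) t" if "t \<in> {0..1}" "z \<in> K" for t z
    proof -
      have "cp (y s z) = y s z" if "s \<in> {0..1}" for s
        unfolding cp_def using yR[OF that \<open>z \<in> K\<close>] by (rule closest_point_self)
      then show ?thesis unfolding eq0[OF that] using that(1)
        by (intro arg_cong2[where f = "(+)"] refl volterra_cong) auto
    qed
    have mem: "(z, y t z) \<in> V" and half: "norm (D (z, y t z) (0, w)) \<le> 1/2 * norm w"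
      if "t \<in> {0..1}" "z \<in> K" for t z w
      using boxV[OF KR[OF that(2)] yR[OF that]] D_half[OF box[OF KR[OF that(2)] yR[OF that]]] by auto
    have lin: "linear (\<lambda>w. D (z, y t z) (0, w))" if "t \<in> {0..1}" "z \<in> K" for t z
    proof -
      have "linear (D (z, y t z))" using fd[OF mem[OF that]] by (rule has_derivative_linear)
      moreover have "linear (\<lambda>w::'e. (0::'e, w))" by (intro linearI) auto
      ultimately show ?thesis using linear_compose by (fastforce simp: o_def)
    qed
    have split: "D (z, y t z) (v, w) = D (z, y t z) (v, 0) + D (z, y t z) (0, w)"
      if "t \<in> {0..1}" "z \<in> K" for t z v w
      using linear_add[OF has_derivative_linear[OF fd[OF mem[OF that]]], of "(v, 0)" "(0, w)"] by simp
    define U where "U = ball c r"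
    have U: "open U" "U \<subseteq> K" using K by (auto simp: U_def)
    have yU: "continuous_on ({0..1} \<times> U) (\<lambda>(t, z). y t z)" using y U by (auto elim: continuous_on_subset)
    have Cid: "Ck_param k T (\<lambda>t z. z) S" if "open S" for k T and S :: "'e set"
      using smooth_on_imp_Ck_param[OF smooth_on_id[OF that]] .
    have loc: "\<exists>r' W. r' > 0 \<and> ball z0 r' \<subseteq> U \<and> (\<forall>v. continuous_on ({0..1} \<times> ball z0 r') (\<lambda>(t, z). W v t z)) \<and>
      (\<forall>t\<in>{0..1}. \<forall>z\<in>ball z0 r'. (y t has_derivative (\<lambda>v. W v t z)) (at z) \<and>
        (\<forall>v. W v t z = v + volterra (\<lambda>s. D (z, y s z) (v, W v s z)) t))" if z0: "z0 \<in> U" for z0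
    proof (rule integral_equation_differentiable[OF U(1) V Cid[OF U(1)] Cf yU _ _ _ z0])
      fix r' W assume *: "r' > 0" "ball z0 r' \<subseteq> U" "\<And>v. continuous_on ({0..1} \<times> ball z0 r') (\<lambda>(t, z). W v t z)"
        "\<And>t z. t \<in> {0..1} \<Longrightarrow> z \<in> ball z0 r' \<Longrightarrow> (y t has_derivative (\<lambda>v. W v t z)) (at z)"
        "\<And>v t z. t \<in> {0..1} \<Longrightarrow> z \<in> ball z0 r' \<Longrightarrow> W v t z = frechet_derivative (\<lambda>z. z) (at z) v
          + volterra (\<lambda>s. frechet_derivative f (at (z, y s z)) (v, W v s z)) t"
      then show ?thesis
        by (intro exI[of _ r'] exI[of _ W]) (simp add: D_def frechet_derivative_ident)
    qed (use U mem eq half in \<open>auto simp: D_def\<close>)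
    have Ck: "Ck_param k {0..1} y U" for k
    proof (induction k)
      case 0
      then show ?case using yU by simp
    next
      case (Suc k)
      have CD: "Ck_param k {0..1} (\<lambda>s z. D (z, y s z) q) U" for q
        unfolding D_def
        by (rule Ck_param_compose[OF U(1) smooth_on_imp_Ck_param[OF smooth_on_derivative[OF f]]
            Ck_param_Pair[OF U(1) Cid[OF U(1)] Suc]]) (use mem U in auto)
      show ?case
      proof (rule Ck_param_local)
        fix z0 assume "z0 \<in> U"
        from loc[OF this] obtain r' W where W0: "r' > 0" "ball z0 r' \<subseteq> U"
          "\<forall>v. continuous_on ({0..1} \<times> ball z0 r') (\<lambda>(t, z). W v t z)"
          "\<forall>t\<in>{0..1}. \<forall>z\<in>ball z0 r'. (y t has_derivative (\<lambda>v. W v t z)) (at z) \<and>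
            (\<forall>v. W v t z = v + volterra (\<lambda>s. D (z, y s z) (v, W v s z)) t)"
          by blast
        note W = W0(1,2) W0(3)[rule_format] W0(4)[rule_format, THEN conjunct1]
          W0(4)[rule_format, THEN conjunct2, rule_format]
        have zK: "z \<in> K" if "z \<in> ball z0 r'" for z using that W(2) U(2) by blast
        have CD': "Ck_param k {0..1} (\<lambda>s z. D (z, y s z) q) (ball z0 r')" for q
          using Ck_param_subset[OF CD W(2) order_refl] .
        \<comment> \<open>The linearised equation has coefficients built from \<open>f\<close> and
          \<open>y\<close>, which are \<open>k\<close> times differentiable by the induction
          hypothesis; its solutions inherit this, and one order is gained for
          \<open>y\<close>.\<close>
        have "Ck_param k {0..1} (W v) (ball z0 r')" for v
        proof (rule linear_integral_equation_Ck[where A = "\<lambda>t z w. D (z, y t z) (0, w)"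
              and b = "\<lambda>t z. v + volterra (\<lambda>s. D (z, y s z) (v, 0)) t"])
          show "Ck_param k {0..1} (\<lambda>t z. v + volterra (\<lambda>s. D (z, y s z) (v, 0)) t) (ball z0 r')"
            by (intro Ck_param_add open_ball Ck_param_volterra CD' Ck_param_const continuous_on_const)
          fix t :: real and z assume t: "t \<in> {0..1}" and z: "z \<in> ball z0 r'"
          note zK = zK[OF z]
          have c1: "continuous_on {0..1} (\<lambda>s. D (z, y s z) (v, 0))"
            using continuous_on_param_slice[OF Ck_param_continuous[OF CD'] z] .
          have c2: "continuous_on {0..1} (\<lambda>s. D (z, y s z) (0, W v s z))"
          proof -
            have "continuous_on {0..1} (\<lambda>s. blinfun_apply (B (z, y s z)) (0, W v s z))"
              by (intro continuous_intros continuous_on_compose2[OF cB] continuous_on_param_slice[OF W(3) z]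
                  continuous_on_param_slice[OF y zK]) (use mem zK in auto)
            then show ?thesis
              by (rule continuous_on_cong[THEN iffD1, rotated 2]) (use B mem zK in auto)
          qed
          have "volterra (\<lambda>s. D (z, y s z) (v, W v s z)) t =
              volterra (\<lambda>s. D (z, y s z) (v, 0) + D (z, y s z) (0, W v s z)) t"
            by (rule volterra_cong[OF split t]) (use zK in auto)
          then show "W v t z = v + volterra (\<lambda>s. D (z, y s z) (v, 0)) t + volterra (\<lambda>s. D (z, y s z) (0, W v s z)) t"
            using W(5)[OF t z, of v] volterra_add[OF c1 c2 t] by simp
        qed (use W(3) CD' lin half zK in auto)
        then have "Ck_param (Suc k) {0..1} y (ball z0 r')"
          using W(4) continuous_on_subset[OF yU, of "{0..1} \<times> ball z0 r'"] W(2)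
          by (intro Ck_param_SucI[where f' = "\<lambda>t z v. W v t z"] open_ball) auto
        then show "\<exists>N. open N \<and> z0 \<in> N \<and> Ck_param (Suc k) {0..1} y (N \<inter> U)"
          using W by (intro exI[of _ "ball z0 r'"]) (simp add: Int_absorb2 del: Ck_param.simps)
      qed
    qed
    show ?thesis
    proof (rule that[of r y])
      show "Ck_param k {0..1} y (ball c r)" for k using Ck by (simp add: U_def)
      fix t z v X assume t: "t \<in> {0..1::real}" and z: "z \<in> ball c r" and X: "continuous_on {0..1} X"
        "\<forall>t\<in>{0..1}. X t = v + volterra (\<lambda>s. frechet_derivative f (at (z, y s z)) (v, X s)) t"
      have zU: "z \<in> U" and zK: "z \<in> K" using z K by (auto simp: U_def)
      from loc[OF zU] obtain r' W where W: "r' > 0"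
        "continuous_on ({0..1} \<times> ball z r') (\<lambda>(t, z). W v t z)"
        "\<And>t z'. t \<in> {0..1} \<Longrightarrow> z' \<in> ball z r' \<Longrightarrow> (y t has_derivative (\<lambda>v. W v t z')) (at z')"
        "\<And>t z'. t \<in> {0..1} \<Longrightarrow> z' \<in> ball z r' \<Longrightarrow> W v t z' = v + volterra (\<lambda>s. D (z', y s z') (v, W v s z')) t"
        by blast
      have zr: "z \<in> ball z r'" using W(1) by simp
      have cW: "continuous_on {0..1} (\<lambda>s. W v s z)" using continuous_on_param_slice[OF W(2) zr] .
      have cD: "continuous_on {0..1} (\<lambda>s. D (z, y s z) (v, Q s))" if "continuous_on {0..1} Q" for Q
      proof -
        have "continuous_on {0..1} (\<lambda>s. blinfun_apply (B (z, y s z)) (v, Q s))"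
          by (intro continuous_intros continuous_on_compose2[OF cB] that
              continuous_on_param_slice[OF y zK]) (use mem zK in auto)
        then show ?thesis
          by (rule continuous_on_cong[THEN iffD1, rotated 2]) (use B mem zK in auto)
      qed
      \<comment> \<open>The difference of two solutions of the linearised equation with the same
        inhomogeneity satisfies the homogeneous one.\<close>
      have "W v t z - X t = 0"
      proof (rule linear_integral_equation_unique[where e = "\<lambda>t. W v t z - X t" and A = "\<lambda>s w. D (z, y s z) (0, w)"])
        fix t :: real assume t: "t \<in> {0..1}"
        have "volterra (\<lambda>s. D (z, y s z) (0, W v s z - X s)) t =
            volterra (\<lambda>s. D (z, y s z) (v, W v s z) - D (z, y s z) (v, X s)) t"
        proof (rule volterra_cong[OF _ t])
          fix s :: real assume s: "s \<in> {0..1}"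
          show "D (z, y s z) (0, W v s z - X s) = D (z, y s z) (v, W v s z) - D (z, y s z) (v, X s)"
            using linear_diff[OF has_derivative_linear[OF fd[OF mem[OF s zK]]], of "(v, W v s z)" "(v, X s)"] by simp
        qed
        also have "\<dots> = volterra (\<lambda>s. D (z, y s z) (v, W v s z)) t - volterra (\<lambda>s. D (z, y s z) (v, X s)) t"
          using volterra_diff[OF cD[OF cW] cD[OF X(1)] t] .
        also have "\<dots> = W v t z - X t" using W(4)[OF t zr] X(2)[rule_format, OF t] by (simp add: D_def)
        finally show "W v t z - X t = volterra (\<lambda>s. D (z, y s z) (0, W v s z - X s)) t" ..
      qed (use t X cW half zK in \<open>auto intro!: continuous_intros\<close>)
      moreover have "frechet_derivative (y t) (at z) = (\<lambda>v. W v t z)"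
        using frechet_derivative_at[OF W(3)[OF t zr]] by simp
      ultimately show "frechet_derivative (y t) (at z) v = X t" by simp
    qed (use r mem eq K in auto)
  qed
qed

section \<open>Primitives along an integrable distribution\<close>

lemma Ck_param_imp_Ck_on: "Ck_param k T f S \<Longrightarrow> t \<in> T \<Longrightarrow> Ck_on k (f t) S"
proof (induction k arbitrary: f)
  case 0
  have "continuous_on S (\<lambda>x. (t, x))" by (intro continuous_intros)
  moreover have "(\<lambda>x. (t, x)) ` S \<subseteq> T \<times> S" using 0 by auto
  ultimately have "continuous_on S (\<lambda>x. case (t, x) of (t, x) \<Rightarrow> f t x)"
    by (rule continuous_on_compose2[OF 0(1)[unfolded Ck_param.simps]])
  then show ?case by simp
qed auto

lemma has_vector_derivative_compose_derivative:
  assumes "(p has_vector_derivative p') (at t within S)" "(g has_derivative g') (at (p t))"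
  shows "((\<lambda>t. g (p t)) has_vector_derivative g' p') (at t within S)"
proof -
  have "((\<lambda>t. g (p t)) has_derivative (\<lambda>h. g' (h *\<^sub>R p'))) (at t within S)"
    using has_derivative_compose[OF assms(1)[unfolded has_vector_derivative_def] assms(2)] .
  then show ?thesis
    using has_derivative_linear[OF assms(2)] by (simp add: has_vector_derivative_def linear_scale)
qed

lemma linear_sum_Basis:
  fixes f :: "'e::euclidean_space \<Rightarrow> 'f::real_vector"
  assumes "linear f"
  shows "f w = (\<Sum>i\<in>Basis. (w \<bullet> i) *\<^sub>R f i)"
proof -
  have "f w = f (\<Sum>i\<in>Basis. (w \<bullet> i) *\<^sub>R i)" by (simp add: euclidean_representation)
  then show ?thesis using assms by (simp add: linear_sum linear_scale)
qed

text \<open>Differentiating the basis expansion of \<open>L z w\<close> shows that the derivative in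
  \<open>z\<close> is again linear in \<open>w\<close>; the right-hand sides below are written as
  such expansions.\<close>

lemma derivative_linear_family:
  fixes L :: "'c::real_normed_vector \<Rightarrow> 'e::euclidean_space \<Rightarrow> 'f::real_normed_vector"
  assumes S: "open S" "z \<in> S" and lin: "\<And>z. z \<in> S \<Longrightarrow> linear (L z)"
    and sL: "\<And>w. smooth_on (\<lambda>z. L z w) S"
  shows "frechet_derivative (\<lambda>z. L z w) (at z) v =
    (\<Sum>i\<in>Basis. (w \<bullet> i) *\<^sub>R frechet_derivative (\<lambda>z. L z i) (at z) v)"
proof -
  have "((\<lambda>z. \<Sum>i\<in>Basis. (w \<bullet> i) *\<^sub>R L z i) has_derivative
      (\<lambda>v. \<Sum>i\<in>Basis. (w \<bullet> i) *\<^sub>R frechet_derivative (\<lambda>z. L z i) (at z) v)) (at z)"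
    by (intro has_derivative_sum has_derivative_scaleR_right smooth_on_has_derivative[OF sL S(2)])
  then have "((\<lambda>z. L z w) has_derivative
      (\<lambda>v. \<Sum>i\<in>Basis. (w \<bullet> i) *\<^sub>R frechet_derivative (\<lambda>z. L z i) (at z) v)) (at z)"
    by (rule has_derivative_transform_within_open[OF _ S]) (simp add: linear_sum_Basis[OF lin, symmetric])
  from frechet_derivative_at[OF this, symmetric] show ?thesis by simp
qed

text \<open>The vector fields \<open>z \<mapsto> L z a\<close> commute. Following \<open>z' = - L z (z - c)\<close> over the unit time
  interval and integrating \<open>\<theta>\<close> yields the primitive; the derivative of the flow \<open>y t\<close> in the
  direction \<open>L z w\<close> is \<open>(1 - t) L (y t z) w\<close>, so no inverse function theorem is needed.\<close>

lemma primitive_along_commuting_fields: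
  fixes L :: "'e::euclidean_space \<Rightarrow> 'e \<Rightarrow> 'e" and \<theta> :: "'e \<Rightarrow> 'e \<Rightarrow> real"
  assumes \<Omega>: "open \<Omega>" "c \<in> \<Omega>"
    and linL: "\<And>z. z \<in> \<Omega> \<Longrightarrow> linear (L z)" and sL: "\<And>w. smooth_on (\<lambda>z. L z w) \<Omega>"
    and lin\<theta>: "\<And>z. z \<in> \<Omega> \<Longrightarrow> linear (\<theta> z)" and s\<theta>: "\<And>w. smooth_on (\<lambda>z. \<theta> z w) \<Omega>"
    and comm: "\<And>z a b. z \<in> \<Omega> \<Longrightarrow>
      frechet_derivative (\<lambda>z. L z b) (at z) (L z a) = frechet_derivative (\<lambda>z. L z a) (at z) (L z b)"
    and closed: "\<And>z a b. z \<in> \<Omega> \<Longrightarrow>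
      frechet_derivative (\<lambda>z. \<theta> z b) (at z) (L z a) = frechet_derivative (\<lambda>z. \<theta> z a) (at z) (L z b)"
    and LL: "\<And>z z' w. z \<in> \<Omega> \<Longrightarrow> z' \<in> \<Omega> \<Longrightarrow> L z (L z' w) = L z w"
    and \<theta>L: "\<And>z z' w. z \<in> \<Omega> \<Longrightarrow> z' \<in> \<Omega> \<Longrightarrow> \<theta> z (L z' w) = \<theta> z w"
  obtains r \<sigma> where "r > 0" "ball c r \<subseteq> \<Omega>" "smooth_on \<sigma> (ball c r)"
    "\<And>z w. z \<in> ball c r \<Longrightarrow> frechet_derivative \<sigma> (at z) (L z w) = \<theta> z w"
proof -
  define V where "V = (UNIV :: 'e set) \<times> \<Omega>"
  have V: "open V" unfolding V_def using \<Omega> by (intro open_Times) auto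
  \<comment> \<open>The starting point \<open>z\<close> enters as a frozen parameter: each flow line
    follows one fixed combination of the commuting fields, namely minus the one with coefficients
    \<open>z - c\<close>. Its right-hand side vanishes for \<open>z = c\<close>.\<close>
  define f where "f p = - (\<Sum>i\<in>Basis. ((fst p - c) \<bullet> i) *\<^sub>R L (snd p) i)" for p
  have f_L: "f (z, Y) = - L Y (z - c)" if "Y \<in> \<Omega>" for z Y
    unfolding f_def using linear_sum_Basis[OF linL[OF that], of "z - c"] by simp
  have s_fst: "smooth_on (\<lambda>p::'e \<times> 'e. (fst p - c) \<bullet> i) V" for i
  proof -
    have "smooth_on (\<lambda>p::'e \<times> 'e. fst p - c) V"
      by (intro smooth_on_diff smooth_on_const V smooth_on_bounded_linear bounded_linear_fst)
    from smooth_on_bounded_linear_compose[OF bounded_linear_inner_left V this] show ?thesis .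
  qed
  have s_snd: "smooth_on (\<lambda>p::'e \<times> 'e. L (snd p) i) V" for i
    by (rule smooth_on_compose[OF V sL smooth_on_bounded_linear[OF bounded_linear_snd V]]) (auto simp: V_def)
  have sf: "smooth_on f V"
    unfolding f_def by (intro smooth_on_minus smooth_on_sum smooth_on_scaleR V s_fst s_snd)
  define DL where "DL Y i = frechet_derivative (\<lambda>Y. L Y i) (at Y)" for Y i
  have DL: "((\<lambda>Y. L Y i) has_derivative DL Y i) (at Y)" if "Y \<in> \<Omega>" for Y i
    unfolding DL_def using sL that by (rule smooth_on_has_derivative)
  have DL_sum: "DL Y w v = (\<Sum>i\<in>Basis. (w \<bullet> i) *\<^sub>R DL Y i v)" if "Y \<in> \<Omega>" for Y w v
    unfolding DL_def using derivative_linear_family[OF \<Omega>(1) that linL sL] .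
  have fd: "frechet_derivative f (at (z, Y)) (v, w) = - DL Y (z - c) w - L Y v" if Y: "Y \<in> \<Omega>" for z Y v w
  proof -
    have "((\<lambda>p. L (snd p) i) has_derivative (\<lambda>q. DL Y i (snd q))) (at (z, Y))" for i
      using has_derivative_compose[OF bounded_linear_imp_has_derivative[OF bounded_linear_snd, of "at (z, Y)"],
          of "\<lambda>Y. L Y i" "DL Y i"] DL[OF Y, of i] by simp
    then have "(f has_derivative (\<lambda>q. - (\<Sum>i\<in>Basis. ((z - c) \<bullet> i) *\<^sub>R DL Y i (snd q) + (fst q \<bullet> i) *\<^sub>R L Y i))) (at (z, Y))"
      unfolding f_def by (auto intro!: derivative_eq_intros)
    from frechet_derivative_at[OF this, symmetric] show ?thesis
      using linear_sum_Basis[OF linL[OF Y], of v] DL_sum[OF Y, of "z - c" w] by (simp add: sum.distrib)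
  qed
  have Df0: "frechet_derivative f (at (c, c)) (0, w) = 0" for w
    using fd[OF \<Omega>(2), of c 0 w] DL_sum[OF \<Omega>(2), of 0 w] linear_0[OF linL[OF \<Omega>(2)]] by simp
  have f0: "f (c, c) = 0" using f_L[OF \<Omega>(2), of c] linear_0[OF linL[OF \<Omega>(2)]] by simp
  have cV: "(c, c) \<in> V" using \<Omega> by (simp add: V_def)
  obtain r0 y where r0: "r0 > 0" and Cy: "\<And>k. Ck_param k {0..1} y (ball c r0)"
    and mem: "\<And>t z. t \<in> {0..1} \<Longrightarrow> z \<in> ball c r0 \<Longrightarrow> (z, y t z) \<in> V"
    and eq: "\<And>t z. t \<in> {0..1} \<Longrightarrow> z \<in> ball c r0 \<Longrightarrow> y t z = z + volterra (\<lambda>s. f (z, y s z)) t"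
    and uniq: "\<And>t z v X. t \<in> {0..1} \<Longrightarrow> z \<in> ball c r0 \<Longrightarrow> continuous_on {0..1} X \<Longrightarrow>
      \<forall>t\<in>{0..1}. X t = v + volterra (\<lambda>s. frechet_derivative f (at (z, y s z)) (v, X s)) t \<Longrightarrow>
      frechet_derivative (y t) (at z) v = X t"
    by (rule smooth_flow[OF V sf cV f0 Df0]) (rule that)
  obtain r1 where r1: "r1 > 0" "ball c r1 \<subseteq> \<Omega>" using \<Omega> openE by blast
  define r where "r = min r0 r1"
  have r: "r > 0" "ball c r \<subseteq> \<Omega>" "ball c r \<subseteq> ball c r0" using r0 r1 by (auto simp: r_def)
  have memr: "y t z \<in> \<Omega>" if "t \<in> {0..1}" "z \<in> ball c r" for t z
    using mem[OF that(1), of z] that(2) r by (auto simp: V_def)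
  have Cyr: "Ck_param k {0..1} y (ball c r)" for k using Ck_param_subset[OF Cy r(3) order_refl] .
  \<comment> \<open>This is \<theta> evaluated on minus the velocity of the flow line, by
    \<open>\<theta>L\<close>. The primitive is thus minus the integral of \<theta> along that
    line.\<close>
  define h where "h s z = (\<Sum>i\<in>Basis. ((z - c) \<bullet> i) *\<^sub>R \<theta> (y s z) i)" for s z
  have Ch: "Ck_param k {0..1} h (ball c r)" for k
    unfolding h_def
  proof (intro Ck_param_sum Ck_param_scaleR open_ball)
    fix i :: 'e
    have "smooth_on (\<lambda>z. z - c) (ball c r)"
      by (intro smooth_on_diff smooth_on_id smooth_on_const open_ball)
    from smooth_on_bounded_linear_compose[OF bounded_linear_inner_left open_ball this]
    show "Ck_param k {0..1::real} (\<lambda>s z. (z - c) \<bullet> i) (ball c r)"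
      by (rule smooth_on_imp_Ck_param)
    show "Ck_param k {0..1} (\<lambda>s z. \<theta> (y s z) i) (ball c r)"
      by (rule Ck_param_compose[OF open_ball smooth_on_imp_Ck_param[OF s\<theta>] Cyr]) (use memr in auto)
  qed
  define \<sigma> where "\<sigma> z = volterra (\<lambda>s. h s z) 1" for z
  have s\<sigma>: "smooth_on \<sigma> (ball c r)"
    unfolding smooth_on_def \<sigma>_def
    using Ck_param_imp_Ck_on[OF Ck_param_volterra[OF open_ball Ch], of 1] by simp
  have d\<sigma>: "frechet_derivative \<sigma> (at z) (L z w) = \<theta> z w" if z: "z \<in> ball c r" for z w
  proof -
    have z0: "z \<in> ball c r0" and z\<Omega>: "z \<in> \<Omega>" using z r by auto
    note memz = memr[OF _ z]
    define F where "F s = f (z, y s z)" for s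
    have F: "F s = - L (y s z) (z - c)" if "s \<in> {0..1}" for s
      unfolding F_def using f_L memz[OF that] by simp
    have cy: "continuous_on {0..1} (\<lambda>s. y s z)"
      using continuous_on_param_slice[OF Ck_param_continuous[OF Cy] z0] .
    have cF: "continuous_on {0..1} F"
      unfolding F_def
      by (rule continuous_on_compose2[OF smooth_on_imp_continuous_on[OF sf]])
        (use mem z0 in \<open>auto intro!: continuous_intros cy\<close>)
    have dy: "((\<lambda>s. y s z) has_vector_derivative - L (y s z) (z - c)) (at s within {0..1})" if s: "s \<in> {0..1}" for s
    proof -
      have "((\<lambda>s. z + volterra F s) has_vector_derivative F s) (at s within {0..1})"
        using has_vector_derivative_add[OF has_vector_derivative_const volterra_has_vector_derivative[OF cF s], of z]
        by simp
      then have "((\<lambda>s. y s z) has_vector_derivative F s) (at s within {0..1})"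
        by (rule has_vector_derivative_transform[OF s, rotated]) (use eq z0 in \<open>auto simp: F_def[abs_def]\<close>)
      then show ?thesis using F[OF s] by simp
    qed
    have y0: "y 0 z = z" using eq[of 0 z] z0 by (simp add: volterra_def)
    \<comment> \<open>The guess for the derivative of the flow in the direction
      \<open>L z w\<close>. Its time derivative agrees with the linearised equation once
      \<open>comm\<close> exchanges \<open>w\<close> and \<open>z - c\<close>. The factor vanishes
      at time 1: the end point of the flow line has zero derivative along the leaf.\<close>
    define X where "X s = (1 - s) *\<^sub>R L (y s z) w" for s
    have dX: "(X has_vector_derivative - ((1 - s) *\<^sub>R DL (y s z) w (L (y s z) (z - c))) - L (y s z) w) (at s within {0..1})"
      if s: "s \<in> {0..1}" for s
    proof -
      have "((\<lambda>s. L (y s z) w) has_vector_derivative DL (y s z) w (- L (y s z) (z - c))) (at s within {0..1})"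
        using has_vector_derivative_compose_derivative[OF dy[OF s] DL[OF memz[OF s]]] .
      then have "((\<lambda>s. L (y s z) w) has_vector_derivative - DL (y s z) w (L (y s z) (z - c))) (at s within {0..1})"
        using has_derivative_linear[OF DL[OF memz[OF s]]] by (simp add: linear_neg)
      moreover have "((\<lambda>s. 1 - s) has_real_derivative - 1) (at s within {0..1})"
        by (auto intro!: derivative_eq_intros)
      ultimately show ?thesis unfolding X_def
        using has_vector_derivative_scaleR[of "\<lambda>s. 1 - s" "-1" s "{0..1}" "\<lambda>s. L (y s z) w"] by fastforce
    qed
    have DyX: "frechet_derivative (y t) (at z) (L z w) = X t" if t: "t \<in> {0..1}" for t
    proof (rule uniq[OF t z0 _ ballI])
      show "continuous_on {0..1} X"
        using dX by (meson continuous_on_eq_continuous_within has_vector_derivative_continuous)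
      fix t :: real assume t: "t \<in> {0..1}"
      have "frechet_derivative f (at (z, y s z)) (L z w, X s) =
          - ((1 - s) *\<^sub>R DL (y s z) w (L (y s z) (z - c))) - L (y s z) w" if s: "s \<in> {0..1}" for s
        using fd[OF memz[OF s]] LL[OF memz[OF s] z\<Omega>] comm[OF memz[OF s], of "z - c" w]
          linear_scale[OF has_derivative_linear[OF DL[OF memz[OF s]]]]
        by (simp add: X_def DL_def)
      then have "volterra (\<lambda>s. frechet_derivative f (at (z, y s z)) (L z w, X s)) t = X t - X 0"
        using volterra_derivative[of X "\<lambda>s. - ((1 - s) *\<^sub>R DL (y s z) w (L (y s z) (z - c))) - L (y s z) w" t, OF dX t]
          volterra_cong[of "\<lambda>s. frechet_derivative f (at (z, y s z)) (L z w, X s)"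
            "\<lambda>s. - ((1 - s) *\<^sub>R DL (y s z) w (L (y s z) (z - c))) - L (y s z) w" t] t by simp
      then show "X t = L z w + volterra (\<lambda>s. frechet_derivative f (at (z, y s z)) (L z w, X s)) t"
        by (simp add: X_def y0)
    qed
    define D\<theta> where "D\<theta> Y i = frechet_derivative (\<lambda>Y. \<theta> Y i) (at Y)" for Y i
    have D\<theta>: "((\<lambda>Y. \<theta> Y i) has_derivative D\<theta> Y i) (at Y)" if "Y \<in> \<Omega>" for Y i
      unfolding D\<theta>_def using s\<theta> that by (rule smooth_on_has_derivative)
    have D\<theta>_sum: "D\<theta> Y w v = (\<Sum>i\<in>Basis. (w \<bullet> i) *\<^sub>R D\<theta> Y i v)" if "Y \<in> \<Omega>" for Y w v
      unfolding D\<theta>_def using derivative_linear_family[OF \<Omega>(1) that lin\<theta> s\<theta>] .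
    have Dh: "frechet_derivative (h s) (at z) (L z w) =
        (1 - s) * D\<theta> (y s z) w (L (y s z) (z - c)) + \<theta> (y s z) w" if s: "s \<in> {0..1}" for s
    proof -
      have "(y s has_derivative frechet_derivative (y s) (at z)) (at z)"
        using Ck_param_has_derivative[OF Cy s z0] .
      then have "((\<lambda>z. \<theta> (y s z) i) has_derivative (\<lambda>v. D\<theta> (y s z) i (frechet_derivative (y s) (at z) v))) (at z)" for i
        using has_derivative_compose D\<theta>[OF memz[OF s]] by blast
      then have "(h s has_derivative (\<lambda>v. \<Sum>i\<in>Basis. ((z - c) \<bullet> i) *\<^sub>R D\<theta> (y s z) i (frechet_derivative (y s) (at z) v)
          + (v \<bullet> i) *\<^sub>R \<theta> (y s z) i)) (at z)"
        unfolding h_def by (auto intro!: derivative_eq_intros)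
      from frechet_derivative_at[OF this, symmetric]
      have "frechet_derivative (h s) (at z) (L z w) = D\<theta> (y s z) (z - c) (X s) + \<theta> (y s z) (L z w)"
        using linear_sum_Basis[OF lin\<theta>[OF memz[OF s]], of "L z w"] D\<theta>_sum[OF memz[OF s], of "z - c" "X s"]
        by (simp add: sum.distrib DyX[OF s])
      also have "D\<theta> (y s z) (z - c) (X s) = (1 - s) * D\<theta> (y s z) (z - c) (L (y s z) w)"
        using linear_scale[OF has_derivative_linear[OF D\<theta>[OF memz[OF s]]]] by (simp add: X_def)
      also have "D\<theta> (y s z) (z - c) (L (y s z) w) = D\<theta> (y s z) w (L (y s z) (z - c))"
        unfolding D\<theta>_def using closed[OF memz[OF s]] .
      finally show ?thesis using \<theta>L[OF memz[OF s] z\<Omega>] by simp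
    qed
    \<comment> \<open>\<open>closed\<close> has turned the integrand into an exact time derivative,
      that of \<open>Z\<close>. Its boundary values are 0 at time 1 and
      \<open>- \<theta> z w\<close> at time 0.\<close>
    define Z where "Z s = - (1 - s) * \<theta> (y s z) w" for s
    have dZ: "(Z has_vector_derivative (1 - s) * D\<theta> (y s z) w (L (y s z) (z - c)) + \<theta> (y s z) w) (at s within {0..1})"
      if s: "s \<in> {0..1}" for s
    proof -
      have "((\<lambda>s. \<theta> (y s z) w) has_vector_derivative D\<theta> (y s z) w (- L (y s z) (z - c))) (at s within {0..1})"
        using has_vector_derivative_compose_derivative[OF dy[OF s] D\<theta>[OF memz[OF s]]] .
      then have "((\<lambda>s. \<theta> (y s z) w) has_real_derivative - D\<theta> (y s z) w (L (y s z) (z - c))) (at s within {0..1})"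
        using has_derivative_linear[OF D\<theta>[OF memz[OF s]]]
        by (simp add: linear_neg has_real_derivative_iff_has_vector_derivative)
      then have "(Z has_real_derivative (1 - s) * D\<theta> (y s z) w (L (y s z) (z - c)) + \<theta> (y s z) w) (at s within {0..1})"
        unfolding Z_def by (auto intro!: derivative_eq_intros simp: algebra_simps)
      then show ?thesis by (simp add: has_real_derivative_iff_has_vector_derivative)
    qed
    have "frechet_derivative \<sigma> (at z) (L z w) = volterra (\<lambda>s. frechet_derivative (h s) (at z) (L z w)) 1"
      unfolding \<sigma>_def using frechet_derivative_at[OF volterra_has_derivative[OF open_ball Ch _ z, of 1], symmetric] by simp
    also have "\<dots> = volterra (\<lambda>s. (1 - s) * D\<theta> (y s z) w (L (y s z) (z - c)) + \<theta> (y s z) w) 1"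
      by (rule volterra_cong[OF Dh]) auto
    also have "\<dots> = Z 1 - Z 0" by (rule volterra_derivative[OF dZ]) auto
    also have "\<dots> = \<theta> z w" by (simp add: Z_def y0)
    finally show ?thesis .
  qed
  show ?thesis using that[OF r(1,2) s\<sigma> d\<sigma>] .
qed

section \<open>From an integrable distribution to a commuting frame\<close>

lemma smooth_on_det:
  fixes M :: "'c::real_normed_vector \<Rightarrow> real^'n^'n"
  assumes "open S" "\<And>i j. smooth_on (\<lambda>z. M z $ i $ j) S"
  shows "smooth_on (\<lambda>z. det (M z)) S"
  unfolding det_def
  by (intro smooth_on_sum smooth_on_mult smooth_on_prod smooth_on_const assms)

text \<open>The vectors \<open>e j\<close> are dual to the covectors \<open>\<kappa> i c\<close>, so that \<open>M c = 1\<close> below, and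
  \<open>L z w\<close> is the unique vector in the kernel of all \<open>\<kappa> i z\<close> with \<open>P (L z w) = P w\<close>.\<close>

lemma primitive_along_integrable_distribution:
  fixes \<kappa> :: "nat \<Rightarrow> real^'n \<Rightarrow> real^'n" and \<eta> :: "real^'n \<Rightarrow> real^'n"
  assumes \<Omega>: "open \<Omega>" "c \<in> \<Omega>"
    and s\<kappa>: "\<And>i. i < m \<Longrightarrow> smooth_on (\<kappa> i) \<Omega>" and s\<eta>: "smooth_on \<eta> \<Omega>"
    and dual: "\<And>i j. i < m \<Longrightarrow> j < m \<Longrightarrow> \<kappa> i c \<bullet> e j = (if i = j then 1 else 0)"
    and cl\<kappa>: "\<And>z u w i. z \<in> \<Omega> \<Longrightarrow> (\<And>j. j < m \<Longrightarrow> \<kappa> j z \<bullet> u = 0) \<Longrightarrow> (\<And>j. j < m \<Longrightarrow> \<kappa> j z \<bullet> w = 0) \<Longrightarrow>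
      i < m \<Longrightarrow> frechet_derivative (\<kappa> i) (at z) u \<bullet> w = frechet_derivative (\<kappa> i) (at z) w \<bullet> u"
    and cl\<eta>: "\<And>z u w. z \<in> \<Omega> \<Longrightarrow> (\<And>j. j < m \<Longrightarrow> \<kappa> j z \<bullet> u = 0) \<Longrightarrow> (\<And>j. j < m \<Longrightarrow> \<kappa> j z \<bullet> w = 0) \<Longrightarrow>
      frechet_derivative \<eta> (at z) u \<bullet> w = frechet_derivative \<eta> (at z) w \<bullet> u"
  obtains r \<sigma> where "r > 0" "ball c r \<subseteq> \<Omega>" "smooth_on \<sigma> (ball c r)"
    "\<And>z u. z \<in> ball c r \<Longrightarrow> (\<And>j. j < m \<Longrightarrow> \<kappa> j z \<bullet> u = 0) \<Longrightarrow> frechet_derivative \<sigma> (at z) u = \<eta> z \<bullet> u"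
proof -
  \<comment> \<open>The projection onto the common kernel of the covectors at \<open>c\<close>,
    along the span of the \<open>e j\<close>.\<close>
  define P where "P v = v - (\<Sum>i<m. (\<kappa> i c \<bullet> v) *\<^sub>R e i)" for v
  have linP: "linear P"
    unfolding P_def
    by (rule linearI) (simp_all add: inner_add_right scaleR_add_left sum.distrib scaleR_diff_right scaleR_sum_right)
  have \<kappa>P: "\<kappa> j c \<bullet> P v = 0" if "j < m" for j v
  proof -
    have "(\<Sum>i<m. (\<kappa> i c \<bullet> v) * (\<kappa> j c \<bullet> e i)) = (\<Sum>i<m. if j = i then \<kappa> i c \<bullet> v else 0)"
      using dual[OF that] by (intro sum.cong) auto
    also have "\<dots> = \<kappa> j c \<bullet> v" using that by simp
    finally show ?thesis by (simp add: P_def inner_diff_right inner_sum_right)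
  qed
  \<comment> \<open>Applying \<open>\<kappa> j c\<close> to \<open>M z v\<close> gives
    \<open>\<kappa> j z \<bullet> v\<close>, so \<open>M z\<close> carries the kernel at
    \<open>z\<close> into the kernel at \<open>c\<close>, and there acts as
    \<open>P\<close>.\<close>
  define M where "M z v = P v + (\<Sum>i<m. (\<kappa> i z \<bullet> v) *\<^sub>R e i)" for z v
  have linM: "linear (M z)" for z
    unfolding M_def using linP
    by (intro linearI) (simp_all add: linear_add linear_scale inner_add_right scaleR_add_left sum.distrib scaleR_add_right scaleR_sum_right)
  have \<kappa>M: "\<kappa> j c \<bullet> M z v = \<kappa> j z \<bullet> v" if "j < m" for j z v
  proof -
    have "(\<Sum>i<m. (\<kappa> i z \<bullet> v) * (\<kappa> j c \<bullet> e i)) = (\<Sum>i<m. if j = i then \<kappa> i z \<bullet> v else 0)"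
      using dual[OF that] by (intro sum.cong) auto
    also have "\<dots> = \<kappa> j z \<bullet> v" using that by simp
    finally show ?thesis using \<kappa>P[OF that] by (simp add: M_def inner_add_right inner_sum_right)
  qed
  have M_ker: "M z u = P u" if "\<And>j. j < m \<Longrightarrow> \<kappa> j z \<bullet> u = 0" for z u
    using that by (simp add: M_def)
  define A where "A z = matrix (M z)" for z
  have A: "A z *v v = M z v" for z v 
    unfolding A_def using matrix_works[of "M z" v] linM by (simp add: linear_matrix_vector_mul_eq)
  have sA: "smooth_on (\<lambda>z. A z $ i $ j) \<Omega>" for i j
  proof -
    have "smooth_on (\<lambda>z. P (axis j 1) + (\<Sum>l<m. (\<kappa> l z \<bullet> axis j 1) *\<^sub>R e l)) \<Omega>"
      by (intro smooth_on_add smooth_on_sum smooth_on_scaleR smooth_on_inner smooth_on_const \<Omega> s\<kappa>) auto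
    from smooth_on_vec_nth[OF \<Omega>(1) this, of i] show ?thesis
      by (simp add: A_def matrix_def M_def)
  qed
  \<comment> \<open>The set where \<open>M z\<close> is invertible; it contains \<open>c\<close>
    because \<open>M c\<close> is the identity.\<close>
  define \<Omega>' where "\<Omega>' = {z \<in> \<Omega>. det (A z) \<noteq> 0}"
  have "M c v = v" for v by (simp add: M_def P_def)
  then have "A c = mat 1" using A matrix_eq[of "A c" "mat 1"] by simp
  then have c: "c \<in> \<Omega>'" using \<Omega> by (simp add: \<Omega>'_def)
  have sdet: "smooth_on (\<lambda>z. det (A z)) \<Omega>" by (rule smooth_on_det[OF \<Omega>(1) sA])
  have op: "open \<Omega>'"
  proof -
    have "open ((\<lambda>z. det (A z)) -` (- {0}) \<inter> \<Omega>)"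
      using continuous_on_open_vimage[OF \<Omega>(1)] smooth_on_imp_continuous_on[OF sdet] by blast
    moreover have "(\<lambda>z. det (A z)) -` (- {0}) \<inter> \<Omega> = \<Omega>'" by (auto simp: \<Omega>'_def)
    ultimately show ?thesis by simp
  qed
  have sub: "\<Omega>' \<subseteq> \<Omega>" by (auto simp: \<Omega>'_def)
  \<comment> \<open>Cramer's rule for \<open>M z x = P w\<close>: it exhibits the solution as a
    smooth function of \<open>z\<close>.\<close>
  define L where "L z w = (\<chi> k. det (\<chi> i j. if j = k then P w $ i else A z $ i $ j) / det (A z))" for z w
  have M_iff: "M z x = P w \<longleftrightarrow> x = L z w" if "z \<in> \<Omega>'" for z x w
    using cramer[of "A z" x "P w"] that by (simp add: A L_def \<Omega>'_def)
  have M_of_L: "M z (L z w) = P w" if "z \<in> \<Omega>'" for z w using M_iff[OF that] by simp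
  have \<kappa>L: "\<kappa> j z \<bullet> L z w = 0" if "z \<in> \<Omega>'" "j < m" for j z w
    using \<kappa>M[OF that(2), of z "L z w"] M_of_L[OF that(1)] \<kappa>P[OF that(2)] by simp
  have PL: "P (L z w) = P w" if "z \<in> \<Omega>'" for z w
    using M_ker[of z "L z w"] \<kappa>L[OF that] M_of_L[OF that] by simp
  have L_ker: "L z u = u" if "z \<in> \<Omega>'" "\<And>j. j < m \<Longrightarrow> \<kappa> j z \<bullet> u = 0" for z u
    using M_iff[OF that(1), of u u] M_ker[OF that(2)] by simp
  have sL: "smooth_on (\<lambda>z. L z w) \<Omega>'" for w
    unfolding L_def
  proof (intro smooth_on_vec_lambda smooth_on_divide smooth_on_det op)
    fix k i j :: 'n
    show "smooth_on (\<lambda>z. (\<chi> i j. if j = k then P w $ i else A z $ i $ j) $ i $ j) \<Omega>'"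
      using smooth_on_const[OF op] smooth_on_subset[OF sA sub] by (cases "j = k") auto
    show "smooth_on (\<lambda>z. A z $ i $ j) \<Omega>'" using smooth_on_subset[OF sA sub] .
  qed (auto simp: \<Omega>'_def)
  have linL: "linear (L z)" if "z \<in> \<Omega>'" for z
  proof (rule linearI)
    fix a b show "L z (a + b) = L z a + L z b"
      by (rule M_iff[OF that, THEN iffD1, symmetric])
        (simp add: linear_add[OF linM] linear_add[OF linP] M_of_L[OF that])
  next
    fix r b show "L z (r *\<^sub>R b) = r *\<^sub>R L z b"
      by (rule M_iff[OF that, THEN iffD1, symmetric])
        (simp add: linear_scale[OF linM] linear_scale[OF linP] M_of_L[OF that])
  qed
  have LL: "L z (L z' w) = L z w" if "z \<in> \<Omega>'" "z' \<in> \<Omega>'" for z z' w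
    by (rule M_iff[OF that(1), THEN iffD1]) (simp add: M_of_L[OF that(1)] PL[OF that(2)])
  define DL where "DL z a = frechet_derivative (\<lambda>z. L z a) (at z)" for z a
  have DL: "((\<lambda>z. L z a) has_derivative DL z a) (at z)" if "z \<in> \<Omega>'" for z a
    unfolding DL_def using sL that by (rule smooth_on_has_derivative)
  have inner_deriv: "frechet_derivative (\<lambda>z. \<tau> z \<bullet> L z a) (at z) v =
      \<tau> z \<bullet> DL z a v + frechet_derivative \<tau> (at z) v \<bullet> L z a" if z: "z \<in> \<Omega>'" and "smooth_on \<tau> \<Omega>" for \<tau> z a v
  proof -
    have "(\<tau> has_derivative frechet_derivative \<tau> (at z)) (at z)"
      using smooth_on_has_derivative[OF that(2)] z sub by blast
    from frechet_derivative_at[OF has_derivative_inner[OF this DL[OF z, of a]]] show ?thesis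
      by (metis (no_types, lifting))
  qed
  \<comment> \<open>The vector \<open>?u\<close> is the Lie bracket of two of the fields. It is
    annihilated by every \<open>\<kappa> j z\<close>, by differentiating \<open>\<kappa>L\<close>
    and using the closedness condition, and by \<open>P\<close>, since \<open>P (L z w)\<close> does
    not depend on \<open>z\<close>. Hence \<open>M z\<close> maps it to 0.\<close>
  have comm: "DL z b (L z a) = DL z a (L z b)" if z: "z \<in> \<Omega>'" for z a b
  proof -
    let ?u = "DL z b (L z a) - DL z a (L z b)"
    have z\<Omega>: "z \<in> \<Omega>" using z sub by auto
    have *: "\<kappa> j z \<bullet> DL z b (L z a) = - (frechet_derivative (\<kappa> j) (at z) (L z a) \<bullet> L z b)" if j: "j < m" for j a b
    proof -
      have "((\<lambda>z. 0) has_derivative (\<lambda>v. 0)) (at z)" by simp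
      then have "((\<lambda>z. \<kappa> j z \<bullet> L z b) has_derivative (\<lambda>v. 0)) (at z)"
        by (rule has_derivative_transform_within_open[OF _ op z]) (simp add: \<kappa>L j)
      from frechet_derivative_at[OF this, symmetric] inner_deriv[OF z s\<kappa>[OF j], of b "L z a"]
      show ?thesis by simp
    qed
    have "\<kappa> j z \<bullet> ?u = 0" if j: "j < m" for j
      using *[OF j, of b a] *[OF j, of a b] cl\<kappa>[OF z\<Omega> \<kappa>L[OF z] \<kappa>L[OF z] j, of a b] by (simp add: inner_diff_right)
    then have "M z ?u = P ?u" by (rule M_ker)
    moreover have "P (DL z b v) = 0" for b v
    proof -
      have "((\<lambda>z. P (L z b)) has_derivative (\<lambda>v. P (DL z b v))) (at z)"
        using linP DL[OF z] by (auto intro: bounded_linear.has_derivative simp: linear_conv_bounded_linear)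
      moreover have "((\<lambda>z. P b) has_derivative (\<lambda>v. 0)) (at z)" by simp
      then have "((\<lambda>z. P (L z b)) has_derivative (\<lambda>v. 0)) (at z)"
        by (rule has_derivative_transform_within_open[OF _ op z]) (simp add: PL)
      ultimately show ?thesis using has_derivative_unique by metis
    qed
    ultimately have "M z ?u = P 0" using linP by (simp add: linear_diff linear_0)
    moreover have "M z 0 = P 0" using linP linM by (simp add: linear_0)
    ultimately show ?thesis using M_iff[OF z, of ?u 0] M_iff[OF z, of 0 0] by simp
  qed
  define \<theta> where "\<theta> z w = \<eta> z \<bullet> L z w" for z w
  have s\<theta>: "smooth_on (\<lambda>z. \<theta> z w) \<Omega>'" for w
    unfolding \<theta>_def by (intro smooth_on_inner op sL smooth_on_subset[OF s\<eta> sub])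
  have lin\<theta>: "linear (\<theta> z)" if "z \<in> \<Omega>'" for z
    unfolding \<theta>_def using linL[OF that]
    by (intro linearI) (simp_all add: linear_add linear_scale inner_add_right)
  \<comment> \<open>By the product rule there are two terms: the one with the derivative of
    \<open>L\<close> is symmetric by \<open>comm\<close>, the one with the derivative of \<eta> by
    its closedness on the kernel.\<close>
  have closed: "frechet_derivative (\<lambda>z. \<theta> z b) (at z) (L z a) = frechet_derivative (\<lambda>z. \<theta> z a) (at z) (L z b)"
    if z: "z \<in> \<Omega>'" for z a b
    using inner_deriv[OF z s\<eta>] comm[OF z, of a b] cl\<eta>[OF _ \<kappa>L[OF z] \<kappa>L[OF z], of a b] z sub
    unfolding \<theta>_def by auto
  obtain r \<sigma> where *: "r > 0" "ball c r \<subseteq> \<Omega>'" "smooth_on \<sigma> (ball c r)"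
    "\<And>z w. z \<in> ball c r \<Longrightarrow> frechet_derivative \<sigma> (at z) (L z w) = \<theta> z w"
    by (rule primitive_along_commuting_fields[OF op c linL sL lin\<theta> s\<theta> comm[unfolded DL_def] closed LL])
      (auto simp: \<theta>_def LL)
  show ?thesis
  proof (rule that[OF *(1) _ *(3)])
    show "ball c r \<subseteq> \<Omega>" using *(2) sub by auto
    fix z u assume z: "z \<in> ball c r" and u: "\<And>j. j < m \<Longrightarrow> \<kappa> j z \<bullet> u = 0"
    have "L z u = u" using L_ker[OF _ u] z *(2) by auto
    then show "frechet_derivative \<sigma> (at z) u = \<eta> z \<bullet> u" using *(4)[OF z, of u] by (simp add: \<theta>_def)
  qed
qed

text \<open>Independence is assumed for the indexed family; injectivity is derived first so that the
  functionals dual to the set of vectors can be indexed. The adjoint turns each functional into the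
  vector that represents it.\<close>

lemma dual_family:
  fixes b :: "nat \<Rightarrow> 'e::euclidean_space"
  assumes "\<And>a. (\<Sum>i<m. a i *\<^sub>R b i) = 0 \<Longrightarrow> (\<And>i. i < m \<Longrightarrow> a i = 0)"
  obtains e where "\<And>i j. i < m \<Longrightarrow> j < m \<Longrightarrow> b i \<bullet> e j = (if i = j then 1 else 0)"
proof -
  have inj: "inj_on b {..<m}"
  proof (rule inj_onI, rule ccontr)
    fix i j assume *: "i \<in> {..<m}" "j \<in> {..<m}" "b i = b j" "i \<noteq> j"
    define a :: "nat \<Rightarrow> real" where "a k = (if k = i then 1 else if k = j then - 1 else 0)" for k
    have "(\<Sum>k<m. a k *\<^sub>R b k) = (\<Sum>k<m. (if k = i then b i else 0) - (if k = j then b j else 0))"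
      using * by (intro sum.cong) (auto simp: a_def)
    also have "\<dots> = 0" using * by (simp add: sum_subtractf)
    finally have "a i = 0" using assms * by blast
    then show False by (simp add: a_def)
  qed
  have "independent (b ` {..<m})"
    unfolding dependent_finite[OF finite_imageI[OF finite_lessThan]]
  proof
    assume "\<exists>u. (\<exists>v\<in>b ` {..<m}. u v \<noteq> 0) \<and> (\<Sum>v\<in>b ` {..<m}. u v *\<^sub>R v) = 0"
    then obtain u i where *: "(\<Sum>v\<in>b ` {..<m}. u v *\<^sub>R v) = 0" "i < m" "u (b i) \<noteq> 0" by auto
    from *(1) have "(\<Sum>i<m. u (b i) *\<^sub>R b i) = 0" by (simp add: sum.reindex[OF inj])
    from assms[OF this *(2)] *(3) show False by simp
  qed
  then have "\<exists>g. linear g \<and> (\<forall>x\<in>b ` {..<m}. g x = (if x = b j then 1 else (0::real)))" for j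
    by (rule linear_independent_extend)
  then obtain g where g: "\<And>j. linear (g j)" "\<And>j x. x \<in> b ` {..<m} \<Longrightarrow> g j x = (if x = b j then 1 else (0::real))"
    by metis
  have "x \<bullet> adjoint (g j) 1 = g j x" for x j
    using adjoint_works[OF g(1), of x j 1] by simp
  then show ?thesis
    using that[of "\<lambda>j. adjoint (g j) 1"] g(2) inj by (auto simp: inj_on_eq_iff)
qed

text \<open>The increment \<open>f (z + t *\<^sub>R u) - f z\<close> is an integral over the
  segment. Differentiating it in \<open>z\<close> along \<open>v\<close> under the integral sign and
  then in \<open>t\<close> at 0 gives one order of differentiation; doing so without the integral
  gives the other.\<close>

lemma second_derivative_symmetric:
  fixes f :: "'e::euclidean_space \<Rightarrow> 'f::euclidean_space"
  assumes S: "open S" "x \<in> S" and f: "smooth_on f S"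
  shows "frechet_derivative (\<lambda>y. frechet_derivative f (at y) u) (at x) v =
    frechet_derivative (\<lambda>y. frechet_derivative f (at y) v) (at x) u"
proof -
  obtain r where r: "r > 0" "ball x r \<subseteq> S" using S openE by blast
  \<comment> \<open>Scales \<open>u\<close> so that a full unit of time along it moves less than
    r/2; the summand 1 covers \<open>u = 0\<close>. The scaling is undone at the end by
    linearity.\<close>
  define \<epsilon> where "\<epsilon> = r / (2 * (norm u + 1))"
  have "norm u + 1 > 0" by (simp add: add_nonneg_pos)
  then have \<epsilon>: "\<epsilon> > 0" using r(1) by (simp add: \<epsilon>_def)
  have "norm u < norm u + 1" by simp
  then have "norm u / (norm u + 1) < 1" using \<open>norm u + 1 > 0\<close> by (simp add: divide_less_eq)
  then have "r/2 * (norm u / (norm u + 1)) < r/2 * 1" using r(1) by (intro mult_strict_left_mono) auto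
  then have \<epsilon>u: "norm (\<epsilon> *\<^sub>R u) < r/2" using \<epsilon> r(1) by (simp add: \<epsilon>_def)
  define u' where "u' = \<epsilon> *\<^sub>R u"
  define B where "B = ball x (r/2)"
  have B: "open B" "x \<in> B" using r by (auto simp: B_def)
  have mem: "z + s *\<^sub>R u' \<in> S" if "z \<in> B" "s \<in> {0..1}" for z s
  proof -
    have "norm (s *\<^sub>R u') \<le> norm u'" using that(2) by (simp add: mult_left_le_one_le)
    then have "norm (s *\<^sub>R u') < r/2" using \<epsilon>u by (simp add: u'_def)
    moreover have "dist x z < r/2" using that(1) by (simp add: B_def)
    moreover have "dist x (z + s *\<^sub>R u') \<le> dist x z + norm (s *\<^sub>R u')"
      using dist_triangle[of x "z + s *\<^sub>R u'" z] by (simp add: dist_norm)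
    ultimately have "dist x (z + s *\<^sub>R u') < r" by linarith
    then show ?thesis using r(2) by auto
  qed
  define D where "D w y = frechet_derivative f (at y) w" for w y
  have fD: "(f has_derivative (\<lambda>w. D w y)) (at y)" if "y \<in> S" for y
    using smooth_on_has_derivative[OF f that] by (simp add: D_def)
  have sD: "smooth_on (D w) S" for w unfolding D_def[abs_def] using f by (rule smooth_on_derivative)
  define DD where "DD w y = frechet_derivative (D w) (at y)" for w y
  have DD: "(D w has_derivative DD w y) (at y)" if "y \<in> S" for w y
    unfolding DD_def using sD that by (rule smooth_on_has_derivative)
  define h where "h s z = D u' (z + s *\<^sub>R u')" for s z
  have Ch: "Ck_param (Suc 0) {0..1} h B"
  proof -
    have "Ck_param (Suc 0) {0..1} (\<lambda>s z. z + s *\<^sub>R u') B"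
      by (intro Ck_param_add B Ck_param_const continuous_intros smooth_on_imp_Ck_param smooth_on_id)
    then show ?thesis unfolding h_def
      by (rule Ck_param_compose[OF B(1) smooth_on_imp_Ck_param[OF sD]]) (use mem in auto)
  qed
  have line: "((\<lambda>t. g (z + t *\<^sub>R u')) has_vector_derivative g' u') (at t within {0..1})"
    if "(g has_derivative g') (at (z + t *\<^sub>R u'))" for g :: "'e \<Rightarrow> 'f" and g' z t
  proof (rule has_vector_derivative_compose_derivative[where p = "\<lambda>t. z + t *\<^sub>R u'" and g = g, OF _ that])
    show "((\<lambda>t. z + t *\<^sub>R u') has_vector_derivative u') (at t within {0..1})"
      by (auto intro!: derivative_eq_intros)
  qed
  have eq: "volterra (\<lambda>s. h s z) t = f (z + t *\<^sub>R u') - f z" if "z \<in> B" "t \<in> {0..1}" for z t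
    using volterra_derivative[of "\<lambda>t. f (z + t *\<^sub>R u')" "\<lambda>s. h s z" t] line[OF fD[OF mem[OF that(1)]]] that
    by (simp add: h_def)
  have eq': "volterra (\<lambda>s. DD u' (x + s *\<^sub>R u') v) t = D v (x + t *\<^sub>R u') - D v x" if t: "t \<in> {0..1}" for t
  proof -
    have hd: "frechet_derivative (h s) (at x) = DD u' (x + s *\<^sub>R u')" if "s \<in> {0..1}" for s
    proof -
      have "((\<lambda>z. z + s *\<^sub>R u') has_derivative (\<lambda>w. w)) (at x)" by (auto intro!: derivative_eq_intros)
      from has_derivative_compose[OF this DD[OF mem[OF B(2) that]]]
      have "(h s has_derivative DD u' (x + s *\<^sub>R u')) (at x)" by (simp add: h_def[abs_def])
      then show ?thesis by (rule frechet_derivative_at[symmetric])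
    qed
    have "((\<lambda>z. f (z + t *\<^sub>R u') - f z) has_derivative (\<lambda>w. D w (x + t *\<^sub>R u') - D w x)) (at x)"
    proof -
      have "((\<lambda>z. z + t *\<^sub>R u') has_derivative (\<lambda>w. w)) (at x)" by (auto intro!: derivative_eq_intros)
      from has_derivative_diff[OF has_derivative_compose[OF this fD[OF mem[OF B(2) t]]] fD[OF S(2)]]
      show ?thesis .
    qed
    then have "((\<lambda>z. volterra (\<lambda>s. h s z) t) has_derivative (\<lambda>w. D w (x + t *\<^sub>R u') - D w x)) (at x)"
      by (rule has_derivative_transform_within_open[OF _ B]) (simp only: eq[OF _ t])
    from fun_cong[OF has_derivative_unique[OF this volterra_has_derivative[OF B(1) Ch t B(2)]], of v]
    have "D v (x + t *\<^sub>R u') - D v x = volterra (\<lambda>s. frechet_derivative (h s) (at x) v) t" .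
    also have "\<dots> = volterra (\<lambda>s. DD u' (x + s *\<^sub>R u') v) t"
      by (rule volterra_cong[OF _ t]) (simp add: hd)
    finally show ?thesis ..
  qed
  have "continuous_on {0..1} (\<lambda>s. DD u' (x + s *\<^sub>R u') v)"
    unfolding DD_def
    by (rule continuous_on_compose2[OF smooth_on_imp_continuous_on[OF smooth_on_derivative[OF sD]]])
      (use mem B in \<open>auto intro!: continuous_intros\<close>)
  then have "(volterra (\<lambda>s. DD u' (x + s *\<^sub>R u') v) has_vector_derivative DD u' x v) (at 0 within {0..1})"
    using volterra_has_vector_derivative[of "\<lambda>s. DD u' (x + s *\<^sub>R u') v" 0] by simp
  then have "((\<lambda>t. D v (x + t *\<^sub>R u') - D v x) has_vector_derivative DD u' x v) (at 0 within {0..1})"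
    by (rule has_vector_derivative_transform[rotated 2]) (auto simp: eq')
  moreover have "((\<lambda>t. D v (x + t *\<^sub>R u') - D v x) has_vector_derivative DD v x u') (at 0 within {0..1})"
    using has_vector_derivative_diff[OF line[of "D v" "DD v x" x 0] has_vector_derivative_const] DD[OF S(2), of v] by simp
  ultimately have "DD u' x v = DD v x u'"
    using vector_derivative_unique_within_closed_interval[of 0 1 0] by fastforce
  moreover have "DD u' x v = \<epsilon> *\<^sub>R DD u x v"
  proof -
    have "((\<lambda>y. \<epsilon> *\<^sub>R D u y) has_derivative (\<lambda>w. \<epsilon> *\<^sub>R DD u x w)) (at x)"
      by (intro has_derivative_scaleR_right DD S)
    then have "(D u' has_derivative (\<lambda>w. \<epsilon> *\<^sub>R DD u x w)) (at x)"
    proof (rule has_derivative_transform_within_open[OF _ S])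
      fix y assume "y \<in> S"
      then show "\<epsilon> *\<^sub>R D u y = D u' y"
        using linear_scale[OF has_derivative_linear[OF fD]] by (simp add: u'_def)
    qed
    from fun_cong[OF has_derivative_unique[OF this DD[OF S(2)]], of v] show ?thesis ..
  qed
  moreover have "DD v x u' = \<epsilon> *\<^sub>R DD v x u"
    using linear_scale[OF has_derivative_linear[OF DD[OF S(2)]]] by (simp add: u'_def)
  ultimately show ?thesis using \<epsilon> by (simp add: DD_def D_def[abs_def])
qed

section \<open>Charts and tangent vectors\<close>

locale smooth_manifold =
  fixes A :: "('a::topological_space, 'n::finite) chart set"
  assumes atlas: "smooth_atlas A"
begin

lemma chart_open: "c \<in> A \<Longrightarrow> open (fst c)" "c \<in> A \<Longrightarrow> open (snd c ` fst c)"
  using atlas by (auto simp only: smooth_atlas_def)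

lemma chart_homeo: "c \<in> A \<Longrightarrow> homeomorphism (fst c) (snd c ` fst c) (snd c) (chart_inv c)"
  using atlas by (auto simp only: smooth_atlas_def)

lemma transition_smooth: "c \<in> A \<Longrightarrow> d \<in> A \<Longrightarrow> smooth_on (snd d \<circ> chart_inv c) (snd c ` (fst c \<inter> fst d))"
  using atlas by (auto simp only: smooth_atlas_def)

lemma chart_cover: "\<exists>c\<in>A. x \<in> fst c"
proof -
  have "x \<in> (\<Union>c\<in>A. fst c)" using atlas by (simp only: smooth_atlas_def UNIV_I)
  then show ?thesis by blast
qed

lemma chart_inv [simp]: "c \<in> A \<Longrightarrow> x \<in> fst c \<Longrightarrow> chart_inv c (snd c x) = x"
  using chart_homeo by (auto simp: homeomorphism_def)

lemma chart_at: "chart_at A x \<in> A" "x \<in> fst (chart_at A x)"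
  using someI_ex[of "\<lambda>c. c \<in> A \<and> x \<in> fst c"] chart_cover[of x] unfolding chart_at_def by blast+

lemma chart_image_open:
  assumes "c \<in> A" "open U"
  shows "open (snd c ` (U \<inter> fst c))"
proof -
  have "continuous_on (snd c ` fst c) (chart_inv c)"
    using chart_homeo[OF assms(1)] by (simp add: homeomorphism_def)
  then have "open ((snd c ` fst c) \<inter> chart_inv c -` U)"
    using chart_open[OF assms(1)] assms(2) by (intro continuous_open_preimage)
  moreover have "(snd c ` fst c) \<inter> chart_inv c -` U = snd c ` (U \<inter> fst c)"
    using assms(1) by auto
  ultimately show ?thesis by simp
qed

lemma smooth_map_chart: "smooth_map A U f \<Longrightarrow> c \<in> A \<Longrightarrow> smooth_on (\<lambda>z. f (chart_inv c z)) (snd c ` (U \<inter> fst c))"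
  by (simp add: smooth_map_def o_def)

lemma smooth_mapI:
  "(\<And>c. c \<in> A \<Longrightarrow> smooth_on (\<lambda>z. f (chart_inv c z)) (snd c ` (U \<inter> fst c))) \<Longrightarrow> smooth_map A U f"
  by (simp add: smooth_map_def o_def)

lemma smooth_map_subset: "smooth_map A U f \<Longrightarrow> V \<subseteq> U \<Longrightarrow> smooth_map A V f"
  unfolding smooth_map_def using smooth_on_subset by (metis Int_mono image_mono order_refl)

lemma smooth_map_const: "open U \<Longrightarrow> smooth_map A U (\<lambda>x. a)"
  by (rule smooth_mapI) (simp add: smooth_on_const chart_image_open)

lemma smooth_map_add: "open U \<Longrightarrow> smooth_map A U f \<Longrightarrow> smooth_map A U g \<Longrightarrow> smooth_map A U (\<lambda>x. f x + g x)"
  by (rule smooth_mapI) (simp add: smooth_on_add chart_image_open smooth_map_chart)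

lemma smooth_map_diff: "open U \<Longrightarrow> smooth_map A U f \<Longrightarrow> smooth_map A U g \<Longrightarrow> smooth_map A U (\<lambda>x. f x - g x)"
  by (rule smooth_mapI) (simp add: smooth_on_diff chart_image_open smooth_map_chart)

lemma smooth_map_scaleR:
  "open U \<Longrightarrow> smooth_map A U f \<Longrightarrow> smooth_map A U g \<Longrightarrow> smooth_map A U (\<lambda>x. f x *\<^sub>R g x)"
  by (rule smooth_mapI) (simp add: smooth_on_scaleR chart_image_open smooth_map_chart)

lemma smooth_map_mult:
  fixes f g :: "'a \<Rightarrow> real"
  shows "open U \<Longrightarrow> smooth_map A U f \<Longrightarrow> smooth_map A U g \<Longrightarrow> smooth_map A U (\<lambda>x. f x * g x)"
  by (rule smooth_mapI) (simp add: smooth_on_mult chart_image_open smooth_map_chart)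

lemma smooth_map_divide:
  fixes f g :: "'a \<Rightarrow> real"
  assumes "open U" "smooth_map A U f" "smooth_map A U g" "\<And>x. x \<in> U \<Longrightarrow> g x \<noteq> 0"
  shows "smooth_map A U (\<lambda>x. f x / g x)"
proof (rule smooth_mapI)
  fix c assume c: "c \<in> A"
  show "smooth_on (\<lambda>z. f (chart_inv c z) / g (chart_inv c z)) (snd c ` (U \<inter> fst c))"
    by (rule smooth_on_divide) (use assms c in \<open>auto simp: chart_image_open smooth_map_chart\<close>)
qed

lemma smooth_map_exp:
  assumes "open U" "smooth_map A U (f :: 'a \<Rightarrow> real)"
  shows "smooth_map A U (\<lambda>x. exp (f x))"
proof (rule smooth_mapI)
  fix c assume c: "c \<in> A"
  show "smooth_on (\<lambda>z. exp (f (chart_inv c z))) (snd c ` (U \<inter> fst c))"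
    by (rule smooth_on_compose[OF chart_image_open[OF c assms(1)] smooth_on_exp smooth_map_chart[OF assms(2) c]]) auto
qed

lemma smooth_map_of_chart:
  assumes "c \<in> A" "open U" "U \<subseteq> fst c" "smooth_on F (snd c ` U)"
  shows "smooth_map A U (\<lambda>x. F (snd c x))"
proof (rule smooth_mapI)
  fix d assume d: "d \<in> A"
  have "smooth_on (\<lambda>z. snd c (chart_inv d z)) (snd d ` (U \<inter> fst d))"
    using smooth_on_subset[OF transition_smooth[OF d assms(1)], of "snd d ` (U \<inter> fst d)"] assms(3)
    by (auto simp: o_def)
  then show "smooth_on (\<lambda>z. F (snd c (chart_inv d z))) (snd d ` (U \<inter> fst d))"
    by (rule smooth_on_compose[OF chart_image_open[OF d assms(2)] assms(4)]) (use d in auto)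
qed

lemma smooth_map_has_derivative:
  assumes "smooth_map A U f" "c \<in> A" "x \<in> U" "x \<in> fst c"
  shows "((\<lambda>z. f (chart_inv c z)) has_derivative cderiv c f x) (at (snd c x))"
proof -
  have "snd c x \<in> snd c ` (U \<inter> fst c)" using assms by auto
  from smooth_on_has_derivative[OF smooth_map_chart[OF assms(1,2)] this]
  show ?thesis by (simp add: cderiv_def[abs_def] o_def)
qed

lemma smooth_map_continuous_on:
  assumes "smooth_map A U f" "open U"
  shows "continuous_on U f"
proof (rule continuous_on_open_UN[of A "\<lambda>c. U \<inter> fst c" f, THEN continuous_on_subset])
  fix c assume c: "c \<in> A"
  show "open (U \<inter> fst c)" by (intro open_Int assms(2) chart_open(1) c)
  have "continuous_on (U \<inter> fst c) (snd c)"
    using chart_homeo[OF c] by (auto simp: homeomorphism_def elim: continuous_on_subset)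
  moreover have "snd c ` (U \<inter> fst c) \<subseteq> snd c ` (U \<inter> fst c)" by simp
  ultimately have "continuous_on (U \<inter> fst c) (\<lambda>x. f (chart_inv c (snd c x)))"
    by (rule continuous_on_compose2[OF smooth_on_imp_continuous_on[OF smooth_map_chart[OF assms(1) c]]])
  then show "continuous_on (U \<inter> fst c) f"
    by (rule continuous_on_cong[THEN iffD1, rotated 2]) (use c in auto)
qed (use chart_cover in auto)

lemma cderiv_eqI:
  "((\<lambda>z. f (chart_inv c z)) has_derivative f') (at (snd c x)) \<Longrightarrow> cderiv c f x = f'"
  unfolding cderiv_def[abs_def] o_def by (drule frechet_derivative_at) simp

lemma cderiv_cong:
  assumes "c \<in> A" "open U" "x \<in> U" "x \<in> fst c" "\<And>y. y \<in> U \<Longrightarrow> y \<in> fst c \<Longrightarrow> f y = g y"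
  shows "cderiv c f x = cderiv c g x"
proof -
  have N: "open (snd c ` (U \<inter> fst c))" "snd c x \<in> snd c ` (U \<inter> fst c)"
    using assms chart_image_open by auto
  have "((f \<circ> chart_inv c) has_derivative D) (at (snd c x)) \<longleftrightarrow> ((g \<circ> chart_inv c) has_derivative D) (at (snd c x))" for D
    using has_derivative_transform_within_open[OF _ N, of "f \<circ> chart_inv c" D UNIV "g \<circ> chart_inv c"]
      has_derivative_transform_within_open[OF _ N, of "g \<circ> chart_inv c" D UNIV "f \<circ> chart_inv c"] assms
    by force
  then show ?thesis by (simp add: cderiv_def[abs_def] frechet_derivative_def)
qed

lemma transition_has_derivative:
  assumes "c \<in> A" "d \<in> A" "x \<in> fst c" "x \<in> fst d"
  shows "((\<lambda>z. snd d (chart_inv c z)) has_derivative cderiv c (snd d) x) (at (snd c x))"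
proof -
  have "snd c x \<in> snd c ` (fst c \<inter> fst d)" using assms by auto
  from smooth_on_has_derivative[OF transition_smooth[OF assms(1,2)] this]
  show ?thesis by (simp add: cderiv_def[abs_def] o_def)
qed

lemma cderiv_chain:
  assumes "c \<in> A" "d \<in> A" "x \<in> fst c" "x \<in> fst d"
    and f: "((\<lambda>z. f (chart_inv d z)) has_derivative cderiv d f x) (at (snd d x))"
  shows "cderiv c f x w = cderiv d f x (cderiv c (snd d) x w)"
proof -
  have N: "open (snd c ` (fst d \<inter> fst c))" "snd c x \<in> snd c ` (fst d \<inter> fst c)"
    using assms chart_image_open chart_open by auto
  have "((\<lambda>z. f (chart_inv d (snd d (chart_inv c z)))) has_derivative (\<lambda>w. cderiv d f x (cderiv c (snd d) x w))) (at (snd c x))"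
    using has_derivative_compose[OF transition_has_derivative[OF assms(1-4)], of "\<lambda>z. f (chart_inv d z)" "cderiv d f x"]
      f assms by simp
  then have "((\<lambda>z. f (chart_inv c z)) has_derivative (\<lambda>w. cderiv d f x (cderiv c (snd d) x w))) (at (snd c x))"
    by (rule has_derivative_transform_within_open[OF _ N]) (use assms in auto)
  from cderiv_eqI[OF this] show ?thesis by simp
qed

lemma cderiv_self:
  assumes "c \<in> A" "x \<in> fst c"
  shows "cderiv c (snd c) x = (\<lambda>w. w)"
proof (rule cderiv_eqI)
  have N: "open (snd c ` fst c)" "snd c x \<in> snd c ` fst c" using assms chart_open by auto
  have "((\<lambda>z. z) has_derivative (\<lambda>w. w)) (at (snd c x))" by simp
  then show "((\<lambda>z. snd c (chart_inv c z)) has_derivative (\<lambda>w. w)) (at (snd c x))"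
    by (rule has_derivative_transform_within_open[OF _ N]) (use assms in auto)
qed

lemma coord_vec_self: "c \<in> A \<Longrightarrow> x \<in> fst c \<Longrightarrow> coord_vec A c w x c = w"
  by (simp add: coord_vec_def cderiv_self)

lemma coord_vec_tangent:
  assumes "c \<in> A" "x \<in> fst c"
  shows "coord_vec A c w x \<in> tangent_space A x"
proof -
  have *: "cderiv d (snd e) x (cderiv c (snd d) x w) = cderiv c (snd e) x w"
    if "d \<in> A" "e \<in> A" "x \<in> fst d" "x \<in> fst e" for d e
    by (rule cderiv_chain[symmetric]) (use that assms transition_has_derivative in auto)
  then show ?thesis unfolding tangent_space_def coord_vec_def by simp
qed

lemma tangent_transform:
  assumes "v \<in> tangent_space A x" "c \<in> A" "d \<in> A" "x \<in> fst c" "x \<in> fst d"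
  shows "cderiv c (snd d) x (v c) = v d"
proof -
  have "\<forall>c\<in>A. \<forall>d\<in>A. x \<in> fst c \<and> x \<in> fst d \<longrightarrow> v d = cderiv c (snd d) x (v c)"
    using assms(1) unfolding tangent_space_def mem_Collect_eq by (rule conjunct2)
  from this[rule_format, OF assms(2,3) conjI[OF assms(4,5)]] show ?thesis by (rule sym)
qed

lemma tangent_outside:
  assumes "v \<in> tangent_space A x" "c \<notin> A \<or> x \<notin> fst c"
  shows "v c = 0"
proof -
  have "\<forall>c. c \<notin> A \<or> x \<notin> fst c \<longrightarrow> v c = 0"
    using assms(1) unfolding tangent_space_def mem_Collect_eq by (rule conjunct1)
  from this[rule_format, OF assms(2)] show ?thesis .
qed

lemma tangent_coord_vec:
  assumes "v \<in> tangent_space A x" "c \<in> A" "x \<in> fst c"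
  shows "coord_vec A c (v c) x = v"
proof
  fix d
  show "coord_vec A c (v c) x d = v d"
    using tangent_transform[OF assms(1,2) _ assms(3)] tangent_outside[OF assms(1)]
    by (simp add: coord_vec_def)
qed

lemma linear_cderiv_transition:
  assumes "c \<in> A" "d \<in> A" "x \<in> fst c" "x \<in> fst d"
  shows "linear (cderiv c (snd d) x)"
  using transition_has_derivative[OF assms] by (rule has_derivative_linear)

lemma tangentI:
  assumes "\<And>c. c \<notin> A \<or> x \<notin> fst c \<Longrightarrow> v c = 0"
    "\<And>c d. c \<in> A \<Longrightarrow> d \<in> A \<Longrightarrow> x \<in> fst c \<Longrightarrow> x \<in> fst d \<Longrightarrow> v d = cderiv c (snd d) x (v c)"
  shows "v \<in> tangent_space A x"
  unfolding tangent_space_def mem_Collect_eq using assms by meson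

lemma subspace_tangent_space: "subspace (tangent_space A x)"
proof (rule subspaceI)
  show "0 \<in> tangent_space A x"
    by (rule tangentI) (simp_all add: linear_0[OF linear_cderiv_transition])
  fix u v r assume u: "u \<in> tangent_space A x"
  show "r *\<^sub>R u \<in> tangent_space A x"
    by (rule tangentI) (simp_all add: scaleR_fun_def tangent_outside[OF u] tangent_transform[OF u]
        linear_scale[OF linear_cderiv_transition])
  assume v: "v \<in> tangent_space A x"
  show "u + v \<in> tangent_space A x"
    by (rule tangentI) (simp_all add: tangent_outside[OF u] tangent_outside[OF v] tangent_transform[OF u]
        tangent_transform[OF v] linear_add[OF linear_cderiv_transition])
qed

lemma coord_vec_linear:
  assumes "c \<in> A" "x \<in> fst c"
  shows "linear (\<lambda>w. coord_vec A c w x)"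
proof (rule linearI)
  fix a b show "coord_vec A c (a + b) x = coord_vec A c a x + coord_vec A c b x"
    using linear_add[OF linear_cderiv_transition[OF assms(1) _ assms(2)]]
    by (auto simp: coord_vec_def fun_eq_iff)
next
  fix r b show "coord_vec A c (r *\<^sub>R b) x = r *\<^sub>R coord_vec A c b x"
    using linear_scale[OF linear_cderiv_transition[OF assms(1) _ assms(2)]]
    by (auto simp: coord_vec_def fun_eq_iff scaleR_fun_def)
qed

text \<open>The arbitrary chart in the definition can be exchanged for \<open>c\<close>: the
  Jacobian from the chain rule is the one by which the coordinates of \<open>v\<close>
  transform.\<close>

lemma dir_deriv_chart:
  assumes "c \<in> A" "x \<in> fst c" "v \<in> tangent_space A x"
    "((\<lambda>z. f (chart_inv c z)) has_derivative cderiv c f x) (at (snd c x))"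
  shows "dir_deriv A x v f = cderiv c f x (v c)"
proof -
  have "cderiv (chart_at A x) f x (v (chart_at A x)) =
      cderiv c f x (cderiv (chart_at A x) (snd c) x (v (chart_at A x)))"
    by (rule cderiv_chain) (use assms chart_at in auto)
  also have "cderiv (chart_at A x) (snd c) x (v (chart_at A x)) = v c"
    using assms chart_at[of x] by (intro tangent_transform) auto
  finally show ?thesis by (simp add: dir_deriv_def)
qed

end

section \<open>Pseudo-Riemannian metrics in coordinates\<close>

lemma matrix_inv_mult:
  fixes A :: "real^'n^'n"
  assumes "invertible A"
  shows "A ** matrix_inv A = mat 1" "matrix_inv A ** A = mat 1"
  using someI_ex[OF assms[unfolded invertible_def]] unfolding matrix_inv_def by blast+

lemma linear_vec_sum:
  fixes f :: "real^'n \<Rightarrow> 'b::real_vector"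
  assumes "linear f"
  shows "f w = (\<Sum>m\<in>UNIV. w $ m *\<^sub>R f (axis m 1))"
proof -
  have "f w = f (\<Sum>m\<in>UNIV. w $ m *\<^sub>R axis m 1)"
    using basis_expansion[of w] by (simp add: scalar_mult_eq_scaleR)
  then show ?thesis using assms by (simp add: linear_sum linear_scale)
qed

lemma bounded_bilinear_matrix_mult: "bounded_bilinear ((**) :: real^'n^'m \<Rightarrow> real^'k^'n \<Rightarrow> real^'k^'m)"
  unfolding bilinear_conv_bounded_bilinear[symmetric] bilinear_def
  by (auto intro!: linearI simp: vec_eq_iff matrix_matrix_mult_def sum_distrib_left algebra_simps sum.distrib)

lemma bounded_bilinear_matrix_vector: "bounded_bilinear ((*v) :: real^'n^'m \<Rightarrow> real^'n \<Rightarrow> real^'m)"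
  unfolding bilinear_conv_bounded_bilinear[symmetric] bilinear_def
  by (auto intro!: linearI simp: vec_eq_iff matrix_vector_mult_def sum_distrib_left algebra_simps sum.distrib)

lemmas smooth_on_matrix_vector = smooth_on_bilinear[OF bounded_bilinear_matrix_vector]

locale coordinate_metric =
  fixes \<Omega> :: "(real^'n) set" and G :: "real^'n \<Rightarrow> real^'n^'n"
  assumes open_\<Omega>: "open \<Omega>" and smooth_G: "smooth_on G \<Omega>"
    and G_sym: "\<And>z i j. z \<in> \<Omega> \<Longrightarrow> G z $ i $ j = G z $ j $ i"
    and G_inv: "\<And>z. z \<in> \<Omega> \<Longrightarrow> invertible (G z)"
begin

abbreviation DG :: "real^'n \<Rightarrow> real^'n \<Rightarrow> real^'n^'n" where
  "DG z \<equiv> frechet_derivative G (at z)"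

definition Gderiv :: "real^'n \<Rightarrow> real^'n \<Rightarrow> real^'n \<Rightarrow> real^'n \<Rightarrow> real" where
  "Gderiv z a u v = (DG z a *v u) \<bullet> v"

text \<open>The Christoffel symbols as a bilinear map: the right-hand side of the Koszul formula as
  a covector in the basis directions, with its index raised.\<close>

definition chr :: "real^'n \<Rightarrow> real^'n \<Rightarrow> real^'n \<Rightarrow> real^'n" where
  "chr z a b = matrix_inv (G z) *v
     (\<chi> m. 1/2 * (Gderiv z a b (axis m 1) + Gderiv z b a (axis m 1) - Gderiv z (axis m 1) a b))"

lemma DG: "z \<in> \<Omega> \<Longrightarrow> (G has_derivative DG z) (at z)"
  using smooth_G by (rule smooth_on_has_derivative)

lemma linear_DG: "z \<in> \<Omega> \<Longrightarrow> linear (DG z)"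
  using DG by (rule has_derivative_linear)

lemma linear_Gderiv:
  "z \<in> \<Omega> \<Longrightarrow> linear (\<lambda>a. Gderiv z a u v)" "linear (\<lambda>u. Gderiv z a u v)" "linear (\<lambda>v. Gderiv z a u v)"
  by (auto intro!: linearI simp: Gderiv_def linear_add[OF linear_DG] linear_scale[OF linear_DG]
      matrix_vector_mult_add_rdistrib matrix_vector_right_distrib inner_add_left inner_add_right
      scaleR_matrix_vector_assoc[symmetric] matrix_vector_mult_scaleR)

lemmas Gderiv_simps =
  linear_add[OF linear_Gderiv(1)] linear_scale[OF linear_Gderiv(1)]
  linear_add[OF linear_Gderiv(2)] linear_scale[OF linear_Gderiv(2)]
  linear_add[OF linear_Gderiv(3)] linear_scale[OF linear_Gderiv(3)]

lemma Gderiv_axis: "Gderiv z a (axis i 1) (axis j 1) = DG z a $ j $ i"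
  by (simp add: Gderiv_def matrix_vector_mult_basis column_def inner_axis)

lemma DG_component:
  assumes "z \<in> \<Omega>"
  shows "((\<lambda>z. G z $ i $ j) has_derivative (\<lambda>a. DG z a $ i $ j)) (at z)"
  using bounded_linear.has_derivative[OF bounded_linear_vec_nth bounded_linear.has_derivative[OF bounded_linear_vec_nth DG[OF assms]]] .

lemma DG_sym:
  assumes "z \<in> \<Omega>"
  shows "DG z a $ i $ j = DG z a $ j $ i"
proof -
  have "((\<lambda>z. G z $ j $ i) has_derivative (\<lambda>a. DG z a $ i $ j)) (at z)"
    by (rule has_derivative_transform_within_open[OF DG_component[OF assms] open_\<Omega> assms]) (rule G_sym)
  from fun_cong[OF has_derivative_unique[OF this DG_component[OF assms]]] show ?thesis .
qed

lemma Gderiv_sum: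
  "Gderiv z a u v = (\<Sum>i\<in>UNIV. \<Sum>j\<in>UNIV. u $ i * v $ j * DG z a $ j $ i)"
proof -
  have "Gderiv z a u v = (\<Sum>i\<in>UNIV. u $ i * (\<Sum>j\<in>UNIV. v $ j * Gderiv z a (axis i 1) (axis j 1)))"
    by (subst linear_vec_sum[OF linear_Gderiv(2)], subst linear_vec_sum[OF linear_Gderiv(3)]) simp
  then show ?thesis by (simp add: Gderiv_axis sum_distrib_left mult.assoc)
qed

lemma Gderiv_sym:
  assumes "z \<in> \<Omega>"
  shows "Gderiv z a u v = Gderiv z a v u"
proof -
  have "Gderiv z a u v = (\<Sum>i\<in>UNIV. \<Sum>j\<in>UNIV. u $ j * v $ i * DG z a $ i $ j)"
    unfolding Gderiv_sum by (rule sum.swap)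
  also have "\<dots> = Gderiv z a v u"
    unfolding Gderiv_sum by (intro sum.cong refl) (metis DG_sym[OF assms] mult.commute)
  finally show ?thesis .
qed

lemma koszul:
  assumes "z \<in> \<Omega>"
  shows "(G z *v chr z a b) \<bullet> w = 1/2 * (Gderiv z a b w + Gderiv z b a w - Gderiv z w a b)"
proof -
  define kz where "kz w = 1/2 * (Gderiv z a b w + Gderiv z b a w - Gderiv z w a b)" for w
  have "linear kz"
    unfolding kz_def by (rule linearI) (simp_all add: Gderiv_simps assms algebra_simps)
  have "G z *v chr z a b = (\<chi> m. kz (axis m 1))"
    unfolding chr_def kz_def by (simp add: matrix_vector_mul_assoc matrix_inv_mult[OF G_inv[OF assms]])
  then have "(G z *v chr z a b) \<bullet> w = (\<Sum>m\<in>UNIV. w $ m *\<^sub>R kz (axis m 1))"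
    by (simp add: inner_vec_def mult.commute)
  also have "\<dots> = kz w" by (rule linear_vec_sum[OF \<open>linear kz\<close>, symmetric])
  finally show ?thesis by (simp add: kz_def)
qed

lemma chr_sym:
  assumes "z \<in> \<Omega>"
  shows "chr z a b = chr z b a"
  unfolding chr_def Gderiv_sym[OF assms, of _ a b] by (simp add: add.commute)

lemma linear_chr:
  assumes "z \<in> \<Omega>"
  shows "linear (chr z a)" "linear (\<lambda>a. chr z a b)"
proof -
  have *: "linear (\<lambda>x. matrix_inv (G z) *v (\<chi> m. f x m))" if "\<And>m. linear (\<lambda>x. f x m)" for f :: "real^'n \<Rightarrow> 'n \<Rightarrow> real"
  proof -
    have "linear (\<lambda>x. \<chi> m. f x m)"
      using that by (auto intro!: linearI simp: vec_eq_iff linear_add[OF that] linear_scale[OF that])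
    then show ?thesis
      using linear_compose[OF _ matrix_vector_mul_linear[of "matrix_inv (G z)"]] by (simp add: o_def)
  qed
  show "linear (chr z a)" "linear (\<lambda>a. chr z a b)"
    unfolding chr_def[abs_def]
    by (rule *, rule linearI; simp add: Gderiv_simps assms algebra_simps)+
qed

text \<open>The exterior derivative of the lowered field is the antisymmetrised covariant
  derivative. Inserting the Koszul formula, the derivatives of the metric on both sides cancel; this
  is where the connection being metric and torsion-free enters.\<close>

lemma curl_lower:
  assumes z: "z \<in> \<Omega>" and Y: "(Y has_derivative DY) (at z)"
  defines "F \<equiv> \<lambda>z. G z *v Y z"
  shows "frechet_derivative F (at z) a \<bullet> b - frechet_derivative F (at z) b \<bullet> a =
    (G z *v (DY a + chr z a (Y z))) \<bullet> b - (G z *v (DY b + chr z b (Y z))) \<bullet> a"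
proof -
  have "(F has_derivative (\<lambda>a. G z *v DY a + DG z a *v Y z)) (at z)"
    unfolding F_def using bounded_bilinear.FDERIV[OF bounded_bilinear_matrix_vector DG[OF z] Y] .
  from frechet_derivative_at[OF this, symmetric]
  have "frechet_derivative F (at z) a \<bullet> b = (G z *v DY a) \<bullet> b + Gderiv z a (Y z) b" for a b
    by (simp add: inner_add_left Gderiv_def)
  then show ?thesis
    using Gderiv_sym[OF z, of "Y z" a b] Gderiv_sym[OF z, of b a "Y z"] Gderiv_sym[OF z, of a b "Y z"]
    by (simp add: matrix_vector_right_distrib inner_add_left koszul[OF z] field_simps)
qed

lemma smooth_Gderiv: "smooth_on (\<lambda>z. Gderiv z a u v) \<Omega>"
proof -
  have "linear (\<lambda>M :: real^'n^'n. (M *v u) \<bullet> v)"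
    by (rule linearI) (simp_all add: matrix_vector_mult_add_rdistrib inner_add_left scaleR_matrix_vector_assoc[symmetric])
  then have "bounded_linear (\<lambda>M :: real^'n^'n. (M *v u) \<bullet> v)" by (simp add: linear_conv_bounded_linear)
  from smooth_on_bounded_linear_compose[OF this open_\<Omega> smooth_on_derivative[OF smooth_G]]
  show ?thesis by (simp add: Gderiv_def)
qed

text \<open>Cramer's rule writes each entry of the inverse as a quotient of determinants, hence as a
  smooth function.\<close>

lemma smooth_matrix_inv: "smooth_on (\<lambda>z. matrix_inv (G z)) \<Omega>"
proof -
  have det: "det (G z) \<noteq> 0" if "z \<in> \<Omega>" for z using G_inv[OF that] by (simp add: invertible_det_nz)
  have eq: "matrix_inv (G z) $ i $ k = det (\<chi> r s. if s = i then axis k 1 $ r else G z $ r $ s) / det (G z)"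
    if z: "z \<in> \<Omega>" for z i k
  proof -
    have "G z *v (matrix_inv (G z) *v axis k 1) = axis k 1"
      by (simp add: matrix_vector_mul_assoc matrix_inv_mult[OF G_inv[OF z]])
    then have "matrix_inv (G z) *v axis k 1 =
        (\<chi> i. det (\<chi> r s. if s = i then axis k 1 $ r else G z $ r $ s) / det (G z))"
      using cramer[OF det[OF z]] by blast
    then have "(matrix_inv (G z) *v axis k 1) $ i =
        det (\<chi> r s. if s = i then axis k 1 $ r else G z $ r $ s) / det (G z)"
      by simp
    then show ?thesis by (simp add: matrix_vector_mult_basis column_def)
  qed
  have G: "smooth_on (\<lambda>z. G z $ r $ s) \<Omega>" for r s
    by (intro smooth_on_vec_nth open_\<Omega> smooth_G)
  have "smooth_on (\<lambda>z. (\<chi> r s. if s = i then axis k 1 $ r else G z $ r $ s) $ r $ s) \<Omega>" for i k r s :: 'n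
    using G[of r s] smooth_on_const[OF open_\<Omega>, of "axis k 1 $ r :: real"] by (cases "s = i") auto
  then have "smooth_on (\<lambda>z. det (\<chi> r s. if s = i then axis k 1 $ r else G z $ r $ s) / det (G z)) \<Omega>" for i k
    by (intro smooth_on_divide smooth_on_det open_\<Omega> G det)
  then have "smooth_on (\<lambda>z. \<chi> i k. det (\<chi> r s. if s = i then axis k 1 $ r else G z $ r $ s) / det (G z)) \<Omega>"
    by (intro smooth_on_vec_lambda open_\<Omega>)
  then show ?thesis
    by (rule smooth_on_cong[OF open_\<Omega>, rotated]) (simp add: vec_eq_iff eq)
qed

lemma smooth_chr: "smooth_on (\<lambda>z. chr z a b) \<Omega>"
proof -
  have "smooth_on (\<lambda>z. 1/2 * (Gderiv z a b (axis m 1) + Gderiv z b a (axis m 1) - Gderiv z (axis m 1) a b)) \<Omega>" for m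
    by (intro smooth_on_mult smooth_on_const smooth_on_add smooth_on_diff smooth_Gderiv open_\<Omega>)
  then show ?thesis
    unfolding chr_def by (intro smooth_on_matrix_vector smooth_on_vec_lambda smooth_matrix_inv open_\<Omega>)
qed

lemma matrix_inv_derivative:
  assumes z: "z \<in> \<Omega>"
  shows "frechet_derivative (\<lambda>z. matrix_inv (G z)) (at z) a = - (matrix_inv (G z) ** DG z a ** matrix_inv (G z))"
proof -
  let ?N = "matrix_inv (G z)" and ?DN = "frechet_derivative (\<lambda>z. matrix_inv (G z)) (at z)"
  have "((\<lambda>z. G z ** matrix_inv (G z)) has_derivative (\<lambda>a. G z ** ?DN a + DG z a ** ?N)) (at z)"
    using bounded_bilinear.FDERIV[OF bounded_bilinear_matrix_mult DG[OF z] smooth_on_has_derivative[OF smooth_matrix_inv z]] .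
  moreover have "((\<lambda>z. mat 1 :: real^'n^'n) has_derivative (\<lambda>a. 0)) (at z)" by simp
  then have "((\<lambda>z. G z ** matrix_inv (G z)) has_derivative (\<lambda>a. 0)) (at z)"
    by (rule has_derivative_transform_within_open[OF _ open_\<Omega> z]) (simp add: matrix_inv_mult G_inv)
  ultimately have "G z ** ?DN a + DG z a ** ?N = 0"
    using has_derivative_unique by (metis (no_types, lifting))
  then have "?N ** (G z ** ?DN a + DG z a ** ?N) = ?N ** 0" by simp
  moreover have "?N ** 0 = (0 :: real^'n^'n)" by (simp add: matrix_matrix_mult_def vec_eq_iff)
  ultimately have "?DN a + ?N ** DG z a ** ?N = 0"
    by (simp add: matrix_add_ldistrib matrix_mul_assoc matrix_inv_mult[OF G_inv[OF z]])
  then show ?thesis by (simp add: eq_neg_iff_add_eq_0)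
qed

lemma matrix_inv_sym:
  assumes z: "z \<in> \<Omega>"
  shows "matrix_inv (G z) $ i $ j = matrix_inv (G z) $ j $ i"
proof -
  let ?N = "matrix_inv (G z)"
  have G: "transpose (G z) = G z" using G_sym[OF z] by (simp add: transpose_def vec_eq_iff)
  have "transpose ?N ** G z = mat 1"
    using matrix_inv_mult(1)[OF G_inv[OF z]] by (metis G matrix_transpose_mul transpose_mat)
  then have "transpose ?N = ?N"
    using matrix_inv_mult(1)[OF G_inv[OF z]] by (metis matrix_mul_assoc matrix_mul_lid matrix_mul_rid)
  from arg_cong[OF this, of "\<lambda>M. M $ j $ i"] show ?thesis by (simp add: transpose_def)
qed

text \<open>The curvature operator on fields with constant coordinates; these commute, so no bracket
  term appears.\<close>

definition curv :: "real^'n \<Rightarrow> real^'n \<Rightarrow> real^'n \<Rightarrow> real^'n \<Rightarrow> real^'n" where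
  "curv z a b w = frechet_derivative (\<lambda>z. chr z b w) (at z) a - frechet_derivative (\<lambda>z. chr z a w) (at z) b
     + chr z a (chr z b w) - chr z b (chr z a w)"

definition ric :: "real^'n \<Rightarrow> real^'n \<Rightarrow> real^'n \<Rightarrow> real" where
  "ric z b w = (\<Sum>l\<in>UNIV. curv z (axis l 1) b w $ l)"

lemma linear_ric:
  assumes z: "z \<in> \<Omega>"
  shows "linear (ric z b)"
proof -
  have d: "linear (\<lambda>w. frechet_derivative (\<lambda>z. chr z b w) (at z) a)" for a b
  proof -
    have lin: "linear (chr z b)" if "z \<in> \<Omega>" for z using linear_chr(1)[OF that] .
    define c where "c i = frechet_derivative (\<lambda>z. chr z b i) (at z) a" for i
    have "c w = (\<Sum>i\<in>Basis. (w \<bullet> i) *\<^sub>R c i)" for w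
      unfolding c_def by (rule derivative_linear_family[where L = "\<lambda>z. chr z b", OF open_\<Omega> z lin smooth_chr])
    then have "c = (\<lambda>w. \<Sum>i\<in>Basis. (w \<bullet> i) *\<^sub>R c i)" by (rule ext)
    moreover have "linear (\<lambda>w. \<Sum>i\<in>Basis. (w \<bullet> i) *\<^sub>R c i)"
      by (rule linearI) (simp_all add: inner_add_left scaleR_add_left sum.distrib scaleR_sum_right)
    ultimately have "linear c" by metis
    then show ?thesis by (simp add: c_def[abs_def])
  qed
  show ?thesis
    unfolding ric_def curv_def
    by (rule linearI)
      (simp_all add: linear_add[OF d] linear_scale[OF d] linear_add[OF linear_chr(1)[OF z]] linear_scale[OF linear_chr(1)[OF z]]
        sum.distrib sum_subtractf sum_distrib_left algebra_simps)
qed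

text \<open>The only term of the Ricci tensor whose symmetry is not apparent is the derivative of
  \<open>tr \<Gamma>(\<cdot>, w) = 1/2 tr (G\<^sup>-\<^sup>1 \<partial>\<^sub>w G)\<close>.\<close>

lemma ric_sym:
  assumes z: "z \<in> \<Omega>"
  shows "ric z b w = ric z w b"
proof -
  let ?e = "\<lambda>l. axis l 1 :: real^'n"
  define N where "N z = matrix_inv (G z)" for z
  define \<tau> where "\<tau> w z = (\<Sum>l\<in>UNIV. chr z (?e l) w $ l)" for w z
  have \<tau>: "\<tau> w z = 1/2 * (\<Sum>l\<in>UNIV. \<Sum>m\<in>UNIV. N z $ l $ m * DG z w $ m $ l)" if z: "z \<in> \<Omega>" for w z
  proof -
    have "\<tau> w z = (\<Sum>l\<in>UNIV. \<Sum>m\<in>UNIV. N z $ l $ m * (1/2 * (Gderiv z (?e l) w (?e m) + Gderiv z w (?e l) (?e m) - Gderiv z (?e m) (?e l) w)))"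
      by (simp add: \<tau>_def chr_def N_def matrix_vector_mult_def)
    also have "\<dots> = 1/2 * (\<Sum>l\<in>UNIV. \<Sum>m\<in>UNIV. N z $ l $ m * Gderiv z w (?e l) (?e m))
        + 1/2 * ((\<Sum>l\<in>UNIV. \<Sum>m\<in>UNIV. N z $ l $ m * Gderiv z (?e l) w (?e m))
          - (\<Sum>l\<in>UNIV. \<Sum>m\<in>UNIV. N z $ l $ m * Gderiv z (?e m) (?e l) w))"
      by (simp add: sum_distrib_left sum.distrib sum_subtractf algebra_simps)
    \<comment> \<open>Exchanging the summation indices and using the symmetry of \<open>N\<close>
      and of the metric makes two of the three Koszul terms cancel in the trace.\<close>
    also have "(\<Sum>l\<in>UNIV. \<Sum>m\<in>UNIV. N z $ l $ m * Gderiv z (?e m) (?e l) w) =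
        (\<Sum>l\<in>UNIV. \<Sum>m\<in>UNIV. N z $ l $ m * Gderiv z (?e l) w (?e m))"
    proof (subst sum.swap, intro sum.cong refl)
      fix m l
      show "N z $ l $ m * Gderiv z (?e m) (?e l) w = N z $ m $ l * Gderiv z (?e m) w (?e l)"
        unfolding N_def using matrix_inv_sym[OF z, of l m] Gderiv_sym[OF z, of "?e m" "?e l" w] by simp
    qed
    finally show ?thesis by (simp add: Gderiv_axis)
  qed
  have dN: "((\<lambda>z. N z $ l $ m) has_derivative (\<lambda>b. - (N z ** DG z b ** N z) $ l $ m)) (at z)" for l m
  proof -
    have "(N has_derivative frechet_derivative N (at z)) (at z)"
      unfolding N_def[abs_def] by (rule smooth_on_has_derivative[OF smooth_matrix_inv z])
    then have "((\<lambda>z. N z $ l $ m) has_derivative (\<lambda>b. frechet_derivative N (at z) b $ l $ m)) (at z)"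
      by (intro bounded_linear.has_derivative[OF bounded_linear_vec_nth])
    then show ?thesis using matrix_inv_derivative[OF z] by (simp add: N_def[abs_def])
  qed
  define DDG where "DDG w b = frechet_derivative (\<lambda>z. DG z w) (at z) b" for w b
  have DDG_sym: "DDG w b = DDG b w" for w b
    unfolding DDG_def by (rule second_derivative_symmetric[OF open_\<Omega> z smooth_G])
  have dDG: "((\<lambda>z. DG z w $ m $ l) has_derivative (\<lambda>b. DDG w b $ m $ l)) (at z)" for w m l
    unfolding DDG_def
    by (intro bounded_linear.has_derivative[OF bounded_linear_vec_nth]
        smooth_on_has_derivative[OF smooth_on_derivative[OF smooth_G] z])
  have D\<tau>: "frechet_derivative (\<tau> w) (at z) b =
      1/2 * (\<Sum>l\<in>UNIV. \<Sum>m\<in>UNIV. N z $ l $ m * DDG w b $ m $ l) - 1/2 * trace ((N z ** DG z b) ** (N z ** DG z w))" for w b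
  proof -
    have "((\<lambda>z. 1/2 * (\<Sum>l\<in>UNIV. \<Sum>m\<in>UNIV. N z $ l $ m * DG z w $ m $ l)) has_derivative
        (\<lambda>b. 1/2 * (\<Sum>l\<in>UNIV. \<Sum>m\<in>UNIV. N z $ l $ m * DDG w b $ m $ l + - (N z ** DG z b ** N z) $ l $ m * DG z w $ m $ l))) (at z)"
      by (intro has_derivative_mult_right has_derivative_sum has_derivative_mult dN dDG)
    then have "(\<tau> w has_derivative
        (\<lambda>b. 1/2 * (\<Sum>l\<in>UNIV. \<Sum>m\<in>UNIV. N z $ l $ m * DDG w b $ m $ l + - (N z ** DG z b ** N z) $ l $ m * DG z w $ m $ l))) (at z)"
      by (rule has_derivative_transform_within_open[OF _ open_\<Omega> z]) (simp add: \<tau>)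
    from frechet_derivative_at[OF this, symmetric] have "frechet_derivative (\<tau> w) (at z) b =
        1/2 * (\<Sum>l\<in>UNIV. \<Sum>m\<in>UNIV. N z $ l $ m * DDG w b $ m $ l)
        - 1/2 * (\<Sum>l\<in>UNIV. \<Sum>m\<in>UNIV. (N z ** DG z b ** N z) $ l $ m * DG z w $ m $ l)"
      by (simp add: sum_subtractf sum.distrib sum_negf right_diff_distrib)
    also have "(\<Sum>l\<in>UNIV. \<Sum>m\<in>UNIV. (N z ** DG z b ** N z) $ l $ m * DG z w $ m $ l)
        = trace ((N z ** DG z b ** N z) ** DG z w)"
      by (simp add: trace_def matrix_matrix_mult_def[of "N z ** DG z b ** N z"])
    finally show ?thesis by (simp add: matrix_mul_assoc)
  qed
  \<comment> \<open>Symmetric for two reasons: second derivatives of the metric commute, and the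
    trace of a product is invariant under exchanging the factors.\<close>
  have D\<tau>_sym: "frechet_derivative (\<tau> w) (at z) b = frechet_derivative (\<tau> b) (at z) w"
    unfolding D\<tau> DDG_sym[of w b] trace_mul_sym[of "N z ** DG z b"] ..
  have dchr: "((\<lambda>z. chr z a b) has_derivative frechet_derivative (\<lambda>z. chr z a b) (at z)) (at z)" for a b
    by (rule smooth_on_has_derivative[OF smooth_chr z])
  have term2: "(\<Sum>l\<in>UNIV. frechet_derivative (\<lambda>z. chr z (?e l) w) (at z) b $ l) = frechet_derivative (\<tau> w) (at z) b" for w b
  proof -
    have "(\<tau> w has_derivative (\<lambda>b. \<Sum>l\<in>UNIV. frechet_derivative (\<lambda>z. chr z (?e l) w) (at z) b $ l)) (at z)"
      unfolding \<tau>_def[abs_def]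
      by (intro has_derivative_sum bounded_linear.has_derivative[OF bounded_linear_vec_nth] dchr)
    from fun_cong[OF frechet_derivative_at[OF this], of b] show ?thesis .
  qed
  have term1: "frechet_derivative (\<lambda>z. chr z b w) (at z) = frechet_derivative (\<lambda>z. chr z w b) (at z)" for b w
    using has_derivative_transform_within_open[OF dchr open_\<Omega> z chr_sym] by (rule frechet_derivative_at)
  have term4: "(\<Sum>l\<in>UNIV. chr z b (chr z (?e l) w) $ l) = trace (matrix (chr z b) ** matrix (chr z w))" for b w
  proof -
    have "matrix (chr z b) ** matrix (chr z w) = matrix (chr z b \<circ> chr z w)"
      using linear_chr(1)[OF z] by (intro matrix_compose[symmetric])
    moreover have "trace (matrix (chr z b \<circ> chr z w)) = (\<Sum>l\<in>UNIV. chr z b (chr z w (?e l)) $ l)"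
      by (simp add: trace_def matrix_def)
    ultimately have "trace (matrix (chr z b) ** matrix (chr z w)) = (\<Sum>l\<in>UNIV. chr z b (chr z w (?e l)) $ l)"
      by simp
    then show ?thesis using chr_sym[OF z, of w] by simp
  qed
  \<comment> \<open>Of the four terms, the first and the third inherit the symmetry of
    \<open>chr\<close>, the second is \<open>D\<tau>_sym\<close>, and the fourth is the trace of a
    product.\<close>
  have "ric z b w = (\<Sum>l\<in>UNIV. frechet_derivative (\<lambda>z. chr z b w) (at z) (?e l) $ l) - frechet_derivative (\<tau> w) (at z) b
      + (\<Sum>l\<in>UNIV. chr z (?e l) (chr z b w) $ l) - trace (matrix (chr z b) ** matrix (chr z w))" for b w
    unfolding ric_def curv_def by (simp add: sum.distrib sum_subtractf term2 term4)
  then show ?thesis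
    using D\<tau>_sym term1[of b w] chr_sym[OF z, of b w] trace_mul_sym[of "matrix (chr z b)" "matrix (chr z w)"] by simp
qed

end

section \<open>Pseudo-Riemannian metrics on manifolds\<close>

locale pseudo_riemannian = smooth_manifold A
  for A :: "('a::topological_space, 'n::finite) chart set" +
  fixes p q :: nat and g :: "('a, 'n) metric"
  assumes metric: "is_metric A p q UNIV g"
begin

lemmas metric_unfolded = metric[unfolded is_metric_def]

lemma metric_sym:
  assumes "u \<in> tangent_space A x" "v \<in> tangent_space A x"
  shows "g x u v = g x v u"
  by (rule metric_unfolded[THEN conjunct1, rule_format, OF UNIV_I assms])

lemma metric_lin:
  assumes "u \<in> tangent_space A x" "v \<in> tangent_space A x" "w \<in> tangent_space A x"
  shows "g x (a *\<^sub>R u + b *\<^sub>R v) w = a * g x u w + b * g x v w"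
  by (rule metric_unfolded[THEN conjunct2, THEN conjunct1, rule_format, OF UNIV_I assms])

lemma metric_frame:
  obtains e :: "nat \<Rightarrow> ('a, 'n) tvec" where "span (e ` {..<p + q}) = tangent_space A x"
    "\<And>i j. i < p + q \<Longrightarrow> j < p + q \<Longrightarrow> g x (e i) (e j) = (if i \<noteq> j then 0 else if i < p then -1 else 1)"
proof -
  have "\<exists>e :: nat \<Rightarrow> ('a, 'n) tvec. span (e ` {..<p + q}) = tangent_space A x \<and>
      (\<forall>i<p + q. \<forall>j<p + q. g x (e i) (e j) = (if i \<noteq> j then 0 else if i < p then -1 else 1))"
    by (rule bspec[OF metric_unfolded[THEN conjunct2, THEN conjunct2, THEN conjunct1] UNIV_I])
  then obtain e :: "nat \<Rightarrow> ('a, 'n) tvec" where e: "span (e ` {..<p + q}) = tangent_space A x \<and>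
      (\<forall>i<p + q. \<forall>j<p + q. g x (e i) (e j) = (if i \<noteq> j then 0 else if i < p then -1 else 1))" ..
  show ?thesis
    by (rule that[OF conjunct1[OF e]]) (use e in simp)
qed

lemma smooth_gmat:
  assumes "c \<in> A"
  shows "smooth_on (\<lambda>z. gmat A g c (chart_inv c z)) (snd c ` fst c)"
proof -
  have "smooth_map A (UNIV \<inter> fst c) (gmat A g c)"
    by (rule bspec[OF metric_unfolded[THEN conjunct2, THEN conjunct2, THEN conjunct2] assms])
  from smooth_map_chart[OF this assms] show ?thesis by simp
qed

lemma metric_add: "u \<in> tangent_space A x \<Longrightarrow> v \<in> tangent_space A x \<Longrightarrow> w \<in> tangent_space A x \<Longrightarrow>
    g x (u + v) w = g x u w + g x v w"
  using metric_lin[of u x v w 1 1] by (simp only: scaleR_one mult_1)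

lemma metric_scale: "u \<in> tangent_space A x \<Longrightarrow> w \<in> tangent_space A x \<Longrightarrow> g x (a *\<^sub>R u) w = a * g x u w"
  using metric_lin[of u x u w a 0] by (simp only: scaleR_zero_left add_0_right mult_zero_left)

lemma metric_sum:
  assumes "\<And>i. i \<in> I \<Longrightarrow> f i \<in> tangent_space A x" "w \<in> tangent_space A x"
  shows "g x (\<Sum>i\<in>I. a i *\<^sub>R f i) w = (\<Sum>i\<in>I. a i * g x (f i) w)"
  using assms(1)
proof (induction I rule: infinite_finite_induct)
  case (insert i I)
  have I: "(\<Sum>i\<in>I. a i *\<^sub>R f i) \<in> tangent_space A x"
    using insert.prems by (intro subspace_sum subspace_scale subspace_tangent_space) auto
  have i: "f i \<in> tangent_space A x" using insert.prems by simp
  have "g x (\<Sum>i\<in>insert i I. a i *\<^sub>R f i) w = g x (a i *\<^sub>R f i + (\<Sum>i\<in>I. a i *\<^sub>R f i)) w"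
    by (simp only: sum.insert[OF insert.hyps])
  also have "\<dots> = g x (a i *\<^sub>R f i) w + g x (\<Sum>i\<in>I. a i *\<^sub>R f i) w"
    by (intro metric_add subspace_scale[OF subspace_tangent_space] i I assms(2))
  also have "\<dots> = a i * g x (f i) w + (\<Sum>i\<in>I. a i * g x (f i) w)"
    using insert by (simp only: metric_scale[OF i assms(2)]) simp
  also have "\<dots> = (\<Sum>i\<in>insert i I. a i * g x (f i) w)"
    by (rule sum.insert[OF insert.hyps, symmetric])
  finally show ?case .
qed (use metric_scale[OF assms(2,2), of 0] in auto)

text \<open>Pairing an expansion in the pseudo-orthonormal frame with \<open>e j\<close> isolates
  the coefficient of \<open>e j\<close> up to sign.\<close>

lemma metric_nondegenerate:
  assumes v: "v \<in> tangent_space A x" and 0: "\<And>w. w \<in> tangent_space A x \<Longrightarrow> g x v w = 0"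
  shows "v = 0"
proof -
  obtain e where span: "span (e ` {..<p + q}) = tangent_space A x"
    and e: "\<And>i j. i < p + q \<Longrightarrow> j < p + q \<Longrightarrow> g x (e i) (e j) = (if i \<noteq> j then 0 else if i < p then -1 else 1)"
    by (rule metric_frame[where x = x]) (rule that)
  let ?E = "e ` {..<p + q}"
  have E: "w \<in> tangent_space A x" if "w \<in> ?E" for w using that span span_superset[of ?E] by blast
  have "v \<in> span ?E" using v span by simp
  then obtain a where a: "v = (\<Sum>w\<in>?E. a w *\<^sub>R w)" by (auto simp: span_finite)
  have "a (e j) = 0" if j: "j < p + q" for j
  proof -
    have "0 = g x v (e j)" using 0[of "e j"] E[of "e j"] j by simp
    also have "\<dots> = (\<Sum>w\<in>?E. a w * g x w (e j))"
      unfolding a using E j by (intro metric_sum) auto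
    also have "\<dots> = (\<Sum>w\<in>?E. if w = e j then a (e j) * g x (e j) (e j) else 0)"
    proof (intro sum.cong refl)
      fix w assume "w \<in> ?E"
      then obtain i where "i < p + q" "w = e i" by auto
      then show "a w * g x w (e j) = (if w = e j then a (e j) * g x (e j) (e j) else 0)"
        using e[OF _ j, of i] by auto
    qed
    also have "\<dots> = a (e j) * g x (e j) (e j)" using j by simp
    finally show ?thesis using e[OF j j] by (auto split: if_splits)
  qed
  then show ?thesis unfolding a by (intro sum.neutral) auto
qed

lemma metric_chart:
  assumes c: "c \<in> A" "x \<in> fst c" and u: "u \<in> tangent_space A x" and v: "v \<in> tangent_space A x"
  shows "g x u v = (gmat A g c x *v u c) \<bullet> v c"
proof -
  let ?X = "\<lambda>i. coord_vec A c (axis i 1) x"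
  have X: "?X i \<in> tangent_space A x" for i using coord_vec_tangent[OF c] .
  have eq: "w = (\<Sum>i\<in>UNIV. w c $ i *\<^sub>R ?X i)" if "w \<in> tangent_space A x" for w
    using tangent_coord_vec[OF that c] linear_vec_sum[OF coord_vec_linear[OF c], of "w c"] by simp
  have "g x u v = (\<Sum>i\<in>UNIV. u c $ i * g x (?X i) v)"
    by (subst eq[OF u]) (intro metric_sum X v)
  also have "\<dots> = (\<Sum>i\<in>UNIV. u c $ i * (\<Sum>j\<in>UNIV. v c $ j * g x (?X j) (?X i)))"
  proof (intro sum.cong refl arg_cong2[where f = "(*)"])
    fix i
    have "g x (?X i) v = g x v (?X i)" by (intro metric_sym X v)
    also have "\<dots> = (\<Sum>j\<in>UNIV. v c $ j * g x (?X j) (?X i))"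
      by (subst eq[OF v]) (intro metric_sum X)
    finally show "g x (?X i) v = (\<Sum>j\<in>UNIV. v c $ j * g x (?X j) (?X i))" .
  qed
  also have "\<dots> = (\<Sum>j\<in>UNIV. \<Sum>i\<in>UNIV. u c $ i * (v c $ j * g x (?X j) (?X i)))"
    unfolding sum_distrib_left by (rule sum.swap)
  also have "\<dots> = (gmat A g c x *v u c) \<bullet> v c"
    by (simp add: inner_vec_def matrix_vector_mult_def gmat_def sum_distrib_right sum_distrib_left
        mult.commute mult.left_commute)
  finally show ?thesis .
qed

lemma coordinate_metric:
  assumes c: "c \<in> A"
  shows "coordinate_metric (snd c ` fst c) (\<lambda>z. gmat A g c (chart_inv c z))"
proof
  show "open (snd c ` fst c)" using chart_open(2)[OF c] .
  show "smooth_on (\<lambda>z. gmat A g c (chart_inv c z)) (snd c ` fst c)" using smooth_gmat[OF c] .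
  fix z assume "z \<in> snd c ` fst c"
  then obtain x where x: "x \<in> fst c" "z = snd c x" by auto
  show "gmat A g c (chart_inv c z) $ i $ j = gmat A g c (chart_inv c z) $ j $ i" for i j
    using x c by (simp add: gmat_def metric_sym coord_vec_tangent)
  have "w = 0" if "gmat A g c x *v w = 0" for w
  proof -
    have "coord_vec A c w x = 0"
    proof (rule metric_nondegenerate)
      show w: "coord_vec A c w x \<in> tangent_space A x" using coord_vec_tangent[OF c x(1)] .
      fix v assume v: "v \<in> tangent_space A x"
      show "g x (coord_vec A c w x) v = 0"
        using metric_chart[OF c x(1) w v] that by (simp add: coord_vec_self[OF c x(1)])
    qed
    then show "w = 0" using coord_vec_self[OF c x(1), of w] by simp
  qed
  then show "invertible (gmat A g c (chart_inv c z))"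
    using x c by (auto simp: invertible_left_inverse matrix_left_invertible_ker)
qed

text \<open>\<open>sharp\<close> is a definite description, so it only has meaning once existence
  and uniqueness are known. The covector \<open>r\<close> witnesses that \<omega> is linear in the
  coordinates; existence then follows by inverting the metric matrix and uniqueness from
  nondegeneracy.\<close>

lemma sharp:
  assumes c: "c \<in> A" "x \<in> fst c" and \<omega>: "\<And>w. w \<in> tangent_space A x \<Longrightarrow> \<omega> w = r \<bullet> w c"
  shows "sharp A g x \<omega> \<in> tangent_space A x" "w \<in> tangent_space A x \<Longrightarrow> g x (sharp A g x \<omega>) w = \<omega> w"
proof -
  interpret coordinate_metric "snd c ` fst c" "\<lambda>z. gmat A g c (chart_inv c z)"
    using coordinate_metric[OF c(1)] .
  have G: "invertible (gmat A g c x)" using G_inv[of "snd c x"] c by simp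
  define v where "v = coord_vec A c (matrix_inv (gmat A g c x) *v r) x"
  have v: "v \<in> tangent_space A x" unfolding v_def using coord_vec_tangent[OF c] .
  have gv: "g x v w = \<omega> w" if w: "w \<in> tangent_space A x" for w
    using metric_chart[OF c v w] \<omega>[OF w] coord_vec_self[OF c]
    by (simp add: v_def matrix_vector_mul_assoc matrix_inv_mult[OF G])
  have "\<exists>!v. v \<in> tangent_space A x \<and> (\<forall>w\<in>tangent_space A x. g x v w = \<omega> w)"
  proof (rule ex1I[of _ v])
    show "v \<in> tangent_space A x \<and> (\<forall>w\<in>tangent_space A x. g x v w = \<omega> w)" using v gv by blast
    fix u assume u: "u \<in> tangent_space A x \<and> (\<forall>w\<in>tangent_space A x. g x u w = \<omega> w)"
    have "u - v = 0"
    proof (rule metric_nondegenerate)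
      show "u - v \<in> tangent_space A x" using u v subspace_diff[OF subspace_tangent_space] by blast
      show "g x (u - v) w = 0" if w: "w \<in> tangent_space A x" for w
        using metric_lin[of u x v w 1 "-1"] u v gv[OF w] w by simp
    qed
    then show "u = v" by simp
  qed
  from theI'[OF this] show "sharp A g x \<omega> \<in> tangent_space A x"
    "w \<in> tangent_space A x \<Longrightarrow> g x (sharp A g x \<omega>) w = \<omega> w"
    unfolding sharp_def by blast+
qed

lemma grad:
  assumes c: "c \<in> A" "x \<in> fst c" and f: "((\<lambda>z. f (chart_inv c z)) has_derivative cderiv c f x) (at (snd c x))"
  shows "grad A g f x \<in> tangent_space A x"
    "w \<in> tangent_space A x \<Longrightarrow> g x (grad A g f x) w = cderiv c f x (w c)"
proof -
  have repr: "dir_deriv A x w f = adjoint (cderiv c f x) 1 \<bullet> w c" if "w \<in> tangent_space A x" for w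
    using dir_deriv_chart[OF c that f] adjoint_works[OF has_derivative_linear[OF f], of "w c" 1]
    by (simp add: inner_commute)
  show "grad A g f x \<in> tangent_space A x" unfolding grad_def 
    by (rule sharp(1)[OF c, where r = "adjoint (cderiv c f x) 1"]) (rule repr)
  show "g x (grad A g f x) w = cderiv c f x (w c)" if "w \<in> tangent_space A x"
  proof -
    have "g x (grad A g f x) w = dir_deriv A x w f"
      unfolding grad_def by (rule sharp(2)[OF c, where r = "adjoint (cderiv c f x) 1"]) (erule repr, rule that)
    then show ?thesis using dir_deriv_chart[OF c that f] by simp
  qed
qed

section \<open>Levi-Civita connection, Ricci tensor and \<open>Kg\<close> in coordinates\<close>

lemma christoffel_chr:
  assumes c: "c \<in> A" "x \<in> fst c"
  shows "(\<chi> k. \<Sum>i\<in>UNIV. \<Sum>j\<in>UNIV. christoffel A g c x k i j * a $ i * b $ j) =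
    coordinate_metric.chr (\<lambda>z. gmat A g c (chart_inv c z)) (snd c x) a b"
proof -
  interpret coordinate_metric "snd c ` fst c" "\<lambda>z. gmat A g c (chart_inv c z)"
    using coordinate_metric[OF c(1)] .
  let ?z = "snd c x"
  have z: "?z \<in> snd c ` fst c" using c by auto
  have d: "cderiv c (\<lambda>y. gmat A g c y $ i $ j) x w = DG ?z w $ i $ j" for i j w
    using cderiv_eqI[OF DG_component[OF z]] by metis
  have chr_axis: "christoffel A g c x k i j = chr ?z (axis i 1) (axis j 1) $ k" for k i j
    unfolding christoffel_def sum_distrib_left chr_def matrix_vector_mult_def vec_lambda_beta chart_inv[OF c] d
  proof (intro sum.cong refl)
    fix l
    show "1/2 * (matrix_inv (gmat A g c x) $ k $ l *
        (DG ?z (axis i 1) $ j $ l + DG ?z (axis j 1) $ i $ l - DG ?z (axis l 1) $ i $ j)) =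
      matrix_inv (gmat A g c x) $ k $ l * (1/2 * (Gderiv ?z (axis i 1) (axis j 1) (axis l 1)
        + Gderiv ?z (axis j 1) (axis i 1) (axis l 1) - Gderiv ?z (axis l 1) (axis i 1) (axis j 1)))"
      unfolding Gderiv_axis DG_sym[OF z, of _ l j] DG_sym[OF z, of _ l i] DG_sym[OF z, of _ j i] by simp
  qed
  have "chr ?z a b $ k = (\<Sum>i\<in>UNIV. \<Sum>j\<in>UNIV. christoffel A g c x k i j * a $ i * b $ j)" for k
  proof -
    have 1: "chr ?z a b = (\<Sum>i\<in>UNIV. a $ i *\<^sub>R chr ?z (axis i 1) b)"
      by (rule linear_vec_sum[OF linear_chr(2)[OF z]])
    have 2: "chr ?z (axis i 1) b = (\<Sum>j\<in>UNIV. b $ j *\<^sub>R chr ?z (axis i 1) (axis j 1))" for i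
      by (rule linear_vec_sum[OF linear_chr(1)[OF z]])
    have "chr ?z a b $ k = (\<Sum>i\<in>UNIV. a $ i * (\<Sum>j\<in>UNIV. b $ j * chr ?z (axis i 1) (axis j 1) $ k))"
      unfolding 1 2 by simp
    then show ?thesis
      unfolding chr_axis by (simp add: sum_distrib_left mult.commute mult.left_commute)
  qed
  then show ?thesis by (simp add: vec_eq_iff)
qed

lemma cov_chart:
  assumes "c \<in> A" "x \<in> fst c"
  shows "cov A g x v Y c = cderiv c (\<lambda>y. Y y c) x (v c)
    + coordinate_metric.chr (\<lambda>z. gmat A g c (chart_inv c z)) (snd c x) (v c) (Y x c)"
  using assms unfolding cov_def christoffel_chr[OF assms] by simp

lemma cderiv_coord_vec:
  assumes "c \<in> A" "x \<in> fst c"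
  shows "cderiv c (\<lambda>y. coord_vec A c w y c) x a = 0"
proof -
  have "cderiv c (\<lambda>y. coord_vec A c w y c) x = cderiv c (\<lambda>y. w) x"
    using assms chart_open(1) by (intro cderiv_cong[of c "fst c"] coord_vec_self) auto
  moreover have "cderiv c (\<lambda>y. w) x = (\<lambda>a. 0)" by (rule cderiv_eqI) simp
  ultimately show ?thesis by simp
qed

text \<open>The definition extends the arguments by fields with constant coordinates. For these the
  covariant derivative reduces to \<open>chr\<close> and the bracket vanishes, which leaves
  \<open>curv\<close>.\<close>

lemma ricci_ric:
  fixes x defines "c \<equiv> chart_at A x"
  shows "ricci A g x u v = coordinate_metric.ric (\<lambda>z. gmat A g c (chart_inv c z)) (snd c x) (u c) (v c)"
proof -
  have c: "c \<in> A" "x \<in> fst c" unfolding c_def by (rule chart_at(1), rule chart_at(2))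
  interpret coordinate_metric "snd c ` fst c" "\<lambda>z. gmat A g c (chart_inv c z)"
    using coordinate_metric[OF c(1)] .
  have N: "open (snd c ` fst c)" "snd c x \<in> snd c ` fst c" using c chart_open(2) by auto
  have cov1: "cov A g y (coord_vec A c b y) (coord_vec A c w) c = chr (snd c y) b w" if "y \<in> fst c" for y b w
    using that c by (simp add: cov_chart coord_vec_self cderiv_coord_vec)
  have cov2: "cov A g x (coord_vec A c a x) (\<lambda>y. cov A g y (coord_vec A c b y) (coord_vec A c w)) c =
      frechet_derivative (\<lambda>z. chr z b w) (at (snd c x)) a + chr (snd c x) a (chr (snd c x) b w)" for a b w
  proof -
    have "cderiv c (\<lambda>y. cov A g y (coord_vec A c b y) (coord_vec A c w) c) x = cderiv c (\<lambda>y. chr (snd c y) b w) x"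
      using c chart_open(1) cov1 by (intro cderiv_cong[of c "fst c"]) auto
    also have "\<dots> = frechet_derivative (\<lambda>z. chr z b w) (at (snd c x))"
      by (intro cderiv_eqI has_derivative_transform_within_open[OF smooth_on_has_derivative[OF smooth_chr N(2)] N])
        (use c in auto)
    finally show ?thesis
      by (subst cov_chart[OF c]) (simp add: coord_vec_self[OF c] cov1[OF c(2)])
  qed
  have lie: "lie_bracket A (coord_vec A c a) (coord_vec A c b) x c = 0" for a b
    using c by (simp add: lie_bracket_def cderiv_coord_vec)
  have "riemann A g (coord_vec A c a) (coord_vec A c b) (coord_vec A c w) x c = curv (snd c x) a b w" for a b w
  proof -
    have "cov A g x (lie_bracket A (coord_vec A c a) (coord_vec A c b) x) (coord_vec A c w) c = 0"
      using c linear_0[OF linear_chr(2)[OF N(2)]] by (simp add: cov_chart lie cderiv_coord_vec)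
    then show ?thesis by (simp add: riemann_def cov2 curv_def)
  qed
  then show ?thesis by (simp add: ricci_def ric_def Let_def c_def[symmetric])
qed

lemma Kg_sym:
  assumes "u \<in> tangent_space A x" "v \<in> tangent_space A x"
  shows "Kg A g x u v = Kg A g x v u"
proof -
  define c where "c = chart_at A x"
  have c: "c \<in> A" "x \<in> fst c" unfolding c_def by (rule chart_at(1), rule chart_at(2))
  interpret coordinate_metric "snd c ` fst c" "\<lambda>z. gmat A g c (chart_inv c z)"
    using coordinate_metric[OF c(1)] .
  have "snd c x \<in> snd c ` fst c" by (rule imageI[OF c(2)])
  from ric_sym[OF this] show ?thesis
    unfolding Kg_def ricci_ric c_def[symmetric] using metric_sym[OF assms] by simp
qed

text \<open>Linearity of \<open>ric\<close> in its last argument makes \<open>Kg A g x u\<close> a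
  covector, so that \<open>sharp\<close> applies to it.\<close>

lemma sharp_Kg:
  assumes u: "u \<in> tangent_space A x"
  shows "sharp A g x (Kg A g x u) \<in> tangent_space A x"
    "w \<in> tangent_space A x \<Longrightarrow> g x (sharp A g x (Kg A g x u)) w = Kg A g x u w"
proof -
  define c where "c = chart_at A x"
  have c: "c \<in> A" "x \<in> fst c" unfolding c_def by (rule chart_at(1), rule chart_at(2))
  interpret coordinate_metric "snd c ` fst c" "\<lambda>z. gmat A g c (chart_inv c z)"
    using coordinate_metric[OF c(1)] .
  have z: "snd c x \<in> snd c ` fst c" by (rule imageI[OF c(2)])
  define k where "k w = 1 / (real CARD('n) - 2) * (scal A g x / (2 * (real CARD('n) - 1)) * ((gmat A g c x *v u c) \<bullet> w)
    - ric (snd c x) (u c) w)" for w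
  have "linear k"
    unfolding k_def
    by (rule linearI) (simp_all only: inner_add_right inner_scaleR_right linear_add[OF linear_ric[OF z]]
        linear_scale[OF linear_ric[OF z]] real_scaleR_def ring_distribs mult.assoc mult.left_commute right_diff_distrib add_diff_add)
  have repr: "Kg A g x u w = adjoint k 1 \<bullet> w c" if "w \<in> tangent_space A x" for w
    using metric_chart[OF c u that] adjoint_works[OF \<open>linear k\<close>, of "w c" 1]
    by (simp add: Kg_def k_def ricci_ric c_def[symmetric] inner_commute)
  show "sharp A g x (Kg A g x u) \<in> tangent_space A x" 
    by (rule sharp(1)[OF c, where r = "adjoint k 1"]) (rule repr)
  show "g x (sharp A g x (Kg A g x u)) w = Kg A g x u w" if "w \<in> tangent_space A x"
    by (rule sharp(2)[OF c, where r = "adjoint k 1"]) (erule repr, rule that)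
qed

text \<open>The tangency hypotheses on the covariant derivatives allow the metric products on the
  right to be computed from coordinates in the single chart \<open>c\<close>.\<close>

lemma metric_curl:
  assumes c: "c \<in> A" "x \<in> U" "x \<in> fst c" and Y: "smooth_map A U (\<lambda>y. Y y c)"
    and u: "u \<in> tangent_space A x" and v: "v \<in> tangent_space A x"
    and cu: "cov A g x u Y \<in> tangent_space A x" and cv: "cov A g x v Y \<in> tangent_space A x"
  defines "F \<equiv> \<lambda>z. gmat A g c (chart_inv c z) *v Y (chart_inv c z) c"
  shows "frechet_derivative F (at (snd c x)) (u c) \<bullet> v c - frechet_derivative F (at (snd c x)) (v c) \<bullet> u c =
    g x (cov A g x u Y) v - g x (cov A g x v Y) u"
proof -
  interpret coordinate_metric "snd c ` fst c" "\<lambda>z. gmat A g c (chart_inv c z)"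
    using coordinate_metric[OF c(1)] .
  have z: "snd c x \<in> snd c ` fst c" using c by auto
  show ?thesis
    unfolding F_def curl_lower[OF z smooth_map_has_derivative[OF Y c]]
      metric_chart[OF c(1,3) cu v] metric_chart[OF c(1,3) cv u] cov_chart[OF c(1,3)]
    using c by simp
qed

end

section \<open>Totally lightlike parallel tractor distributions\<close>

locale lightlike_tractors = pseudo_riemannian A p q g
  for A :: "('a::topological_space, 'n::finite) chart set" and p q :: nat and g :: "('a, 'n) metric" +
  fixes cc :: "('a, 'n) metric set" and k :: nat and H :: "'a \<Rightarrow> ('a, 'n) tractor set"
  assumes in_class_iff: "\<And>h. h \<in> cc \<longleftrightarrow> (\<exists>\<sigma>. conf_rel A UNIV \<sigma> g h)"
    and k: "k \<ge> 1"
    and distribution: "tractor_distribution A cc k H"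
    and lightlike: "totally_lightlike A cc H"
    and parallel: "parallel A cc H"
begin

abbreviation al :: "('a, 'n) tractor \<Rightarrow> real" where "al t \<equiv> fst (t (UNIV, g))"
abbreviation ve :: "('a, 'n) tractor \<Rightarrow> ('a, 'n) tvec" where "ve t \<equiv> fst (snd (t (UNIV, g)))"
abbreviation be :: "('a, 'n) tractor \<Rightarrow> real" where "be t \<equiv> snd (snd (t (UNIV, g)))"

lemma linear_eval: "linear (\<lambda>t::('a, 'n) tractor. t G)"
  by (rule linearI) (simp_all add: scaleR_fun_def)

lemma linear_ve: "linear ve" and linear_be: "linear be"
  by (rule linearI; simp add: scaleR_fun_def)+

lemma conf_rel_refl: "open V \<Longrightarrow> conf_rel A V (\<lambda>_. 0) g g"
  by (simp add: conf_rel_def smooth_map_const)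

lemma g_in_class: "g \<in> cc"
  using in_class_iff conf_rel_refl[OF open_UNIV] by blast

lemma g_conf_restrict: "open V \<Longrightarrow> g \<in> conf_restrict A cc V"
  unfolding conf_restrict_def using g_in_class conf_rel_refl by blast

lemma gauge_g: "(UNIV, g) \<in> gauges_at A cc x"
  using g_conf_restrict[OF open_UNIV] by (simp add: gauges_at_def)

lemma gauge_conf_rel:
  assumes "(W, h) \<in> gauges_at A cc x"
  obtains \<sigma> where "open W" "x \<in> W" "conf_rel A W \<sigma> g h"
proof -
  have W: "open W" "x \<in> W" "h \<in> conf_restrict A cc W" using assms by (auto simp: gauges_at_def)
  then obtain g' \<tau> where g': "g' \<in> cc" and \<tau>: "conf_rel A W \<tau> g' h" by (auto simp: conf_restrict_def)
  obtain \<rho> where \<rho>: "conf_rel A UNIV \<rho> g g'" using g' in_class_iff by blast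
  have "conf_rel A W (\<lambda>x. \<rho> x + \<tau> x) g h"
    unfolding conf_rel_def
  proof (intro conjI ballI)
    show "smooth_map A W (\<lambda>x. \<rho> x + \<tau> x)"
      using \<rho> \<tau> W smooth_map_subset[of UNIV \<rho> W] by (intro smooth_map_add) (auto simp: conf_rel_def)
    fix x u v assume "x \<in> W" "u \<in> tangent_space A x" "v \<in> tangent_space A x"
    then have "h x u v = exp (2 * \<tau> x) * (exp (2 * \<rho> x) * g x u v)"
      using \<rho> \<tau> by (simp add: conf_rel_def)
    also have "\<dots> = exp (2 * (\<rho> x + \<tau> x)) * g x u v" by (simp add: exp_add[symmetric] algebra_simps)
    finally show "h x u v = exp (2 * (\<rho> x + \<tau> x)) * g x u v" .
  qed
  with W show ?thesis by (intro that)
qed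

lemma tractor_change:
  assumes "t \<in> tractor_space A cc x" "(W, h) \<in> gauges_at A cc x" "conf_rel A W \<sigma> g h"
  shows "t (W, h) = change_gauge A g \<sigma> x (t (UNIV, g))"
proof -
  have "\<forall>(V, g)\<in>gauges_at A cc x. \<forall>(W, h)\<in>gauges_at A cc x. \<forall>\<sigma>.
        conf_rel A (V \<inter> W) \<sigma> g h \<longrightarrow> t (W, h) = change_gauge A g \<sigma> x (t (V, g))"
    using assms(1) unfolding tractor_space_def mem_Collect_eq by (elim conjE)
  from bspec[OF bspec[OF this gauge_g, simplified] assms(2)] assms(3) show ?thesis by simp
qed

lemma tractor_ve: "t \<in> tractor_space A cc x \<Longrightarrow> ve t \<in> tangent_space A x"
  using gauge_g by (simp add: tractor_space_def)

lemma dir_deriv_smooth: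
  assumes "smooth_map A U f" "x \<in> U" "v \<in> tangent_space A x" "c \<in> A" "x \<in> fst c"
  shows "dir_deriv A x v f = cderiv c f x (v c)"
  by (rule dir_deriv_chart[OF assms(4,5,3) smooth_map_has_derivative[OF assms(1,4,2,5)]])

lemma dir_deriv_const_on:
  assumes "open U" "x \<in> U" "\<And>y. y \<in> U \<Longrightarrow> f y = a"
  shows "dir_deriv A x v f = 0"
proof -
  have "cderiv (chart_at A x) f x = cderiv (chart_at A x) (\<lambda>y. a) x"
    by (rule cderiv_cong[OF chart_at(1) assms(1,2) chart_at(2) assms(3)])
  also have "\<dots> = (\<lambda>v. 0)" by (rule cderiv_eqI) simp
  finally show ?thesis by (simp add: dir_deriv_def)
qed

text \<open>Every gauge at \<open>x\<close> is a rescaling of \<open>g\<close> near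
  \<open>x\<close>, and the transformation law maps the zero triple to zero; all other arguments
  give 0 by convention. Thus the triple with respect to \<open>g\<close> decides whether a tractor
  vanishes.\<close>

lemma tractor_zero:
  assumes t: "t \<in> tractor_space A cc x" and 0: "t (UNIV, g) = 0"
  shows "t = 0"
proof
  fix G :: "('a, 'n) gauge"
  obtain W h where G: "G = (W, h)" by (cases G)
  show "t G = 0 G"
  proof (cases "G \<in> gauges_at A cc x")
    case True
    then obtain \<sigma> where \<sigma>: "open W" "x \<in> W" "conf_rel A W \<sigma> g h" using gauge_conf_rel G by metis
    have s: "smooth_map A W \<sigma>" using \<sigma>(3) by (simp add: conf_rel_def)
    obtain c where c: "c \<in> A" "x \<in> fst c" using chart_cover by blast
    have "dir_deriv A x 0 \<sigma> = cderiv c \<sigma> x 0"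
      using dir_deriv_smooth[OF s \<sigma>(2) _ c, of 0] subspace_0[OF subspace_tangent_space] by simp
    then have "dir_deriv A x 0 \<sigma> = 0"
      using linear_0[OF has_derivative_linear[OF smooth_map_has_derivative[OF s c(1) \<sigma>(2) c(2)]]] by simp
    moreover have "t G = change_gauge A g \<sigma> x (0, 0, 0)"
      using tractor_change[OF t _ \<sigma>(3)] True G 0 by (simp add: zero_prod_def)
    ultimately show ?thesis by (simp add: zero_prod_def)
  next
    case False
    have "\<forall>G. G \<notin> gauges_at A cc x \<longrightarrow> t G = 0"
      using t unfolding tractor_space_def mem_Collect_eq by (elim conjE)
    from this[rule_format, OF False] show ?thesis by simp
  qed
qed

lemma subspace_H: "subspace (H x)" and H_tractor: "H x \<subseteq> tractor_space A cc x" and dim_H: "dim (H x) = k"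
  using distribution unfolding tractor_distribution_def by blast+

lemma frame:
  obtains U s where "open U" "x \<in> U" "\<And>i. i < k \<Longrightarrow> smooth_section A cc U (s i)"
    "\<And>y. y \<in> U \<Longrightarrow> H y = span ((\<lambda>i. s i y) ` {..<k})"
proof -
  have "\<exists>U s. open U \<and> x \<in> U \<and> (\<forall>i<k. smooth_section A cc U (s i)) \<and>
        (\<forall>y\<in>U. H y = span ((\<lambda>i. s i y) ` {..<k}))"
    using distribution unfolding tractor_distribution_def by (elim conjE allE[where x = x])
  then obtain U s where "open U \<and> x \<in> U \<and> (\<forall>i<k. smooth_section A cc U (s i)) \<and>
        (\<forall>y\<in>U. H y = span ((\<lambda>i. s i y) ` {..<k}))" by blast
  then show ?thesis by (intro that[of U s]) auto
qed

lemma lightlike_pairing: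
  assumes "s \<in> H x" "t \<in> H x"
  shows "al s * be t + al t * be s + g x (ve s) (ve t) = 0"
proof -
  have "\<forall>(V, g)\<in>gauges_at A cc x. tractor_metric g x (s (V, g)) (t (V, g)) = 0"
    using lightlike assms unfolding totally_lightlike_def by simp
  from bspec[OF this gauge_g] have "tractor_metric g x (s (UNIV, g)) (t (UNIV, g)) = 0" by simp
  then show ?thesis by (cases "s (UNIV, g)"; cases "t (UNIV, g)") simp
qed

lemma smooth_section_subset:
  assumes "smooth_section A cc U s" "V \<subseteq> U"
  shows "smooth_section A cc V s"
proof -
  have "V \<inter> W \<subseteq> U \<inter> W" "V \<inter> W \<inter> C \<subseteq> U \<inter> W \<inter> C" for W C using assms(2) by auto
  then show ?thesis
    using assms unfolding smooth_section_def smooth_vf_def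
    by (meson smooth_map_subset subsetD)
qed

lemma smooth_section_g:
  assumes "smooth_section A cc U s"
  shows "smooth_map A U (\<lambda>x. al (s x))" "smooth_vf A U (\<lambda>x. ve (s x))" "smooth_map A U (\<lambda>x. be (s x))"
  using assms g_conf_restrict[OF open_UNIV] unfolding smooth_section_def
  by (metis Int_UNIV_right open_UNIV)+

text \<open>Membership in the tractor space is a hypothesis here. In the applications it is supplied
  by \<open>H\<close>, whose fibres are subspaces inside the tractor spaces.\<close>

lemma smooth_section_combine:
  assumes U: "open U" and s: "smooth_section A cc U s" and s': "smooth_section A cc U s'"
    and r: "smooth_map A U r" and r': "smooth_map A U r'"
    and mem: "\<And>x. x \<in> U \<Longrightarrow> r x *\<^sub>R s x + r' x *\<^sub>R s' x \<in> tractor_space A cc x"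
  shows "smooth_section A cc U (\<lambda>x. r x *\<^sub>R s x + r' x *\<^sub>R s' x)"
  unfolding smooth_section_def
proof (intro conjI ballI allI impI)
  fix x assume "x \<in> U" then show "r x *\<^sub>R s x + r' x *\<^sub>R s' x \<in> tractor_space A cc x" by (rule mem)
next
  fix V h assume V: "open V \<and> h \<in> conf_restrict A cc V"
  have UV: "open (U \<inter> V)" "open (U \<inter> V \<inter> fst c)" if "c \<in> A" for c
    using U V chart_open(1)[OF that] by auto
  obtain c0 where c0: "c0 \<in> A" using chart_cover by blast
  note op = UV(1)[OF c0]
  have R: "smooth_map A (U \<inter> V) r" "smooth_map A (U \<inter> V) r'"
    using r r' by (auto elim: smooth_map_subset)
  have S: "smooth_map A (U \<inter> V) (\<lambda>x. fst (f x (V, h)))" "smooth_vf A (U \<inter> V) (\<lambda>x. fst (snd (f x (V, h))))"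
      "smooth_map A (U \<inter> V) (\<lambda>x. snd (snd (f x (V, h))))" if "smooth_section A cc U f" for f
    using that V unfolding smooth_section_def by blast+
  have "smooth_map A (U \<inter> V) (\<lambda>x. r x * fst (s x (V, h)) + r' x * fst (s' x (V, h)))"
    by (intro smooth_map_add smooth_map_mult op R S s s')
  then show "smooth_map A (U \<inter> V) (\<lambda>x. fst ((r x *\<^sub>R s x + r' x *\<^sub>R s' x) (V, h)))"
    by (simp add: scaleR_fun_def)
  have "smooth_map A (U \<inter> V) (\<lambda>x. r x * snd (snd (s x (V, h))) + r' x * snd (snd (s' x (V, h))))"
    by (intro smooth_map_add smooth_map_mult op R S s s')
  then show "smooth_map A (U \<inter> V) (\<lambda>x. snd (snd ((r x *\<^sub>R s x + r' x *\<^sub>R s' x) (V, h))))"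
    by (simp add: scaleR_fun_def)
  show "smooth_vf A (U \<inter> V) (\<lambda>x. fst (snd ((r x *\<^sub>R s x + r' x *\<^sub>R s' x) (V, h))))"
    unfolding smooth_vf_def
  proof (intro conjI ballI)
    fix x assume x: "x \<in> U \<inter> V"
    have "fst (snd (s x (V, h))) \<in> tangent_space A x" "fst (snd (s' x (V, h))) \<in> tangent_space A x"
      using S(2)[OF s] S(2)[OF s'] x unfolding smooth_vf_def by auto
    then show "fst (snd ((r x *\<^sub>R s x + r' x *\<^sub>R s' x) (V, h))) \<in> tangent_space A x"
      using subspace_add[OF subspace_tangent_space subspace_scale[OF subspace_tangent_space] subspace_scale[OF subspace_tangent_space]]
      by (simp add: scaleR_fun_def)
  next
    fix c assume c: "c \<in> A"
    have "smooth_map A (U \<inter> V \<inter> fst c) (\<lambda>x. r x *\<^sub>R fst (snd (s x (V, h))) c + r' x *\<^sub>R fst (snd (s' x (V, h))) c)"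
      using S(2)[OF s] S(2)[OF s'] c R unfolding smooth_vf_def
      by (intro smooth_map_add smooth_map_scaleR UV c) (auto elim: smooth_map_subset)
    then show "smooth_map A (U \<inter> V \<inter> fst c) (\<lambda>x. fst (snd ((r x *\<^sub>R s x + r' x *\<^sub>R s' x) (V, h))) c)"
      by (simp add: scaleR_fun_def)
  qed
qed

lemma nabla_in_H:
  assumes "open U" "smooth_section A cc U s" "\<And>y. y \<in> U \<Longrightarrow> s y \<in> H y" "x \<in> U" "v \<in> tangent_space A x"
  obtains t where "t \<in> H x" "be t = dir_deriv A x v (\<lambda>y. be (s y)) - g x v (ve (s x))"
    "ve t = cov A g x v (\<lambda>y. ve (s y)) + al (s x) *\<^sub>R v - be (s x) *\<^sub>R sharp A g x (Kg A g x v)"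
proof
  show "nabla_nc A cc x v s \<in> H x"
    using parallel assms unfolding parallel_def by blast
  have "nabla_nc A cc x v s (UNIV, g) = nabla_split A g x v (\<lambda>y. s y (UNIV, g))"
    using gauge_g by (simp add: nabla_nc_def)
  then show "be (nabla_nc A cc x v s) = dir_deriv A x v (\<lambda>y. be (s y)) - g x v (ve (s x))"
    "ve (nabla_nc A cc x v s) = cov A g x v (\<lambda>y. ve (s y)) + al (s x) *\<^sub>R v - be (s x) *\<^sub>R sharp A g x (Kg A g x v)"
    by (simp_all add: nabla_split_def Let_def)
qed

lemma zero_on_span:
  assumes "linear f" "\<And>b. b \<in> B \<Longrightarrow> f b = 0" "t \<in> span B"
  shows "f t = 0"
  using linear_eq_0_on_span[of f B t] assms by blast

section \<open>Density of the points where some tractor of \<open>H\<close> has nonzero third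
  component\<close>

lemma generic_point:
  assumes W: "open W" "x \<in> W"
  shows "\<exists>y\<in>W. \<exists>t\<in>H y. be t \<noteq> 0"
proof (rule ccontr)
  assume "\<not> ?thesis"
  then have no: "be t = 0" if "y \<in> W" "t \<in> H y" for y t using that by blast
  obtain U s where U: "open U" "x \<in> U" and s: "\<And>i. i < k \<Longrightarrow> smooth_section A cc U (s i)"
    and span: "\<And>y. y \<in> U \<Longrightarrow> H y = span ((\<lambda>i. s i y) ` {..<k})"
    by (rule frame[where x = x]) (rule that)
  define V where "V = U \<inter> W"
  have V: "open V" "x \<in> V" "V \<subseteq> U" "V \<subseteq> W" using U W by (auto simp: V_def)
  have sV: "smooth_section A cc V (s i)" if "i < k" for i using smooth_section_subset[OF s[OF that] V(3)] .
  have sH: "s i y \<in> H y" if "i < k" "y \<in> V" for i y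
    unfolding span[OF subsetD[OF V(3) that(2)]] by (rule span_base) (use that in auto)
  \<comment> \<open>Established on all of \<open>V\<close>, because the covariant derivative at
    \<open>x\<close> taken below depends on the values near \<open>x\<close>.\<close>
  have vec0: "ve (s i y) = 0" if i: "i < k" and y: "y \<in> V" for i y
  proof (rule metric_nondegenerate)
    show T: "ve (s i y) \<in> tangent_space A y" using tractor_ve H_tractor sH[OF i y] by blast
    fix v assume v: "v \<in> tangent_space A y"
    obtain t where t: "t \<in> H y" "be t = dir_deriv A y v (\<lambda>y. be (s i y)) - g y v (ve (s i y))"
      by (rule nabla_in_H[OF V(1) sV[OF i] sH[OF i] y v]) (assumption, rule that)
    have "dir_deriv A y v (\<lambda>y. be (s i y)) = 0"
      by (rule dir_deriv_const_on[OF V(1) y no]) (use V sH[OF i] in auto)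
    moreover have "be t = 0" using no t(1) y V by blast
    ultimately show "g y (ve (s i y)) v = 0" using t(2) metric_sym[OF T v] by simp
  qed
  have x: "x \<in> V" "x \<in> U" using V U by auto
  have vecH: "ve t = 0" if "t \<in> H x" for t
    by (rule zero_on_span[OF linear_ve _ that[unfolded span[OF x(2)]]]) (use vec0 x in auto)
  have "s i x = 0" if i: "i < k" for i
  proof (rule tractor_zero)
    show "s i x \<in> tractor_space A cc x" using H_tractor sH[OF i x(1)] by blast
    obtain c where c: "c \<in> A" "x \<in> fst c" using chart_cover by blast
    interpret coordinate_metric "snd c ` fst c" "\<lambda>z. gmat A g c (chart_inv c z)"
      using coordinate_metric[OF c(1)] .
    \<comment> \<open>Any nonzero direction serves: the vector part of the derivative has been
      reduced to \<alpha> times this vector, and it must vanish as the vector part of an element of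
      \<open>H x\<close>.\<close>
    define v where "v = coord_vec A c (axis undefined 1) x"
    have v: "v \<in> tangent_space A x" unfolding v_def by (rule coord_vec_tangent[OF c])
    obtain t where t: "t \<in> H x"
      "ve t = cov A g x v (\<lambda>y. ve (s i y)) + al (s i x) *\<^sub>R v - be (s i x) *\<^sub>R sharp A g x (Kg A g x v)"
      by (rule nabla_in_H[OF V(1) sV[OF i] sH[OF i] x(1) v]) (assumption, rule that)
    have be0: "be (s i x) = 0" using no sH[OF i x(1)] x V by blast
    have "cderiv c (\<lambda>y. ve (s i y) c) x = cderiv c (\<lambda>y. 0) x"
      using vec0[OF i] by (intro cderiv_cong[OF c(1) V(1) x(1) c(2)]) simp
    moreover have "cderiv c (\<lambda>y. 0 :: real^'n) x = (\<lambda>v. 0)" by (rule cderiv_eqI) simp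
    ultimately have "cov A g x v (\<lambda>y. ve (s i y)) c = 0"
      using linear_0[OF linear_chr(1)[OF imageI[OF c(2)]]] vec0[OF i x(1)] by (simp add: cov_chart[OF c])
    moreover have "ve t c = (cov A g x v (\<lambda>y. ve (s i y)) + al (s i x) *\<^sub>R v - be (s i x) *\<^sub>R sharp A g x (Kg A g x v)) c"
      using t(2) by simp
    ultimately have "al (s i x) *\<^sub>R axis undefined 1 = (0 :: real^'n)"
      using vecH[OF t(1)] be0 by (simp add: scaleR_fun_def v_def coord_vec_self[OF c])
    then have "al (s i x) = 0" by simp
    then show "s i x (UNIV, g) = 0" using vec0[OF i x(1)] be0 by (simp add: prod_eq_iff)
  qed
  then have "H x \<subseteq> span {}" unfolding span[OF x(2)] by (intro span_minimal) auto
  then have "dim (H x) \<le> card ({} :: ('a, 'n) tractor set)" by (intro dim_le_card) auto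
  then show False using dim_H k by simp
qed

end

section \<open>Local frames normalised in the third tractor component\<close>

locale adapted_frame = lightlike_tractors A p q g cc k H
  for A :: "('a::topological_space, 'n::finite) chart set" and p q :: nat and g :: "('a, 'n) metric"
    and cc :: "('a, 'n) metric set" and k :: nat and H :: "'a \<Rightarrow> ('a, 'n) tractor set" +
  fixes U :: "'a set" and c :: "('a, 'n) chart" and S :: "nat \<Rightarrow> 'a \<Rightarrow> ('a, 'n) tractor"
  assumes U: "open U" and c: "c \<in> A" and Uc: "U \<subseteq> fst c"
    and section_S: "\<And>i. i < k \<Longrightarrow> smooth_section A cc U (S i)"
    and span_S: "\<And>y. y \<in> U \<Longrightarrow> H y = span ((\<lambda>i. S i y) ` {..<k})"
    and be_0: "\<And>y. y \<in> U \<Longrightarrow> be (S 0 y) = 1"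
    and be_Suc: "\<And>i y. y \<in> U \<Longrightarrow> Suc i < k \<Longrightarrow> be (S (Suc i) y) = 0"

context lightlike_tractors
begin

text \<open>One step of Gaussian elimination on the third components: a section with nonzero \<beta>
  is moved to the front, scaled to \<beta> = 1 and subtracted from the others, on the open set where
  its \<beta> does not vanish and within one chart domain.\<close>

lemma adapted_frame_exists:
  assumes t: "t \<in> H x" "be t \<noteq> 0"
  obtains U c S where "x \<in> U" "adapted_frame A p q g cc k H U c S"
proof -
  obtain U0 s where U0: "open U0" "x \<in> U0" and s: "\<And>i. i < k \<Longrightarrow> smooth_section A cc U0 (s i)"
    and span: "\<And>y. y \<in> U0 \<Longrightarrow> H y = span ((\<lambda>i. s i y) ` {..<k})"
    by (rule frame[where x = x]) (rule that)
  obtain c where c: "c \<in> A" "x \<in> fst c" using chart_cover by blast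
  have "\<exists>j<k. be (s j x) \<noteq> 0"
  proof (rule ccontr)
    assume "\<not> ?thesis"
    then have "be t = 0"
      by (intro zero_on_span[OF linear_be _ t(1)[unfolded span[OF U0(2)]]]) auto
    then show False using t(2) by simp
  qed
  then obtain j where j: "j < k" "be (s j x) \<noteq> 0" by blast
  define \<pi> where "\<pi> i = (if i = 0 then j else if i = j then 0 else i)" for i
  have \<pi>k: "\<pi> i < k" if "i < k" for i using that j by (auto simp: \<pi>_def)
  have "\<pi> (\<pi> i) = i" for i by (auto simp: \<pi>_def)
  then have \<pi>_image: "\<pi> ` {..<k} = {..<k}"
    using \<pi>k by (intro equalityI subsetI) (auto, metis imageI lessThan_iff)
  define s' where "s' i = s (\<pi> i)" for i
  have s': "smooth_section A cc U0 (s' i)" if "i < k" for i unfolding s'_def by (rule s[OF \<pi>k[OF that]])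
  have span': "H y = span ((\<lambda>i. s' i y) ` {..<k})" if "y \<in> U0" for y
  proof -
    have "(\<lambda>i. s' i y) ` {..<k} = (\<lambda>i. s i y) ` \<pi> ` {..<k}" by (simp add: s'_def image_image)
    then show ?thesis using span[OF that] \<pi>_image by simp
  qed
  have s'H: "s' i y \<in> H y" if "i < k" "y \<in> U0" for i y
    unfolding span'[OF that(2)] by (rule span_base) (use that in auto)
  define r where "r y = be (s' 0 y)" for y
  have k0: "0 < k" using k by simp
  have sr: "smooth_map A U0 r" unfolding r_def by (rule smooth_section_g(3)[OF s'[OF k0]])
  define U where "U = (U0 \<inter> r -` (- {0})) \<inter> fst c"
  have U: "open U" unfolding U_def
    by (intro open_Int continuous_open_preimage smooth_map_continuous_on[OF sr] U0 chart_open(1)[OF c(1)]) auto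
  have sub: "U \<subseteq> U0" "U \<subseteq> fst c" and r0: "r y \<noteq> 0" if "y \<in> U" for y using that by (auto simp: U_def)
  have sub: "U \<subseteq> U0" "U \<subseteq> fst c" by (auto simp: U_def)
  have xU: "x \<in> U" using U0 c j by (simp add: U_def r_def s'_def \<pi>_def)
  have srU: "smooth_map A U r" by (rule smooth_map_subset[OF sr sub(1)])
  \<comment> \<open>Both branches are written as two-term combinations, with a coefficient 0 or 1
    where necessary, to match \<open>smooth_section_combine\<close>.\<close>
  define S where "S i y = (if i = 0 then (1 / r y) *\<^sub>R s' 0 y + 0 *\<^sub>R s' 0 y
      else 1 *\<^sub>R s' i y + (- be (s' i y) / r y) *\<^sub>R s' 0 y)" for i y
  have SH: "S i y \<in> H y" if "i < k" "y \<in> U" for i y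
  proof -
    have y: "y \<in> U0" using that(2) sub by auto
    have "a *\<^sub>R s' 0 y + b *\<^sub>R s' 0 y \<in> H y" "a *\<^sub>R s' i y + b *\<^sub>R s' 0 y \<in> H y" for a b
      by (intro subspace_add subspace_scale subspace_H s'H[OF that(1) y] s'H[OF k0 y])+
    then show ?thesis unfolding S_def by (cases "i = 0") (simp_all only: if_True if_False simp_thms)
  qed
  have beS: "be (S 0 y) = 1" "i \<noteq> 0 \<Longrightarrow> be (S i y) = 0" if "y \<in> U" for i y
    using r0[OF that] unfolding S_def
    by (simp_all add: linear_add[OF linear_be] linear_scale[OF linear_be] r_def)
  have "adapted_frame A p q g cc k H U c S"
  proof unfold_locales
    show "open U" "c \<in> A" "U \<subseteq> fst c" using U c sub by auto
    fix i assume i: "i < k"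
    have mem: "S i y \<in> tractor_space A cc y" if "y \<in> U" for y using SH[OF i that] H_tractor by blast
    note sU = smooth_section_subset[OF s' sub(1)]
    show "smooth_section A cc U (S i)"
    proof (cases "i = 0")
      case True
      have "smooth_section A cc U (\<lambda>y. (1 / r y) *\<^sub>R s' 0 y + 0 *\<^sub>R s' 0 y)"
        by (intro smooth_section_combine U sU k0 smooth_map_divide smooth_map_const srU r0)
          (use mem True in \<open>simp_all add: S_def\<close>)
      then show ?thesis using True by (simp add: S_def[abs_def])
    next
      case False
      have "smooth_map A U (\<lambda>y. be (s' i y))" by (rule smooth_section_g(3)[OF sU[OF i]])
      from smooth_map_diff[OF U smooth_map_const[OF U, of 0] this]
      have "smooth_map A U (\<lambda>y. - be (s' i y))" by simp
      then have "smooth_section A cc U (\<lambda>y. 1 *\<^sub>R s' i y + (- be (s' i y) / r y) *\<^sub>R s' 0 y)"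
        by (intro smooth_section_combine U sU i k0 smooth_map_divide smooth_map_const srU r0)
          (use mem False in \<open>simp_all add: S_def\<close>)
      then show ?thesis using False by (simp add: S_def[abs_def])
    qed
  next
    fix y assume y: "y \<in> U"
    let ?B = "span ((\<lambda>i. S i y) ` {..<k})"
    show "H y = ?B"
    proof
      show "?B \<subseteq> H y" by (rule span_minimal[OF _ subspace_H]) (use SH y in auto)
      have base: "S i y \<in> ?B" if "i < k" for i by (rule span_base) (use that in auto)
      have eq0: "s' 0 y = r y *\<^sub>R S 0 y" using r0[OF y] by (simp add: S_def)
      have "s' i y \<in> ?B" if i: "i < k" for i
      proof (cases "i = 0")
        case True
        then show ?thesis using eq0 base[OF k0] by (simp add: span_scale)
      next
        case False
        then have "s' i y = S i y + (be (s' i y) / r y) *\<^sub>R s' 0 y"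
          by (simp add: S_def)
        then show ?thesis using eq0 base[OF k0] base[OF i] by (metis span_add span_scale)
      qed
      then show "H y \<subseteq> ?B" unfolding span'[OF subsetD[OF sub(1) y]]
        by (intro span_minimal subspace_span) auto
    qed
    show "be (S 0 y) = 1" by (rule beS(1)[OF y])
  next
    fix i y assume "y \<in> U" then show "be (S (Suc i) y) = 0" using beS(2) by blast
  qed
  then show ?thesis using that xU by blast
qed

end

context adapted_frame
begin

text \<open>Index 0 of the frame is taken by the tractor with \<beta> = 1, so the \<open>K i\<close>
  start at index 1 and there are \<open>k - 1\<close> of them.\<close>

abbreviation K :: "nat \<Rightarrow> 'a \<Rightarrow> ('a, 'n) tvec" where "K i y \<equiv> ve (S (Suc i) y)"
abbreviation Y :: "'a \<Rightarrow> ('a, 'n) tvec" where "Y y \<equiv> ve (S 0 y)"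
abbreviation KK :: "'a \<Rightarrow> ('a, 'n) tvec set" where "KK y \<equiv> span ((\<lambda>i. K i y) ` {..<k - 1})"

lemma k0: "0 < k" and Suc_k: "i < k - 1 \<Longrightarrow> Suc i < k"
  using k by auto

lemma be_S: "y \<in> U \<Longrightarrow> i < k \<Longrightarrow> be (S i y) = (if i = 0 then 1 else 0)"
  using be_0 be_Suc by (cases i) auto

lemma S_H: "y \<in> U \<Longrightarrow> i < k \<Longrightarrow> S i y \<in> H y"
  unfolding span_S by (rule span_base) auto

lemma ve_tangent: "y \<in> U \<Longrightarrow> i < k \<Longrightarrow> ve (S i y) \<in> tangent_space A y"
  using S_H H_tractor tractor_ve by blast

lemma decompose:
  assumes y: "y \<in> U" and t: "t \<in> H y"
  shows "t - be t *\<^sub>R S 0 y \<in> span ((\<lambda>i. S (Suc i) y) ` {..<k - 1})" (is "_ \<in> ?B")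
proof -
  let ?P = "{t. t - be t *\<^sub>R S 0 y \<in> ?B}"
  have "linear (\<lambda>t. t - be t *\<^sub>R S 0 y)"
    by (intro linearI) (simp_all add: linear_add[OF linear_be] linear_scale[OF linear_be] algebra_simps)
  then have "subspace ?P" using linear_subspace_vimage[of "\<lambda>t. t - be t *\<^sub>R S 0 y" ?B] by (simp add: vimage_def)
  moreover have "S i y - be (S i y) *\<^sub>R S 0 y \<in> ?B" if i: "i \<in> {..<k}" for i
  proof (cases i)
    case 0
    then show ?thesis using be_0[OF y] by (simp add: span_zero)
  next
    case (Suc j)
    then have "S i y \<in> ?B" using i by (intro span_base) auto
    then show ?thesis using be_Suc[OF y, of j] i Suc by simp
  qed
  then have "(\<lambda>i. S i y) ` {..<k} \<subseteq> ?P" by blast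
  ultimately have "span ((\<lambda>i. S i y) ` {..<k}) \<subseteq> ?P" by (rule span_minimal[rotated])
  then show ?thesis using t span_S[OF y] by auto
qed

text \<open>Subtracting \<open>be t\<close> times the first frame tractor leaves a combination of
  those with \<beta> = 0. This converts membership in \<open>H\<close> into a statement about
  tangent vectors only.\<close>

lemma ve_KK:
  assumes "y \<in> U" "t \<in> H y"
  shows "ve t - be t *\<^sub>R Y y \<in> KK y"
proof -
  have "ve (t - be t *\<^sub>R S 0 y) \<in> ve ` span ((\<lambda>i. S (Suc i) y) ` {..<k - 1})"
    using decompose[OF assms] by (rule imageI)
  also have "\<dots> = KK y" by (simp add: linear_span_image[OF linear_ve, symmetric] image_image)
  finally show ?thesis
    by (simp only: linear_diff[OF linear_ve] linear_scale[OF linear_ve])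
qed

lemma KK_tangent: "y \<in> U \<Longrightarrow> KK y \<subseteq> tangent_space A y"
  by (intro span_minimal subspace_tangent_space) (auto intro!: ve_tangent Suc_k)

lemma KK_orthogonal:
  assumes y: "y \<in> U" and u: "u \<in> tangent_space A y" and K: "\<And>j. j < k - 1 \<Longrightarrow> g y (K j y) u = 0"
    and w: "w \<in> KK y"
  shows "g y w u = 0"
proof -
  have "subspace {w \<in> tangent_space A y. g y w u = 0}"
    using subspace_tangent_space[of y] u
    by (auto simp: subspace_def metric_add metric_scale intro: metric_scale[of 0 y u 0, simplified])
  then have "KK y \<subseteq> {w \<in> tangent_space A y. g y w u = 0}"
    by (intro span_minimal) (auto intro!: ve_tangent y Suc_k K)
  then show ?thesis using w by auto
qed

text \<open>This lemma and the next two evaluate the lightlike condition on pairs of frame tractors.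
  With third components 1 and 0 it expresses all \<alpha> through \<open>g\<close> and makes the
  \<open>K i\<close> null and mutually orthogonal.\<close>

lemma al_0: "y \<in> U \<Longrightarrow> 2 * al (S 0 y) + g y (Y y) (Y y) = 0"
  using lightlike_pairing[OF S_H S_H, OF _ k0 _ k0, of y] be_0[of y] by simp

lemma al_Suc: "y \<in> U \<Longrightarrow> i < k - 1 \<Longrightarrow> al (S (Suc i) y) + g y (Y y) (K i y) = 0"
  using lightlike_pairing[OF S_H S_H, OF _ k0 _ Suc_k, of y i] be_0[of y] be_Suc[of y i] Suc_k[of i] by simp

lemma K_null: "y \<in> U \<Longrightarrow> i < k - 1 \<Longrightarrow> j < k - 1 \<Longrightarrow> g y (K i y) (K j y) = 0"
  using lightlike_pairing[OF S_H S_H, OF _ Suc_k _ Suc_k, of y i j] be_Suc[of y i] be_Suc[of y j]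
    Suc_k[of i] Suc_k[of j] by simp

lemma KK_null:
  assumes "y \<in> U" "w \<in> KK y"
  shows "g y w w = 0"
proof (rule KK_orthogonal[OF assms(1) _ _ assms(2)])
  show w: "w \<in> tangent_space A y" using KK_tangent assms by blast
  fix j assume j: "j < k - 1"
  have "g y w (K j y) = 0"
    by (rule KK_orthogonal[OF assms(1) _ _ assms(2)]) (use ve_tangent assms K_null j Suc_k in auto)
  then show "g y (K j y) w = 0" using metric_sym[OF w ve_tangent[OF assms(1) Suc_k[OF j]]] by simp
qed

text \<open>A relation between the vectors lifts to the tractors: the same combination has \<beta> =
  0 and zero vector part, and its pairing with \<open>S 0 y\<close> gives \<alpha> = 0, so it is the
  zero tractor. One frame tractor would then be redundant and the fibre would have dimension less
  than \<open>k\<close>.\<close>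

lemma K_independent:
  assumes y: "y \<in> U" and 0: "(\<Sum>i<k - 1. a i *\<^sub>R K i y) = 0" and j: "j < k - 1"
  shows "a j = 0"
proof (rule ccontr)
  assume aj: "a j \<noteq> 0"
  define t where "t = (\<Sum>i<k - 1. a i *\<^sub>R S (Suc i) y)"
  have tH: "t \<in> H y"
    unfolding t_def by (intro subspace_sum subspace_scale subspace_H S_H[OF y Suc_k]) auto
  have ve: "ve t = 0"
    using 0 by (simp only: t_def linear_sum[OF linear_ve] linear_scale[OF linear_ve] o_def)
  have "be t = (\<Sum>i<k - 1. a i * be (S (Suc i) y))"
    by (simp only: t_def linear_sum[OF linear_be] linear_scale[OF linear_be] o_def real_scaleR_def)
  then have be: "be t = 0" using be_Suc[OF y Suc_k] by simp
  have "g y 0 (Y y) = 0"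
    using metric_scale[OF ve_tangent[OF y k0] ve_tangent[OF y k0], of 0] by simp
  then have "al t = 0" using lightlike_pairing[OF tH S_H[OF y k0]] be ve be_0[OF y] by simp
  with be ve have "t (UNIV, g) = 0" by (simp add: prod_eq_iff)
  then have t0: "t = 0" using tractor_zero tH H_tractor by blast
  define B where "B = insert (S 0 y) ((\<lambda>i. S (Suc i) y) ` ({..<k - 1} - {j}))"
  have B: "S (Suc i) y \<in> span B" if "i < k - 1" "i \<noteq> j" for i
    unfolding B_def by (rule span_base) (use that in auto)
  have "a j *\<^sub>R S (Suc j) y + (\<Sum>i\<in>{..<k - 1} - {j}. a i *\<^sub>R S (Suc i) y) = 0"
    using t0 j unfolding t_def by (subst (asm) sum.remove[of _ j]) auto
  then have "a j *\<^sub>R S (Suc j) y = - (\<Sum>i\<in>{..<k - 1} - {j}. a i *\<^sub>R S (Suc i) y)"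
    by (rule eq_neg_iff_add_eq_0[THEN iffD2])
  also have "\<dots> \<in> span B" using B by (intro span_neg span_sum span_scale) auto
  finally have "(1 / a j) *\<^sub>R (a j *\<^sub>R S (Suc j) y) \<in> span B" by (rule span_scale)
  then have Sj: "S (Suc j) y \<in> span B" using aj by simp
  have "H y \<subseteq> span B"
    unfolding span_S[OF y]
  proof (intro span_minimal subspace_span image_subsetI)
    fix i assume "i \<in> {..<k}"
    show "S i y \<in> span B"
    proof (cases i)
      case 0
      then show ?thesis by (simp add: B_def span_base)
    next
      case (Suc l)
      then show ?thesis using B[of l] Sj \<open>i \<in> {..<k}\<close> by (cases "l = j") auto
    qed
  qed
  moreover have fin: "finite B" by (simp add: B_def)
  ultimately have "dim (H y) \<le> card B" by (intro dim_le_card)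
  also have "\<dots> \<le> Suc (card ((\<lambda>i. S (Suc i) y) ` ({..<k - 1} - {j})))"
    unfolding B_def by (rule card_insert_le_m1) auto
  also have "\<dots> \<le> Suc (card ({..<k - 1} - {j}))" by (simp add: card_image_le)
  also have "\<dots> < k" using j by simp
  finally show False using dim_H by simp
qed

text \<open>The third components of the frame are constant, so the third component of the derivative
  is \<open>- g y v (ve (S i y))\<close>. The last summand is the multiple of \<open>Y y\<close>
  that \<open>ve_KK\<close> removes accordingly.\<close>

lemma nabla_S:
  assumes y: "y \<in> U" and i: "i < k" and v: "v \<in> tangent_space A y"
  shows "cov A g y v (\<lambda>y. ve (S i y)) + al (S i y) *\<^sub>R v - be (S i y) *\<^sub>R sharp A g y (Kg A g y v)
    + g y v (ve (S i y)) *\<^sub>R Y y \<in> KK y"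
proof -
  obtain t where t: "t \<in> H y" "be t = dir_deriv A y v (\<lambda>y. be (S i y)) - g y v (ve (S i y))"
    "ve t = cov A g y v (\<lambda>y. ve (S i y)) + al (S i y) *\<^sub>R v - be (S i y) *\<^sub>R sharp A g y (Kg A g y v)"
    by (rule nabla_in_H[OF U section_S[OF i] S_H[OF _ i] y v]) (assumption, rule that)
  have "dir_deriv A y v (\<lambda>y. be (S i y)) = 0"
    by (rule dir_deriv_const_on[OF U y be_S[OF _ i]])
  then have "be t = - g y v (ve (S i y))" using t(2) by simp
  then show ?thesis using ve_KK[OF y t(1)] unfolding t(3) by simp
qed

text \<open>Parallelism replaces a computation with the transformation law of Christoffel symbols:
  the whole sum in \<open>nabla_S\<close> lies in the span of the \<open>K i\<close>, hence is
  tangent, and so are all its other summands.\<close>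

lemma cov_S_tangent:
  assumes y: "y \<in> U" and i: "i < k" and v: "v \<in> tangent_space A y"
  shows "cov A g y v (\<lambda>y. ve (S i y)) \<in> tangent_space A y"
proof -
  let ?w = "cov A g y v (\<lambda>y. ve (S i y)) + al (S i y) *\<^sub>R v - be (S i y) *\<^sub>R sharp A g y (Kg A g y v)
    + g y v (ve (S i y)) *\<^sub>R Y y"
  have T': "?w \<in> tangent_space A y" using nabla_S[OF assms] KK_tangent[OF y] by blast
  have T: "al (S i y) *\<^sub>R v \<in> tangent_space A y" "be (S i y) *\<^sub>R sharp A g y (Kg A g y v) \<in> tangent_space A y"
    "g y v (ve (S i y)) *\<^sub>R Y y \<in> tangent_space A y"
    by (intro subspace_scale subspace_tangent_space v sharp_Kg(1) ve_tangent y k0)+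
  have "((?w - g y v (ve (S i y)) *\<^sub>R Y y) + be (S i y) *\<^sub>R sharp A g y (Kg A g y v)) - al (S i y) *\<^sub>R v
      \<in> tangent_space A y"
    by (rule subspace_diff[OF subspace_tangent_space subspace_add[OF subspace_tangent_space
          subspace_diff[OF subspace_tangent_space T' T(3)] T(2)] T(1)])
  then show ?thesis by (simp only: add_diff_cancel_right' diff_add_cancel)
qed

text \<open>Pairing \<open>nabla_S\<close> with a vector orthogonal to all \<open>K i\<close>
  annihilates its unspecified part and leaves an explicit formula.\<close>

lemma nabla_S_orthogonal:
  assumes y: "y \<in> U" and i: "i < k" and u: "u \<in> tangent_space A y" and w: "w \<in> tangent_space A y"
    and K: "\<And>j. j < k - 1 \<Longrightarrow> g y (K j y) w = 0"
  shows "g y (cov A g y u (\<lambda>y. ve (S i y))) w =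
    - al (S i y) * g y u w + be (S i y) * Kg A g y u w - g y u (ve (S i y)) * g y (Y y) w"
proof -
  let ?C = "cov A g y u (\<lambda>y. ve (S i y))" and ?s = "sharp A g y (Kg A g y u)"
  have T: "?C \<in> tangent_space A y" "?s \<in> tangent_space A y" "Y y \<in> tangent_space A y"
    using cov_S_tangent[OF y i u] sharp_Kg(1)[OF u] ve_tangent[OF y k0] by auto
  have sc: "r *\<^sub>R v \<in> tangent_space A y" if "v \<in> tangent_space A y" for r v
    using subspace_scale[OF subspace_tangent_space that] .
  have "?C + al (S i y) *\<^sub>R u - be (S i y) *\<^sub>R ?s + g y u (ve (S i y)) *\<^sub>R Y y =
      ((?C + al (S i y) *\<^sub>R u) + (- be (S i y)) *\<^sub>R ?s) + g y u (ve (S i y)) *\<^sub>R Y y"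
    by (simp only: scaleR_minus_left diff_conv_add_uminus)
  then have "0 = g y (((?C + al (S i y) *\<^sub>R u) + (- be (S i y)) *\<^sub>R ?s) + g y u (ve (S i y)) *\<^sub>R Y y) w"
    using KK_orthogonal[OF y w K nabla_S[OF y i u]] by simp
  also have "\<dots> = g y ?C w + al (S i y) * g y u w + (- be (S i y)) * g y ?s w + g y u (ve (S i y)) * g y (Y y) w"
    using T u w sc by (simp only: metric_add metric_scale subspace_add[OF subspace_tangent_space])
  finally show ?thesis using sharp_Kg(2)[OF u w] by simp
qed

section \<open>Closedness of the lowered frame fields along the orthogonal distribution\<close>

lemma smooth_ve:
  assumes "i < k"
  shows "smooth_map A U (\<lambda>y. ve (S i y) c)"
proof -
  have "smooth_map A (U \<inter> fst c) (\<lambda>y. ve (S i y) c)"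
    using smooth_section_g(2)[OF section_S[OF assms]] c unfolding smooth_vf_def by blast
  then show ?thesis using Uc by (simp add: Int_absorb2)
qed

text \<open>The covector g(Y, _) for index 0 and g(K, _) for the others, as a function of the
  coordinates in \<open>c\<close>.\<close>

abbreviation flat :: "nat \<Rightarrow> real^'n \<Rightarrow> real^'n" where
  "flat i \<equiv> \<lambda>z. gmat A g c (chart_inv c z) *v ve (S i (chart_inv c z)) c"

lemma flat_inner:
  assumes "y \<in> U" "i < k" "u \<in> tangent_space A y"
  shows "flat i (snd c y) \<bullet> u c = g y (ve (S i y)) u"
proof -
  have yc: "y \<in> fst c" using assms(1) Uc by blast
  show ?thesis
    using metric_chart[OF c yc ve_tangent[OF assms(1,2)] assms(3)] by (simp only: chart_inv[OF c yc])
qed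

lemma smooth_flat:
  assumes "i < k"
  shows "smooth_on (flat i) (snd c ` U)"
proof -
  have UU: "U \<inter> fst c = U" using Uc by blast
  have "open (snd c ` U)" using chart_image_open[OF c U] UU by simp
  moreover have "smooth_on (\<lambda>z. gmat A g c (chart_inv c z)) (snd c ` U)"
    by (rule smooth_on_subset[OF smooth_gmat[OF c]]) (use Uc in auto)
  moreover have "smooth_on (\<lambda>z. ve (S i (chart_inv c z)) c) (snd c ` U)"
    using smooth_map_chart[OF smooth_ve[OF assms] c] UU by simp
  ultimately show ?thesis by (rule smooth_on_matrix_vector)
qed

text \<open>Antisymmetrising \<open>nabla_S_orthogonal\<close> removes the \<alpha> term by symmetry
  of \<open>g\<close> and the curvature term by symmetry of \<open>Kg\<close>. The term with
  \<open>Y\<close> is symmetric for index 0 and zero for the others, as both vectors are orthogonal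
  to the \<open>K i\<close>. For the \<open>K i\<close> this is integrability of the distribution,
  for \<open>Y\<close> closedness along it.\<close>

lemma flat_closed:
  assumes i: "i < k" and y: "y \<in> U"
    and a: "\<And>j. j < k - 1 \<Longrightarrow> flat (Suc j) (snd c y) \<bullet> a = 0"
    and b: "\<And>j. j < k - 1 \<Longrightarrow> flat (Suc j) (snd c y) \<bullet> b = 0"
  shows "frechet_derivative (flat i) (at (snd c y)) a \<bullet> b = frechet_derivative (flat i) (at (snd c y)) b \<bullet> a"
proof -
  have yc: "y \<in> fst c" using y Uc by blast
  define u where "u = coord_vec A c a y"
  define w where "w = coord_vec A c b y"
  have u: "u \<in> tangent_space A y" "u c = a" and w: "w \<in> tangent_space A y" "w c = b"
    unfolding u_def w_def using coord_vec_tangent[OF c yc] coord_vec_self[OF c yc] by auto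
  have Ku: "g y (K j y) u = 0" if "j < k - 1" for j
    using flat_inner[OF y Suc_k[OF that] u(1)] a[OF that] u(2) by simp
  have Kw: "g y (K j y) w = 0" if "j < k - 1" for j
    using flat_inner[OF y Suc_k[OF that] w(1)] b[OF that] w(2) by simp
  have "frechet_derivative (flat i) (at (snd c y)) (u c) \<bullet> w c - frechet_derivative (flat i) (at (snd c y)) (w c) \<bullet> u c =
      g y (cov A g y u (\<lambda>y. ve (S i y))) w - g y (cov A g y w (\<lambda>y. ve (S i y))) u"
    by (rule metric_curl[OF c y yc smooth_ve[OF i] u(1) w(1) cov_S_tangent[OF y i u(1)] cov_S_tangent[OF y i w(1)]])
  also have "\<dots> = g y w (ve (S i y)) * g y (Y y) u - g y u (ve (S i y)) * g y (Y y) w"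
    using nabla_S_orthogonal[OF y i u(1) w(1) Kw] nabla_S_orthogonal[OF y i w(1) u(1) Ku]
      metric_sym[OF u(1) w(1)] Kg_sym[OF u(1) w(1)] by simp
  also have "\<dots> = 0"
  proof (cases i)
    case 0
    then show ?thesis
      using metric_sym[OF u(1) ve_tangent[OF y k0]] metric_sym[OF w(1) ve_tangent[OF y k0]] by simp
  next
    case (Suc j)
    then have "j < k - 1" using i by simp
    then show ?thesis using Suc Ku Kw metric_sym[OF u(1) ve_tangent[OF y i]] metric_sym[OF w(1) ve_tangent[OF y i]]
      by simp
  qed
  finally show ?thesis using u(2) w(2) by simp
qed

text \<open>Double orthogonality for an indefinite metric, reduced to the Euclidean case: lowering
  indices in the chart turns metric products into inner products of covectors with coordinates, and
  the double orthogonal complement of a subspace of Euclidean space is that subspace. Raising the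
  index again uses that the metric matrix is invertible.\<close>

lemma orthogonal_imp_KK:
  assumes y: "y \<in> U" and w: "w \<in> tangent_space A y"
    and orth: "\<And>u. u \<in> tangent_space A y \<Longrightarrow> (\<And>j. j < k - 1 \<Longrightarrow> g y (K j y) u = 0) \<Longrightarrow> g y w u = 0"
  shows "w \<in> KK y"
proof -
  have yc: "y \<in> fst c" using y Uc by blast
  interpret coordinate_metric "snd c ` fst c" "\<lambda>z. gmat A g c (chart_inv c z)"
    using coordinate_metric[OF c] .
  let ?G = "gmat A g c y" and ?F = "span ((\<lambda>i. flat (Suc i) (snd c y)) ` {..<k - 1})"
  have inv: "invertible ?G" using G_inv[OF imageI[OF yc]] yc c by simp
  have "?G *v w c \<in> (?F\<^sup>\<bottom>)\<^sup>\<bottom>"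
    unfolding orthogonal_comp_def[of "?F\<^sup>\<bottom>"] mem_Collect_eq
  proof
    fix a assume a: "a \<in> ?F\<^sup>\<bottom>"
    define u where "u = coord_vec A c a y"
    have u: "u \<in> tangent_space A y" "u c = a"
      unfolding u_def using coord_vec_tangent[OF c yc] coord_vec_self[OF c yc] by auto
    have "g y (K j y) u = 0" if j: "j < k - 1" for j
    proof -
      have "flat (Suc j) (snd c y) \<in> ?F" by (rule span_base) (use j in auto)
      then have "flat (Suc j) (snd c y) \<bullet> a = 0" using a unfolding orthogonal_comp_def orthogonal_def by blast
      then show ?thesis using flat_inner[OF y Suc_k[OF j] u(1)] u(2) by simp
    qed
    from orth[OF u(1) this] have "(?G *v w c) \<bullet> a = 0" using metric_chart[OF c yc w u(1)] u(2) by simp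
    then show "orthogonal a (?G *v w c)" by (simp add: orthogonal_def inner_commute)
  qed
  then have "?G *v w c \<in> ?F" using orthogonal_comp_self[OF subspace_span] by blast
  also have "?F = (\<lambda>v. ?G *v v) ` span ((\<lambda>i. K i y c) ` {..<k - 1})"
    using linear_span_image[OF matrix_vector_mul_linear[of ?G], of "(\<lambda>i. K i y c) ` {..<k - 1}"] yc c
    by (simp add: image_image)
  finally obtain v where v: "v \<in> span ((\<lambda>i. K i y c) ` {..<k - 1})" "?G *v w c = ?G *v v" by auto
  have "w c = matrix_inv ?G *v (?G *v w c)" by (simp add: matrix_vector_mul_assoc matrix_inv_mult[OF inv])
  also have "\<dots> = v" unfolding v(2) by (simp add: matrix_vector_mul_assoc matrix_inv_mult[OF inv])
  finally have "w = coord_vec A c v y" using tangent_coord_vec[OF w c yc] by simp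
  also have "\<dots> \<in> (\<lambda>v. coord_vec A c v y) ` span ((\<lambda>i. K i y c) ` {..<k - 1})" using v(1) by (rule imageI)
  also have "\<dots> = span ((\<lambda>v. coord_vec A c v y) ` (\<lambda>i. K i y c) ` {..<k - 1})"
    by (rule linear_span_image[OF coord_vec_linear[OF c yc], symmetric])
  also have "(\<lambda>v. coord_vec A c v y) ` (\<lambda>i. K i y c) ` {..<k - 1} = (\<lambda>i. K i y) ` {..<k - 1}"
    unfolding image_image
    by (rule image_cong[OF refl]) (use tangent_coord_vec[OF ve_tangent[OF y Suc_k] c yc] in auto)
  finally show ?thesis .
qed

text \<open>Solves \<open>d\<sigma> = - g(Y, \<cdot>)\<close> along the vectors orthogonal to all \<open>K i\<close>.\<close>

lemma rescaling:
  assumes x: "x \<in> U"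
  obtains V \<sigma> where "open V" "x \<in> V" "V \<subseteq> U" "smooth_map A V \<sigma>"
    "\<And>y u. y \<in> V \<Longrightarrow> u \<in> tangent_space A y \<Longrightarrow> \<forall>j<k - 1. g y (K j y) u = 0 \<Longrightarrow>
      cderiv c \<sigma> y (u c) = - g y (Y y) u"
proof -
  have xc: "x \<in> fst c" using x Uc by blast
  have UU: "U \<inter> fst c = U" using Uc by blast
  have op: "open (snd c ` U)" using chart_image_open[OF c U] UU by simp
  \<comment> \<open>Lowering is injective because \<open>g\<close> is nondegenerate, so independence
    passes from the \<open>K i\<close> to their covectors; this provides the dual vectors
    \<open>e\<close>.\<close>
  have indep: "a i = 0" if 0: "(\<Sum>i<k - 1. a i *\<^sub>R flat (Suc i) (snd c x)) = 0" and i: "i < k - 1" for a i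
  proof -
    define w where "w = (\<Sum>i<k - 1. a i *\<^sub>R K i x)"
    have w: "w \<in> tangent_space A x" unfolding w_def
      by (intro subspace_sum subspace_scale subspace_tangent_space ve_tangent x Suc_k) auto
    have "w = 0"
    proof (rule metric_nondegenerate[OF w])
      fix u assume u: "u \<in> tangent_space A x"
      have "g x w u = (\<Sum>i<k - 1. a i * g x (K i x) u)"
        unfolding w_def by (rule metric_sum[OF _ u]) (use ve_tangent[OF x Suc_k] in auto)
      also have "\<dots> = (\<Sum>i<k - 1. a i *\<^sub>R flat (Suc i) (snd c x)) \<bullet> u c"
        using flat_inner[OF x Suc_k u] by (simp add: inner_sum_left)
      finally show "g x w u = 0" using 0 by simp
    qed
    then show ?thesis using K_independent[OF x, of a i] i by (simp only: w_def)
  qed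
  obtain e where dual: "\<And>i j. i < k - 1 \<Longrightarrow> j < k - 1 \<Longrightarrow> flat (Suc i) (snd c x) \<bullet> e j = (if i = j then 1 else 0)"
  proof (rule dual_family[where b = "\<lambda>i. flat (Suc i) (snd c x)" and m = "k - 1"])
    show "a i = 0" if "(\<Sum>i<k - 1. a i *\<^sub>R flat (Suc i) (snd c x)) = 0" "i < k - 1" for a i
      by (rule indep[OF that])
  qed (rule that)
  have cl: "frechet_derivative (flat i) (at z) u \<bullet> w = frechet_derivative (flat i) (at z) w \<bullet> u"
    if z: "z \<in> snd c ` U" and u: "\<And>j. j < k - 1 \<Longrightarrow> flat (Suc j) z \<bullet> u = 0"
      and w: "\<And>j. j < k - 1 \<Longrightarrow> flat (Suc j) z \<bullet> w = 0" and i: "i < k"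
    for z u w i
  proof -
    obtain y where y: "y \<in> U" "z = snd c y" using z by blast
    show ?thesis using flat_closed[OF i y(1), of u w] u w unfolding y(2) by blast
  qed
  obtain r \<tau> where r: "r > 0" "ball (snd c x) r \<subseteq> snd c ` U" and s\<tau>: "smooth_on \<tau> (ball (snd c x) r)"
    and d\<tau>: "\<And>z u. z \<in> ball (snd c x) r \<Longrightarrow> (\<And>j. j < k - 1 \<Longrightarrow> flat (Suc j) z \<bullet> u = 0) \<Longrightarrow>
      frechet_derivative \<tau> (at z) u = flat 0 z \<bullet> u"
  proof (rule primitive_along_integrable_distribution[where \<kappa> = "\<lambda>i. flat (Suc i)" and \<eta> = "flat 0" and m = "k - 1"
        and e = e, OF op imageI[OF x]])
    show "smooth_on (flat (Suc i)) (snd c ` U)" if "i < k - 1" for i by (rule smooth_flat[OF Suc_k[OF that]])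
    show "smooth_on (flat 0) (snd c ` U)" by (rule smooth_flat[OF k0])
    show "flat (Suc i) (snd c x) \<bullet> e j = (if i = j then 1 else 0)" if "i < k - 1" "j < k - 1" for i j
      by (rule dual[OF that])
    show "frechet_derivative (flat (Suc i)) (at z) u \<bullet> w = frechet_derivative (flat (Suc i)) (at z) w \<bullet> u"
      if "z \<in> snd c ` U" "\<And>j. j < k - 1 \<Longrightarrow> flat (Suc j) z \<bullet> u = 0" "\<And>j. j < k - 1 \<Longrightarrow> flat (Suc j) z \<bullet> w = 0" "i < k - 1"
      for z u w i
      by (rule cl[OF that(1-3) Suc_k[OF that(4)]])
    show "frechet_derivative (flat 0) (at z) u \<bullet> w = frechet_derivative (flat 0) (at z) w \<bullet> u"
      if "z \<in> snd c ` U" "\<And>j. j < k - 1 \<Longrightarrow> flat (Suc j) z \<bullet> u = 0" "\<And>j. j < k - 1 \<Longrightarrow> flat (Suc j) z \<bullet> w = 0"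
      for z u w
      by (rule cl[OF that k0])
  next
    fix r \<tau> assume *: "r > 0" "ball (snd c x) r \<subseteq> snd c ` U" "smooth_on \<tau> (ball (snd c x) r)"
      "\<And>z u. z \<in> ball (snd c x) r \<Longrightarrow> (\<And>j. j < k - 1 \<Longrightarrow> flat (Suc j) z \<bullet> u = 0) \<Longrightarrow>
        frechet_derivative \<tau> (at z) u = flat 0 z \<bullet> u"
    show thesis
    proof (rule that[OF *(1-3)])
      fix z u assume "z \<in> ball (snd c x) r" "\<And>j. j < k - 1 \<Longrightarrow> flat (Suc j) z \<bullet> u = 0"
      then show "frechet_derivative \<tau> (at z) u = flat 0 z \<bullet> u" by (rule *(4))
    qed
  qed
  define V where "V = U \<inter> (fst c \<inter> snd c -` ball (snd c x) r)"
  \<comment> \<open>The primitive reproduces \<open>+ g(Y, _)\<close>, while the change of gauge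
    adds \<open>grad \<sigma>\<close> to \<open>Y\<close>; the sign makes the two cancel along the
    distribution.\<close>
  define \<sigma> where "\<sigma> y = - \<tau> (snd c y)" for y
  have cont: "continuous_on (fst c) (snd c)" using chart_homeo[OF c] unfolding homeomorphism_def by (elim conjE)
  have V: "open V" "x \<in> V" "V \<subseteq> U" "V \<subseteq> fst c" "snd c ` V \<subseteq> ball (snd c x) r"
    using continuous_open_preimage[OF cont chart_open(1)[OF c] open_ball] U x xc r(1) by (auto simp: V_def)
  have VV: "V \<inter> fst c = V" using V by blast
  have opV: "open (snd c ` V)" using chart_image_open[OF c V(1)] VV by simp
  have s\<sigma>: "smooth_map A V \<sigma>"
    unfolding \<sigma>_def
    by (rule smooth_map_of_chart[OF c V(1,4) smooth_on_minus[OF opV smooth_on_subset[OF s\<tau> V(5)]]])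
  show ?thesis
  proof (rule that[OF V(1-3) s\<sigma>])
    fix y u assume y: "y \<in> V" and u: "u \<in> tangent_space A y" and orth: "\<forall>j<k - 1. g y (K j y) u = 0"
    have yU: "y \<in> U" and yb: "snd c y \<in> ball (snd c x) r" using y V by auto
    have "((\<lambda>z. - \<tau> z) has_derivative (\<lambda>w. - frechet_derivative \<tau> (at (snd c y)) w)) (at (snd c y))"
      by (rule has_derivative_minus[OF smooth_on_has_derivative[OF s\<tau> yb]])
    then have "((\<lambda>z. \<sigma> (chart_inv c z)) has_derivative (\<lambda>w. - frechet_derivative \<tau> (at (snd c y)) w)) (at (snd c y))"
      by (rule has_derivative_transform_within_open[OF _ opV imageI[OF y]]) (use V c in \<open>auto simp: \<sigma>_def subset_iff\<close>)
    from cderiv_eqI[OF this] have "cderiv c \<sigma> y (u c) = - frechet_derivative \<tau> (at (snd c y)) (u c)" by simp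
    also have "frechet_derivative \<tau> (at (snd c y)) (u c) = flat 0 (snd c y) \<bullet> u c"
      using flat_inner[OF yU Suc_k u] orth by (intro d\<tau>[OF yb]) simp
    also have "\<dots> = g y (Y y) u" by (rule flat_inner[OF yU k0 u])
    finally show "cderiv c \<sigma> y (u c) = - g y (Y y) u" .
  qed
qed

section \<open>The distribution in the rescaled gauge\<close>

lemma H_span: "y \<in> U \<Longrightarrow> H y = span (insert (S 0 y) ((\<lambda>i. S (Suc i) y) ` {..<k - 1}))"
proof -
  have "{..<k} = insert 0 (Suc ` {..<k - 1})" using k0 by (auto simp: image_iff gr0_conv_Suc less_Suc_eq_0_disj)
  then show "y \<in> U \<Longrightarrow> ?thesis" by (simp add: span_S image_image)
qed

lemma local_form:
  assumes x: "x \<in> U"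
  shows "\<exists>V h. open V \<and> x \<in> V \<and> V \<subseteq> U \<and> h \<in> conf_restrict A cc V \<and>
    (\<exists>L. (\<forall>i<k - 1. lightlike_vf A V h (L i)) \<and>
      (\<forall>y\<in>V. (\<lambda>t. t (V, h)) ` H y = span ((\<lambda>i. (0, L i y, 0)) ` {..<k - 1} \<union> {(0, 0, 1)})))"
proof -
  obtain V \<sigma> where V: "open V" "x \<in> V" "V \<subseteq> U" and s\<sigma>: "smooth_map A V \<sigma>"
    and d\<sigma>: "\<And>y u. y \<in> V \<Longrightarrow> u \<in> tangent_space A y \<Longrightarrow> \<forall>j<k - 1. g y (K j y) u = 0 \<Longrightarrow>
      cderiv c \<sigma> y (u c) = - g y (Y y) u"
    by (rule rescaling[OF x]) (rule that)
  define h where "h = (\<lambda>y u v. exp (2 * \<sigma> y) * g y u v)"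
  have conf: "conf_rel A V \<sigma> g h" unfolding conf_rel_def h_def using s\<sigma> by simp
  have restr: "h \<in> conf_restrict A cc V" unfolding conf_restrict_def using g_in_class conf by blast
  have gauge: "(V, h) \<in> gauges_at A cc y" if "y \<in> V" for y
    using V(1) that restr by (simp add: gauges_at_def)
  \<comment> \<open>The vector part of \<open>S (Suc i) y\<close> after the change of gauge; there
    is no gradient term as \<beta> = 0.\<close>
  define L where "L i y = exp (- \<sigma> y) *\<^sub>R K i y" for i y
  have L_lightlike: "lightlike_vf A V h (L i)" if i: "i < k - 1" for i
    unfolding lightlike_vf_def
  proof (intro conjI ballI)
    have "smooth_map A V (\<lambda>y. 0 - \<sigma> y)" by (intro smooth_map_diff V(1) smooth_map_const s\<sigma>)
    then have e: "smooth_map A V (\<lambda>y. exp (- \<sigma> y))" using smooth_map_exp[OF V(1)] by simp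
    show "smooth_vf A V (L i)"
      unfolding smooth_vf_def
    proof (intro conjI ballI)
      fix y assume "y \<in> V"
      then show "L i y \<in> tangent_space A y"
        unfolding L_def by (intro subspace_scale subspace_tangent_space ve_tangent Suc_k i) (use V in auto)
    next
      fix d assume d: "d \<in> A"
      have Vd: "open (V \<inter> fst d)" using V(1) chart_open(1)[OF d] by auto
      have "smooth_map A (U \<inter> fst d) (\<lambda>y. K i y d)"
        using smooth_section_g(2)[OF section_S[OF Suc_k[OF i]]] d unfolding smooth_vf_def by blast
      then have "smooth_map A (V \<inter> fst d) (\<lambda>y. K i y d)" by (rule smooth_map_subset) (use V in auto)
      then have "smooth_map A (V \<inter> fst d) (\<lambda>y. exp (- \<sigma> y) *\<^sub>R K i y d)"
        by (intro smooth_map_scaleR Vd smooth_map_subset[OF e]) auto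
      then show "smooth_map A (V \<inter> fst d) (\<lambda>y. L i y d)" by (simp add: L_def scaleR_fun_def)
    qed
    fix y assume y: "y \<in> V"
    have yU: "y \<in> U" using y V by auto
    show "L i y \<noteq> 0"
    proof
      assume "L i y = 0"
      then have K0: "K i y = 0" by (simp add: L_def)
      \<comment> \<open>Independence applied to the coefficients of a single field: none of the
        \<open>K i\<close> vanishes anywhere.\<close>
      have "(\<Sum>j<k - 1. (if j = i then 1 else 0) *\<^sub>R K j y) = (\<Sum>j<k - 1. 0)"
        by (rule sum.cong) (use K0 in auto)
      then have "(if i = i then 1 else 0) = (0 :: real)"
        by (intro K_independent[OF yU _ i, where a = "\<lambda>j. if j = i then 1 else 0"]) simp
      then show False by simp
    qed
    have T: "K i y \<in> tangent_space A y" by (rule ve_tangent[OF yU Suc_k[OF i]])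
    have LT: "L i y \<in> tangent_space A y" unfolding L_def by (intro subspace_scale subspace_tangent_space T)
    have "g y (L i y) (L i y) = exp (- \<sigma> y) * g y (K i y) (L i y)"
      using metric_scale[OF T LT] by (simp add: L_def)
    also have "g y (K i y) (L i y) = g y (L i y) (K i y)" by (rule metric_sym[OF T LT])
    also have "\<dots> = exp (- \<sigma> y) * g y (K i y) (K i y)" using metric_scale[OF T T] by (simp add: L_def)
    finally show "h y (L i y) (L i y) = 0" using K_null[OF yU i i] by (simp add: h_def)
  qed
  have "(\<lambda>t. t (V, h)) ` H y = span ((\<lambda>i. (0, L i y, 0)) ` {..<k - 1} \<union> {(0, 0, 1)})" if y: "y \<in> V" for y
  proof -
    have yU: "y \<in> U" and yc: "y \<in> fst c" using y V Uc by auto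
    have d: "((\<lambda>z. \<sigma> (chart_inv c z)) has_derivative cderiv c \<sigma> y) (at (snd c y))"
      by (rule smooth_map_has_derivative[OF s\<sigma> c y yc])
    have dir: "dir_deriv A y v \<sigma> = cderiv c \<sigma> y (v c)" if "v \<in> tangent_space A y" for v
      by (rule dir_deriv_chart[OF c yc that d])
    \<comment> \<open>Up to the factor \<open>exp (- \<sigma> y)\<close> this is the vector part of
      \<open>S 0 y\<close> in the new gauge. By the equation for \<open>\<sigma>\<close> it is
      orthogonal to everything orthogonal to the \<open>K i\<close>, hence lies in their
      span.\<close>
    define W where "W = grad A g \<sigma> y + Y y"
    have YT: "Y y \<in> tangent_space A y" by (rule ve_tangent[OF yU k0])
    have gT: "grad A g \<sigma> y \<in> tangent_space A y" by (rule grad(1)[OF c yc d])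
    have WT: "W \<in> tangent_space A y" unfolding W_def by (intro subspace_add subspace_tangent_space gT YT)
    have W_KK: "W \<in> KK y"
    proof (rule orthogonal_imp_KK[OF yU WT])
      fix u assume u: "u \<in> tangent_space A y" "\<And>j. j < k - 1 \<Longrightarrow> g y (K j y) u = 0"
      show "g y W u = 0"
        unfolding W_def metric_add[OF gT YT u(1)] grad(2)[OF c yc d u(1)] using d\<sigma>[OF y u(1)] u(2) by simp
    qed
    have change: "S i y (V, h) = change_gauge A g \<sigma> y (al (S i y), ve (S i y), be (S i y))" if "i < k" for i
    proof -
      have tS: "S i y \<in> tractor_space A cc y" using S_H[OF yU that] H_tractor by blast
      then show ?thesis using tractor_change[OF tS gauge[OF y] conf] by simp
    qed
    \<comment> \<open>\<open>K i y\<close> is itself orthogonal to all \<open>K j y\<close>, so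
      \<open>d\<sigma>\<close> may be applied to it: the derivative of \<open>\<sigma>\<close> along
      it is \<open>- g y (Y y) (K i y)\<close>, which equals \<alpha> by \<open>al_Suc\<close>, and
      the new first component is 0.\<close>
    have S_Suc: "S (Suc i) y (V, h) = (0, L i y, 0)" if i: "i < k - 1" for i
    proof -
      have T: "K i y \<in> tangent_space A y" by (rule ve_tangent[OF yU Suc_k[OF i]])
      have "cderiv c \<sigma> y (K i y c) = - g y (Y y) (K i y)"
        by (rule d\<sigma>[OF y T]) (use K_null[OF yU _ i] in blast)
      then show ?thesis
        using change[OF Suc_k[OF i]] be_Suc[OF yU Suc_k[OF i]] dir[OF T] al_Suc[OF yU i] by (simp add: L_def)
    qed
    \<comment> \<open>Inserting \<open>al_0\<close>, the new first component is
      \<open>exp (- \<sigma> y)\<close> times \<open>- 1/2 * g y W W\<close>. It vanishes since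
      \<open>W\<close> lies in the span of the \<open>K i\<close>, all of whose elements are
      null.\<close>
    have S_0: "S 0 y (V, h) = (0, exp (- \<sigma> y) *\<^sub>R W, exp (\<sigma> y))"
    proof -
      let ?g = "grad A g \<sigma> y"
      have "g y W W = g y ?g W + g y (Y y) W" using metric_add[OF gT YT WT] by (simp only: W_def)
      then have "g y W ?g + g y W (Y y) = 0"
        using KK_null[OF yU W_KK] metric_sym[OF gT WT] metric_sym[OF YT WT] by simp
      then have "g y ?g ?g + g y (Y y) ?g + (g y ?g (Y y) + g y (Y y) (Y y)) = 0"
        by (simp only: W_def metric_add[OF gT YT gT] metric_add[OF gT YT YT])
      then have "g y ?g ?g = - 2 * g y ?g (Y y) - g y (Y y) (Y y)"
        using metric_sym[OF gT YT] by simp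
      moreover have "dir_deriv A y (Y y) \<sigma> = g y ?g (Y y)"
        using dir[OF YT] grad(2)[OF c yc d YT] by simp
      ultimately show ?thesis
        using change[OF k0] be_0[OF yU] al_0[OF yU] by (simp add: W_def add.commute)
    qed
    define N where "N = (\<lambda>i. (0 :: real, L i y, 0 :: real)) ` {..<k - 1}"
    \<comment> \<open>The vector part of \<open>S 0 y\<close> in the new gauge. It is already a
      combination of the \<open>(0, L i y, 0)\<close>, so removing it leaves a nonzero multiple of
      \<open>(0, 0, 1)\<close>.\<close>
    define q where "q = (0 :: real, exp (- \<sigma> y) *\<^sub>R W, 0 :: real)"
    have q: "q \<in> span N"
    proof -
      have lin: "linear (\<lambda>v :: ('a, 'n) tvec. (0 :: real, exp (- \<sigma> y) *\<^sub>R v, 0 :: real))"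
        by (rule linearI) (simp_all add: scaleR_add_right scaleR_left_commute)
      have "q \<in> (\<lambda>v. (0, exp (- \<sigma> y) *\<^sub>R v, 0)) ` KK y" unfolding q_def using W_KK by (rule imageI)
      also have "\<dots> = span ((\<lambda>v. (0, exp (- \<sigma> y) *\<^sub>R v, 0)) ` (\<lambda>i. K i y) ` {..<k - 1})"
        by (rule linear_span_image[OF lin, symmetric])
      finally show ?thesis by (simp add: N_def L_def image_image)
    qed
    have eq: "S 0 y (V, h) = q + exp (\<sigma> y) *\<^sub>R (0, 0, 1)" by (simp add: S_0 q_def)
    have "(\<lambda>t. t (V, h)) ` H y = span ((\<lambda>t. t (V, h)) ` insert (S 0 y) ((\<lambda>i. S (Suc i) y) ` {..<k - 1}))"
      unfolding H_span[OF yU] by (rule linear_span_image[OF linear_eval, symmetric])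
    also have "(\<lambda>t. t (V, h)) ` insert (S 0 y) ((\<lambda>i. S (Suc i) y) ` {..<k - 1}) = insert (S 0 y (V, h)) N"
      using S_Suc by (auto simp: N_def image_image intro!: image_cong)
    also have "span (insert (S 0 y (V, h)) N) = span (N \<union> {(0, 0, 1)})"
    proof
      have N1: "N \<subseteq> span (N \<union> {(0, 0, 1)})" using span_superset by blast
      have "S 0 y (V, h) \<in> span (N \<union> {(0, 0, 1)})"
        unfolding eq using q span_mono[of N "N \<union> {(0, 0, 1)}"]
        by (intro span_add span_scale) (auto intro: span_base)
      with N1 show "span (insert (S 0 y (V, h)) N) \<subseteq> span (N \<union> {(0, 0, 1)})"
        by (intro span_minimal subspace_span) auto
      have N2: "N \<subseteq> span (insert (S 0 y (V, h)) N)" using span_superset by blast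
      have "q \<in> span (insert (S 0 y (V, h)) N)" using q span_mono[of N "insert (S 0 y (V, h)) N"] by blast
      then have "exp (- \<sigma> y) *\<^sub>R (S 0 y (V, h) - q) \<in> span (insert (S 0 y (V, h)) N)"
        by (intro span_scale span_diff) (auto intro: span_base)
      moreover have "exp (- \<sigma> y) *\<^sub>R (S 0 y (V, h) - q) = (0, 0, 1)"
        unfolding eq by (simp add: exp_minus)
      ultimately show "span (N \<union> {(0, 0, 1)}) \<subseteq> span (insert (S 0 y (V, h)) N)"
        using N2 by (intro span_minimal subspace_span) auto
    qed
    finally show ?thesis by (simp add: N_def)
  qed
  then show ?thesis using V restr L_lightlike by blast
qed

end

section \<open>From the local normal form to an open dense set\<close>

theorem proposition3p1:
  fixes A :: "('a::{t2_space, second_countable_topology}, 'n::finite) chart set"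
    and c :: "('a, 'n) metric set"
    and p q k :: nat
    and TOr SOr :: "'a \<Rightarrow> (nat \<Rightarrow> ('a, 'n) tvec) set"
    and H :: "'a \<Rightarrow> ('a, 'n) tractor set"
  assumes "conformal_manifold A p q c TOr SOr"
    and "p + q \<ge> 3"
    and "k \<ge> 1"
    and "tractor_distribution A c k H"
    and "totally_lightlike A c H"
    and "parallel A c H"
  shows "\<exists>Mt. open Mt \<and> closure Mt = UNIV \<and>
    (\<forall>x\<in>Mt. \<exists>U g. open U \<and> x \<in> U \<and> U \<subseteq> Mt \<and> g \<in> conf_restrict A c U \<and>
      (\<exists>K :: nat \<Rightarrow> 'a \<Rightarrow> ('a, 'n) tvec.
        (\<forall>i<k - 1. lightlike_vf A U g (K i)) \<and>
        (\<forall>y\<in>U. (\<lambda>t. t (U, g)) ` H y =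
           span ((\<lambda>i. (0, K i y, 0)) ` {..<k - 1} \<union> {(0, 0, 1)}))))"
proof -
  have atlas: "smooth_atlas A" and conf: "conformal_class A p q c"
    using assms(1) by (auto simp: conformal_manifold_def manifold_def)
  then obtain g where g: "g \<in> c" "is_metric A p q UNIV g" "\<forall>h. h \<in> c \<longleftrightarrow> (\<exists>\<sigma>. conf_rel A UNIV \<sigma> g h)"
    unfolding conformal_class_def by blast
  interpret lightlike_tractors A p q g c k H
    by (intro lightlike_tractors.intro pseudo_riemannian.intro smooth_manifold.intro
        pseudo_riemannian_axioms.intro lightlike_tractors_axioms.intro)
      (rule atlas g(2) g(3)[rule_format] assms(3-6))+
  \<comment> \<open>Although \<open>be\<close> refers to the chosen \<open>g\<close>, a rescaling
    multiplies the third component by a positive factor, so another metric of the class defines the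
    same set.\<close>
  define Mt where "Mt = {x. \<exists>t\<in>H x. be t \<noteq> 0}"
  have local: "\<exists>U h. open U \<and> x \<in> U \<and> U \<subseteq> Mt \<and> h \<in> conf_restrict A c U \<and>
      (\<exists>K :: nat \<Rightarrow> 'a \<Rightarrow> ('a, 'n) tvec. (\<forall>i<k - 1. lightlike_vf A U h (K i)) \<and>
        (\<forall>y\<in>U. (\<lambda>t. t (U, h)) ` H y = span ((\<lambda>i. (0, K i y, 0)) ` {..<k - 1} \<union> {(0, 0, 1)})))"
    if x_Mt: "x \<in> Mt" for x
  proof -
    obtain t where "t \<in> H x" "be t \<noteq> 0" using x_Mt unfolding Mt_def by blast
    then obtain U ch S where x: "x \<in> U" and frame: "adapted_frame A p q g c k H U ch S"
      by (rule adapted_frame_exists)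
    interpret adapted_frame A p q g c k H U ch S by (rule frame)
    have "U \<subseteq> Mt"
    proof
      fix y assume y: "y \<in> U"
      have "be (S 0 y) \<noteq> 0" using be_0[OF y] by simp
      then show "y \<in> Mt" using S_H[OF y k0] by (auto simp: Mt_def)
    qed
    then show ?thesis using local_form[OF x] by (meson order_trans)
  qed
  have "open Mt"
  proof (subst open_subopen, intro ballI)
    fix x assume "x \<in> Mt"
    from local[OF this] show "\<exists>T. open T \<and> x \<in> T \<and> T \<subseteq> Mt" by (elim exE conjE) (intro exI conjI)
  qed
  moreover have "closure Mt = UNIV"
  proof (rule ccontr)
    assume "closure Mt \<noteq> UNIV"
    then obtain x where x: "x \<in> - closure Mt" by blast
    obtain y t where y: "y \<in> - closure Mt" and t: "t \<in> H y" "be t \<noteq> 0"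
      using generic_point[OF open_Compl[OF closed_closure] x] by (elim bexE) (rule that)
    have "y \<in> Mt" unfolding Mt_def using t by (intro CollectI bexI)
    then show False using y closure_subset[of Mt] by blast
  qed
  ultimately show ?thesis
    by (intro exI[of _ Mt] conjI ballI local)
qed

end
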